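(* Assume $X$ satisfies condition (P). Let $x,w\in W_c$ with $x<w$, and suppose there exists $s\in S$ with $sw<w$ and $x<sx\in W_c$. Then $$L_{x,w}=q^{-1/2}L_{sx,w}-\sum_{\substack{z\in(x,w)_c\\ sz\notin W_c}}q^{(\ell(x)-\ell(z))/2}\,D_{sx,sz}\,L_{z,w}.$$
   Context: Let $X$ be a Coxeter graph with Coxeter system $(W,S)$, length function $\ell$, Bruhat order $\le$, identity $e$; write $\varepsilon_w=(-1)^{\ell(w)}$ and $\ell(x,w)=\ell(w)-\ell(x)$. An element of $W$ is fully commutative if any two of its reduced expressions are related by a sequence of moves $ss'\leftrightarrow s's$ with $s,s'\in S$ commuting; $W_c$ denotes the set of fully commutative elements, $[x,w]_c=\{y\in W_c:x\le y\le w\}$ and $(x,w)_c=\{y\in W_c:x<y<w\}$. $\mathcal H$ is the Hecke algebra of $W$ over $\mathcal A=\mathbb Z[q^{1/2},q^{-1/2}]$ with basis $\{T_w\}_{w\in W}$ and multiplication $T_wT_s=T_{ws}$ if $\ell(ws)>\ell(w)$, $T_wT_s=qT_{ws}+(q-1)T_w$ if $\ell(ws)<\ell(w)$. $J$ is the two-sided ideal generated by the elements $\sum_{w\in\langle s,s'\rangle}T_w$ for all pairs of non-commuting $s,s'\in S$ such that $ss'$ has finite order; $TL(X)=\mathcal H/J$, $\sigma:\mathcal H\to TL(X)$ the projection, $t_w=\sigma(T_w)$. $\{t_w:w\in W_c\}$ is an $\mathcal A$-basis of $TL(X)$; for $w\in W$ the polynomials $D_{x,w}\in\mathbb Z[q]$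 ($x\in W_c$) are defined by $t_w=\sum_{x\in W_c,\,x\le w}D_{x,w}t_x$, with $D_{x,w}=0$ if $x\not\le w$ (so $D_{x,w}=\delta_{x,w}$ when $w\in W_c$). Let $\iota$ be the ring involution of $\mathcal H$ with $\iota(q^{1/2})=q^{-1/2}$, $\iota(T_w)=(T_{w^{-1}})^{-1}$; it preserves $J$ and so induces an involution of $TL(X)$. $R_{x,w}$ are the $R$-polynomials, defined by $(T_{w^{-1}})^{-1}=\varepsilon_wq^{-\ell(w)}\sum_{x\le w}\varepsilon_xR_{x,w}T_x$, and $P_{x,w}$ are the Kazhdan–Lusztig polynomials, so that $C'_w=q^{-\ell(w)/2}\sum_{x\le w}P_{x,w}T_x$ is $\iota$-invariant, $P_{w,w}=1$, $\deg P_{x,w}\le(\ell(x,w)-1)/2$ for $x<w$. For $w\in W_c$, the polynomials $a_{y,w}\in\mathbb Z[q]$ ($y\in W_c$) are defined by $\iota(t_w)=(t_{w^{-1}})^{-1}=q^{-\ell(w)}\sum_{y\in W_c,\,y\le w}a_{y,w}t_y$, $a_{y,w}=0$ if $y\not\le w$. Let $p\mapsto\overline p$ be the ring involution of $\mathbb Z[q^{1/2},q^{-1/2}]$ with $q^{1/2}\mapsto q^{-1/2}$. For $w\in W_c$, $\{L_{x,w}\}_{x\in W_c}$ is the unique family in $\mathbb Z[q^{-1/2}]$ with $L_{x,w}=0$ if $x\not\le w$, $L_{w,w}=1$, $L_{x,w}\in q^{-1/2}\mathbb Z[q^{-1/2}]$ if $x<w$, and $L_{x,w}=\sum_{y\in[x,w]_c}q^{(\ell(x)-\ell(y))/2}a_{x,y}\,\overline{L_{y,w}}$;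 set $c_w=\sum_{x\in W_c,\,x\le w}q^{-\ell(x)/2}L_{x,w}t_x$. Condition (P) on $X$: $\sigma(C'_w)=c_w$ for all $w\in W_c$ and $\sigma(C'_w)=0$ for all $w\in W\setminus W_c$. (For finite irreducible or affine $X$, this holds exactly when $X$ has no vertex adjacent to three or more vertices and $X\neq\widetilde F_4$; in particular types $A$, $B$, $F_4$, $H_3$, $H_4$, $I_2(m)$.) *)

theory Defs
  imports "HOL-Library.Extended_Nat" "HOL-Computational_Algebra.Formal_Laurent_Series"
begin

text \<open>A Coxeter graph on the vertex set S is encoded by its Coxeter matrix
  m :: 'a => 'a => enat (m s t = infinity allowed).  The Coxeter group W is the
  group with presentation: generators S, relations s s = 1 and the braid relations
  (s t s ...) = (t s t ...) (m s t factors each) whenever m s t is finite.  Elements of W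
  are the equivalence classes of words over S (type 'a list set).\<close>

definition coxeter_graph :: "'a set \<Rightarrow> ('a \<Rightarrow> 'a \<Rightarrow> enat) \<Rightarrow> bool" where
  "coxeter_graph S m \<longleftrightarrow>
     (\<forall>s\<in>S. \<forall>t\<in>S. m s t = m t s \<and> (s = t \<longrightarrow> m s t = 1) \<and> (s \<noteq> t \<longrightarrow> 2 \<le> m s t))"

fun alt_word :: "'a \<Rightarrow> 'a \<Rightarrow> nat \<Rightarrow> 'a list" where
  "alt_word s t 0 = []"
| "alt_word s t (Suc k) = s # alt_word t s k"

inductive_set cox_step :: "'a set \<Rightarrow> ('a \<Rightarrow> 'a \<Rightarrow> enat) \<Rightarrow> ('a list \<times> 'a list) set"
  for S m where
  del: "u \<in> lists S \<Longrightarrow> v \<in> lists S \<Longrightarrow> s \<in> S \<Longrightarrow> (u @ [s, s] @ v, u @ v) \<in> cox_step S m"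
| braid: "u \<in> lists S \<Longrightarrow> v \<in> lists S \<Longrightarrow> s \<in> S \<Longrightarrow> t \<in> S \<Longrightarrow> s \<noteq> t \<Longrightarrow> m s t = enat k \<Longrightarrow>
     (u @ alt_word s t k @ v, u @ alt_word t s k @ v) \<in> cox_step S m"

definition cox_equiv :: "'a set \<Rightarrow> ('a \<Rightarrow> 'a \<Rightarrow> enat) \<Rightarrow> ('a list \<times> 'a list) set" where
  "cox_equiv S m = (cox_step S m \<union> (cox_step S m)\<inverse>)\<^sup>*"

definition cox_cls :: "'a set \<Rightarrow> ('a \<Rightarrow> 'a \<Rightarrow> enat) \<Rightarrow> 'a list \<Rightarrow> 'a list set" where
  "cox_cls S m u = cox_equiv S m `` {u}"

definition cox_W :: "'a set \<Rightarrow> ('a \<Rightarrow> 'a \<Rightarrow> enat) \<Rightarrow> 'a list set set" where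
  "cox_W S m = cox_cls S m ` lists S"

definition cox_rep :: "'a list set \<Rightarrow> 'a list" where
  "cox_rep w = (SOME u. u \<in> w)"

definition cox_mult :: "'a set \<Rightarrow> ('a \<Rightarrow> 'a \<Rightarrow> enat) \<Rightarrow> 'a list set \<Rightarrow> 'a list set \<Rightarrow> 'a list set" where
  "cox_mult S m x y = cox_cls S m (cox_rep x @ cox_rep y)"

definition cox_one :: "'a set \<Rightarrow> ('a \<Rightarrow> 'a \<Rightarrow> enat) \<Rightarrow> 'a list set" where
  "cox_one S m = cox_cls S m []"

definition cox_gen :: "'a set \<Rightarrow> ('a \<Rightarrow> 'a \<Rightarrow> enat) \<Rightarrow> 'a \<Rightarrow> 'a list set" where
  "cox_gen S m s = cox_cls S m [s]"

definition cox_inv :: "'a set \<Rightarrow> ('a \<Rightarrow> 'a \<Rightarrow> enat) \<Rightarrow> 'a list set \<Rightarrow> 'a list set" where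
  "cox_inv S m x = cox_cls S m (rev (cox_rep x))"

definition cox_len :: "'a list set \<Rightarrow> nat" where
  "cox_len w = (LEAST n. \<exists>u\<in>w. length u = n)"

definition red_words :: "'a list set \<Rightarrow> 'a list set" where
  "red_words w = {u \<in> w. length u = cox_len w}"

definition red_word :: "'a list set \<Rightarrow> 'a list" where
  "red_word w = (SOME u. u \<in> red_words w)"

definition comm_step :: "('a \<Rightarrow> 'a \<Rightarrow> enat) \<Rightarrow> ('a list \<times> 'a list) set" where
  "comm_step m = {(u @ [s, t] @ v, u @ [t, s] @ v) | u v s t. m s t = enat 2}"

definition cox_Wc :: "'a set \<Rightarrow> ('a \<Rightarrow> 'a \<Rightarrow> enat) \<Rightarrow> 'a list set set" where
  "cox_Wc S m = {w \<in> cox_W S m. \<forall>u\<in>red_words w. \<forall>u'\<in>red_words w. (u, u') \<in> (comm_step m)\<^sup>*}"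

definition cox_reflections :: "'a set \<Rightarrow> ('a \<Rightarrow> 'a \<Rightarrow> enat) \<Rightarrow> 'a list set set" where
  "cox_reflections S m =
     {cox_mult S m x (cox_mult S m (cox_gen S m s) (cox_inv S m x)) | x s. x \<in> cox_W S m \<and> s \<in> S}"

definition bruhat_le :: "'a set \<Rightarrow> ('a \<Rightarrow> 'a \<Rightarrow> enat) \<Rightarrow> 'a list set \<Rightarrow> 'a list set \<Rightarrow> bool" where
  "bruhat_le S m x w \<longleftrightarrow> x \<in> cox_W S m \<and> w \<in> cox_W S m \<and>
     (\<lambda>y z. \<exists>t\<in>cox_reflections S m. z = cox_mult S m y t \<and> cox_len y < cox_len z)\<^sup>*\<^sup>* x w"

definition bruhat_less :: "'a set \<Rightarrow> ('a \<Rightarrow> 'a \<Rightarrow> enat) \<Rightarrow> 'a list set \<Rightarrow> 'a list set \<Rightarrow> bool" where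
  "bruhat_less S m x w \<longleftrightarrow> bruhat_le S m x w \<and> x \<noteq> w"

text \<open>A = Z[q^(1/2), q^(-1/2)] is realised inside int fls (variable v = q^(1/2)) as
  the Laurent series with finite support.\<close>

definition vpow :: "int \<Rightarrow> int fls" where
  "vpow i = fls_X_intpow i"

definition qq :: "int fls" where
  "qq = vpow 2"

definition laurent :: "int fls \<Rightarrow> bool" where
  "laurent f \<longleftrightarrow> finite {n. fls_nth f n \<noteq> 0}"

definition lbar :: "int fls \<Rightarrow> int fls" where
  "lbar f = (\<Sum>n\<in>{n. fls_nth f n \<noteq> 0}. fls_const (fls_nth f n) * vpow (- n))"

text \<open>Elements of H are finitely supported functions W -> A (coefficients w.r.t. T_w).\<close>

definition is_hecke :: "'a set \<Rightarrow> ('a \<Rightarrow> 'a \<Rightarrow> enat) \<Rightarrow> ('a list set \<Rightarrow> int fls) \<Rightarrow> bool" where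
  "is_hecke S m h \<longleftrightarrow> finite {w. h w \<noteq> 0} \<and> (\<forall>w. h w \<noteq> 0 \<longrightarrow> w \<in> cox_W S m) \<and> (\<forall>w. laurent (h w))"

definition hT :: "'a list set \<Rightarrow> ('a list set \<Rightarrow> int fls)" where
  "hT w = (\<lambda>x. if x = w then 1 else 0)"

text \<open>Right multiplication by T_s:  T_w T_s = T_ws if l(ws) > l(w),
  T_w T_s = q T_ws + (q - 1) T_w if l(ws) < l(w).\<close>
definition rmul_gen :: "'a set \<Rightarrow> ('a \<Rightarrow> 'a \<Rightarrow> enat) \<Rightarrow> ('a list set \<Rightarrow> int fls) \<Rightarrow> 'a \<Rightarrow> ('a list set \<Rightarrow> int fls)" where
  "rmul_gen S m h s = (\<lambda>y. if y \<in> cox_W S m then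
      (if cox_len (cox_mult S m y (cox_gen S m s)) < cox_len y
       then h (cox_mult S m y (cox_gen S m s)) + (qq - 1) * h y
       else qq * h (cox_mult S m y (cox_gen S m s)))
     else 0)"

definition rmul_T :: "'a set \<Rightarrow> ('a \<Rightarrow> 'a \<Rightarrow> enat) \<Rightarrow> ('a list set \<Rightarrow> int fls) \<Rightarrow> 'a list set \<Rightarrow> ('a list set \<Rightarrow> int fls)" where
  "rmul_T S m h w = foldl (rmul_gen S m) h (red_word w)"

definition hmul :: "'a set \<Rightarrow> ('a \<Rightarrow> 'a \<Rightarrow> enat) \<Rightarrow> ('a list set \<Rightarrow> int fls) \<Rightarrow> ('a list set \<Rightarrow> int fls) \<Rightarrow> ('a list set \<Rightarrow> int fls)" where
  "hmul S m h g = (\<lambda>y. \<Sum>w\<in>{w. g w \<noteq> 0}. g w * rmul_T S m h w y)"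

definition hinv :: "'a set \<Rightarrow> ('a \<Rightarrow> 'a \<Rightarrow> enat) \<Rightarrow> ('a list set \<Rightarrow> int fls) \<Rightarrow> ('a list set \<Rightarrow> int fls)" where
  "hinv S m h = (THE g. is_hecke S m g \<and> hmul S m h g = hT (cox_one S m) \<and> hmul S m g h = hT (cox_one S m))"

definition hiota :: "'a set \<Rightarrow> ('a \<Rightarrow> 'a \<Rightarrow> enat) \<Rightarrow> ('a list set \<Rightarrow> int fls) \<Rightarrow> ('a list set \<Rightarrow> int fls)" where
  "hiota S m h = (\<lambda>y. \<Sum>w\<in>{w. h w \<noteq> 0}. lbar (h w) * hinv S m (hT (cox_inv S m w)) y)"

text \<open>Sum of T_w over the parabolic subgroup generated by s and t.\<close>
definition tl_gen :: "'a set \<Rightarrow> ('a \<Rightarrow> 'a \<Rightarrow> enat) \<Rightarrow> 'a \<Rightarrow> 'a \<Rightarrow> ('a list set \<Rightarrow> int fls)" where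
  "tl_gen S m s t = (\<lambda>x. if x \<in> cox_cls S m ` lists {s, t} then 1 else 0)"

inductive_set tl_ideal :: "'a set \<Rightarrow> ('a \<Rightarrow> 'a \<Rightarrow> enat) \<Rightarrow> ('a list set \<Rightarrow> int fls) set"
  for S m where
  zero: "(\<lambda>_. 0) \<in> tl_ideal S m"
| add: "h \<in> tl_ideal S m \<Longrightarrow> is_hecke S m a \<Longrightarrow> is_hecke S m b \<Longrightarrow> s \<in> S \<Longrightarrow> t \<in> S \<Longrightarrow> s \<noteq> t \<Longrightarrow>
     m s t \<noteq> 2 \<Longrightarrow> m s t \<noteq> \<infinity> \<Longrightarrow>
     (\<lambda>y. h y + hmul S m (hmul S m a (tl_gen S m s t)) b y) \<in> tl_ideal S m"

definition tl_eq :: "'a set \<Rightarrow> ('a \<Rightarrow> 'a \<Rightarrow> enat) \<Rightarrow> ('a list set \<Rightarrow> int fls) \<Rightarrow> ('a list set \<Rightarrow> int fls) \<Rightarrow> bool" where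
  "tl_eq S m h g \<longleftrightarrow> (\<lambda>y. h y - g y) \<in> tl_ideal S m"

definition D_fam :: "'a set \<Rightarrow> ('a \<Rightarrow> 'a \<Rightarrow> enat) \<Rightarrow> 'a list set \<Rightarrow> ('a list set \<Rightarrow> int fls)" where
  "D_fam S m w = (THE d. (\<forall>x. d x \<noteq> 0 \<longrightarrow> x \<in> cox_Wc S m \<and> bruhat_le S m x w) \<and> (\<forall>x. laurent (d x)) \<and>
      tl_eq S m (hT w) (\<lambda>y. \<Sum>x\<in>{x \<in> cox_Wc S m. bruhat_le S m x w}. d x * hT x y))"

definition Dpol :: "'a set \<Rightarrow> ('a \<Rightarrow> 'a \<Rightarrow> enat) \<Rightarrow> 'a list set \<Rightarrow> 'a list set \<Rightarrow> int fls" where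
  "Dpol S m x w = D_fam S m w x"

definition a_fam :: "'a set \<Rightarrow> ('a \<Rightarrow> 'a \<Rightarrow> enat) \<Rightarrow> 'a list set \<Rightarrow> ('a list set \<Rightarrow> int fls)" where
  "a_fam S m w = (THE a. (\<forall>y. a y \<noteq> 0 \<longrightarrow> y \<in> cox_Wc S m \<and> bruhat_le S m y w) \<and> (\<forall>y. laurent (a y)) \<and>
      tl_eq S m (hiota S m (hT w))
        (\<lambda>z. \<Sum>y\<in>{y \<in> cox_Wc S m. bruhat_le S m y w}. vpow (- 2 * int (cox_len w)) * a y * hT y z))"

definition apol :: "'a set \<Rightarrow> ('a \<Rightarrow> 'a \<Rightarrow> enat) \<Rightarrow> 'a list set \<Rightarrow> 'a list set \<Rightarrow> int fls" where
  "apol S m y w = a_fam S m w y"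

definition L_fam :: "'a set \<Rightarrow> ('a \<Rightarrow> 'a \<Rightarrow> enat) \<Rightarrow> 'a list set \<Rightarrow> ('a list set \<Rightarrow> int fls)" where
  "L_fam S m w = (THE L.
      (\<forall>x. L x \<noteq> 0 \<longrightarrow> x \<in> cox_Wc S m \<and> bruhat_le S m x w) \<and>
      L w = 1 \<and>
      (\<forall>x. laurent (L x) \<and> (\<forall>n. fls_nth (L x) n \<noteq> 0 \<longrightarrow> n \<le> 0)) \<and>
      (\<forall>x. bruhat_less S m x w \<longrightarrow> (\<forall>n. fls_nth (L x) n \<noteq> 0 \<longrightarrow> n \<le> -1)) \<and>
      (\<forall>x\<in>cox_Wc S m. L x =
         (\<Sum>y\<in>{y \<in> cox_Wc S m. bruhat_le S m x y \<and> bruhat_le S m y w}.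
            vpow (int (cox_len x) - int (cox_len y)) * apol S m x y * lbar (L y))))"

definition Lpol :: "'a set \<Rightarrow> ('a \<Rightarrow> 'a \<Rightarrow> enat) \<Rightarrow> 'a list set \<Rightarrow> 'a list set \<Rightarrow> int fls" where
  "Lpol S m x w = L_fam S m w x"

definition c_elem :: "'a set \<Rightarrow> ('a \<Rightarrow> 'a \<Rightarrow> enat) \<Rightarrow> 'a list set \<Rightarrow> ('a list set \<Rightarrow> int fls)" where
  "c_elem S m w = (\<lambda>z. \<Sum>x\<in>{x \<in> cox_Wc S m. bruhat_le S m x w}. vpow (- int (cox_len x)) * Lpol S m x w * hT x z)"

text \<open>Kazhdan--Lusztig polynomials: P_(w,w) = 1, deg_q P_(x,w) <= (l(x,w)-1)/2 for x < w,
  and C'_w = q^(-l(w)/2) sum_(x<=w) P_(x,w) T_x is iota-invariant.\<close>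
definition P_fam :: "'a set \<Rightarrow> ('a \<Rightarrow> 'a \<Rightarrow> enat) \<Rightarrow> 'a list set \<Rightarrow> ('a list set \<Rightarrow> int fls)" where
  "P_fam S m w = (THE p.
      (\<forall>x. p x \<noteq> 0 \<longrightarrow> bruhat_le S m x w) \<and>
      p w = 1 \<and>
      (\<forall>x. bruhat_less S m x w \<longrightarrow>
          (\<forall>n. fls_nth (p x) n \<noteq> 0 \<longrightarrow> even n \<and> 0 \<le> n \<and> n \<le> int (cox_len w) - int (cox_len x) - 1)) \<and>
      hiota S m (\<lambda>x. vpow (- int (cox_len w)) * p x) = (\<lambda>x. vpow (- int (cox_len w)) * p x))"

definition Cprime :: "'a set \<Rightarrow> ('a \<Rightarrow> 'a \<Rightarrow> enat) \<Rightarrow> 'a list set \<Rightarrow> ('a list set \<Rightarrow> int fls)" where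
  "Cprime S m w = (\<lambda>x. vpow (- int (cox_len w)) * P_fam S m w x)"

definition condP :: "'a set \<Rightarrow> ('a \<Rightarrow> 'a \<Rightarrow> enat) \<Rightarrow> bool" where
  "condP S m \<longleftrightarrow>
     (\<forall>w\<in>cox_Wc S m. tl_eq S m (Cprime S m w) (c_elem S m w)) \<and>
     (\<forall>w\<in>cox_W S m - cox_Wc S m. tl_eq S m (Cprime S m w) (\<lambda>_. 0))"

end

(* Condition (P) gives c_w = sigma(C'_w), and s w < w gives T_s C'_w = q C'_w; hence t_s c_w = q c_w.
   The recursion is the coefficient of t_{sx} in this identity, where t_s t_z = t_{sz} is expanded by the
   polynomials D when s z is longer than z and not fully commutative.

   Comparing coefficients needs the linear independence of {t_w : w fully commutative}. This is proved
   with the monomials b_{s_1} ... b_{s_n}, b_s = q^{-1/2}(t_s + 1), i.e. words up to commutation of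
   letters, and the length-decreasing rewriting b_s b_s -> (q^{1/2} + q^{-1/2}) b_s,
   b_s b_t b_s ... (m(s,t) letters) -> shorter alternating monomials with Chebyshev coefficients. Every
   critical pair of redexes in a heap closes, so normal forms define linear functionals on the algebra.
   The lengths of the elements of dihedral parabolic subgroups come from the same functionals at q = 1. *)

theory Submission
  imports Defs
begin

text \<open>The algebra is given as a quotient, so independence needs functionals on the Hecke
  algebra that kill the ideal. They are built on words in the \<open>b_s\<close> because there every
  relation other than commutation shortens words. Commutations have no good orientation and are
  divided out beforehand, which makes a redex a chain in a heap rather than a factor of a word. Most
  critical pairs close for one reason: shortening an alternating word by an even number of letters,
  or \<open>b_s b_s\<close> by one, can be read as deletion at either of its ends, so the deletion
  can be kept away from the other redex. Two kinds of overlap need more: redexes in the same two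
  letters, and redexes of length three with a common middle letter.

  There is an apparent circle: transporting a functional to the Hecke algebra needs Matsumoto's
  theorem, which needs the lengths of alternating words in a group known only by its presentation.
  At q = 1 the operators \<open>T_s\<close> are involutions, so a functional yields a function of
  the group element without any mention of reduced words, and this breaks the circle.\<close>

section \<open>Alternating words\<close>

lemma length_alt_word [simp]: "length (alt_word s t k) = k"
  by (induction k arbitrary: s t) auto

lemma nth_alt_word: "i < k \<Longrightarrow> alt_word s t k ! i = (if even i then s else t)"
proof (induction k arbitrary: s t i)
  case (Suc k)
  then show ?case by (cases i) auto
qed simp

lemma set_alt_word: "set (alt_word s t k) \<subseteq> {s, t}"
  by (induction k arbitrary: s t) auto

lemma take_alt_word: "i \<le> k \<Longrightarrow> take i (alt_word s t k) = alt_word s t i"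
  by (rule nth_equalityI) (auto simp: nth_alt_word)

text \<open>Dropping an odd number of letters would exchange the roles of \<open>s\<close> and
  \<open>t\<close>. This parity decides when a redex may be shortened at its front as well as at its
  back.\<close>

lemma drop_alt_word: "even i \<or> s = t \<Longrightarrow> drop i (alt_word s t k) = alt_word s t (k - i)"
  by (rule nth_equalityI) (auto simp: nth_alt_word)

section \<open>Heaps: events, commutations and contiguous chains\<close>

primrec bef :: "'e list \<Rightarrow> 'e \<Rightarrow> 'e \<Rightarrow> bool" where
  "bef [] e f \<longleftrightarrow> False"
| "bef (x # xs) e f \<longleftrightarrow> (x = e \<and> f \<in> set xs) \<or> bef xs e f"

lemma bef_append: "bef (xs @ ys) e f \<longleftrightarrow> bef xs e f \<or> bef ys e f \<or> (e \<in> set xs \<and> f \<in> set ys)"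
  by (induction xs) auto

lemma bef_set: "bef xs e f \<Longrightarrow> e \<in> set xs \<and> f \<in> set xs"
  by (induction xs) auto

lemma bef_total: "e \<in> set xs \<Longrightarrow> f \<in> set xs \<Longrightarrow> e \<noteq> f \<Longrightarrow> bef xs e f \<or> bef xs f e"
  by (induction xs) auto

lemma bef_irrefl: "distinct xs \<Longrightarrow> \<not> bef xs e e"
  by (induction xs) auto

lemma bef_trans: "distinct xs \<Longrightarrow> bef xs e f \<Longrightarrow> bef xs f g \<Longrightarrow> bef xs e g"
  by (induction xs) (auto dest: bef_set)

lemma bef_filter: "bef (filter P xs) e f \<longleftrightarrow> P e \<and> P f \<and> bef xs e f"
  by (induction xs) (auto dest: bef_set)

text \<open>Includes the case \<open>s = t\<close>, where \<open>m s t = 1\<close>.\<close>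
definition dep :: "('a \<Rightarrow> 'a \<Rightarrow> enat) \<Rightarrow> 'a \<Rightarrow> 'a \<Rightarrow> bool" where
  "dep m s t \<longleftrightarrow> m s t \<noteq> enat 2"

locale coxeter_matrix =
  fixes m :: "'a \<Rightarrow> 'a \<Rightarrow> enat"
  assumes m_sym: "m s t = m t s"
    and m_diag: "m s s = 1"
    and m_off: "s \<noteq> t \<Longrightarrow> 2 \<le> m s t"
begin

lemma dep_sym: "dep m s t \<Longrightarrow> dep m t s"
  by (simp add: dep_def m_sym)

lemma dep_refl [simp]: "dep m s s"
  by (simp add: dep_def m_diag one_enat_def)

text \<open>A word is treated as a labelling of a list of distinct events, so that letters can be traced
  through commutations: the heap of the word is the order generated by \<open>hedge\<close> below.\<close>
definition swaps :: "('e \<Rightarrow> 'a) \<Rightarrow> ('e list \<times> 'e list) set" where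
  "swaps lab = {(a @ [x, y] @ b, a @ [y, x] @ b) | a b x y. \<not> dep m (lab x) (lab y)}"

lemma swapsI: "\<not> dep m (lab x) (lab y) \<Longrightarrow> (a @ [x, y] @ b, a @ [y, x] @ b) \<in> swaps lab"
  unfolding swaps_def by blast

lemma comm_step_eq: "comm_step m = swaps id"
  unfolding comm_step_def swaps_def dep_def by auto

lemma swaps_sym: "(xs, ys) \<in> swaps lab \<Longrightarrow> (ys, xs) \<in> swaps lab"
  unfolding swaps_def using dep_sym by blast

lemma swap_eq_sym: "(xs, ys) \<in> (swaps lab)\<^sup>* \<Longrightarrow> (ys, xs) \<in> (swaps lab)\<^sup>*"
  by (metis swaps_sym symI sym_rtrancl symD)

lemma swap_eq_context:
  assumes "(xs, ys) \<in> (swaps lab)\<^sup>*"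
  shows "(a @ xs @ b, a @ ys @ b) \<in> (swaps lab)\<^sup>*"
  using assms
proof induction
  case (step y z)
  from step(2) obtain a' b' x' y' where "y = a' @ [x', y'] @ b'" "z = a' @ [y', x'] @ b'"
      "\<not> dep m (lab x') (lab y')"
    unfolding swaps_def by blast
  then have "(a @ y @ b, a @ z @ b) \<in> swaps lab"
    using swapsI[of lab x' y' "a @ a'" "b' @ b"] by simp
  with step(3) show ?case by simp
qed simp

lemma swap_eq_set: "(xs, ys) \<in> (swaps lab)\<^sup>* \<Longrightarrow> set ys = set xs \<and> length ys = length xs \<and> (distinct ys \<longleftrightarrow> distinct xs)"
proof (induction rule: rtrancl_induct)
  case (step y z)
  from step(2) obtain a b e f where "y = a @ [e, f] @ b" "z = a @ [f, e] @ b"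
    unfolding swaps_def by blast
  then have "set z = set y \<and> length z = length y \<and> (distinct z \<longleftrightarrow> distinct y)" by auto
  with step(3) show ?case by simp
qed simp

lemma swap_eq_map:
  assumes "(xs, ys) \<in> (swaps lab)\<^sup>*"
  shows "(map lab xs, map lab ys) \<in> (comm_step m)\<^sup>*"
  using assms
proof induction
  case (step y z)
  from step(2) have "(map lab y, map lab z) \<in> comm_step m"
    unfolding swaps_def comm_step_def dep_def
    by clarsimp (metis (no_types, lifting) append_Cons append_Nil)
  with step(3) show ?case by simp
qed simp

text \<open>Commutations permute positions, so they can be traced back to the events that carry the
  letters. This turns a second redex, visible only after commutations, into a chain of events of the
  original word.\<close>

lemma swap_eq_lift:
  assumes "(map lab xs, v) \<in> (comm_step m)\<^sup>*"
  shows "\<exists>ys. (xs, ys) \<in> (swaps lab)\<^sup>* \<and> map lab ys = v"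
  using assms
proof induction
  case (step y z)
  then obtain ys where ys: "(xs, ys) \<in> (swaps lab)\<^sup>*" "map lab ys = y" by blast
  from step(2) obtain a b s t where "y = a @ [s, t] @ b" "z = a @ [t, s] @ b" "\<not> dep m s t"
    unfolding comm_step_def dep_def by blast
  then obtain a' e f b' where "ys = a' @ [e, f] @ b'" "map lab a' = a" "map lab b' = b" "lab e = s" "lab f = t"
    using ys(2) by (auto simp: map_eq_append_conv map_eq_Cons_conv)
  with \<open>\<not> dep m s t\<close> \<open>z = _\<close> have "(ys, a' @ [f, e] @ b') \<in> swaps lab" "map lab (a' @ [f, e] @ b') = z"
    using swapsI[of lab e f a' b'] by auto
  with ys(1) have "(xs, a' @ [f, e] @ b') \<in> (swaps lab)\<^sup>* \<and> map lab (a' @ [f, e] @ b') = z"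
    by (auto intro: rtrancl_into_rtrancl)
  then show ?case by blast
qed blast

text \<open>Deleting events respects commutation: a swap of two surviving events stays a swap, and
  any other swap becomes an equality.\<close>

lemma swap_eq_filter:
  assumes "(xs, ys) \<in> (swaps lab)\<^sup>*"
  shows "(filter P xs, filter P ys) \<in> (swaps lab)\<^sup>*"
  using assms
proof induction
  case (step y z)
  from step(2) obtain a b e f where 1: "y = a @ [e, f] @ b" "z = a @ [f, e] @ b" "\<not> dep m (lab e) (lab f)"
    unfolding swaps_def by blast
  have "(filter P y, filter P z) \<in> (swaps lab)\<^sup>*"
    using 1 swapsI[of lab e f "filter P a" "filter P b"] by (cases "P e"; cases "P f") auto
  with step(3) show ?case by simp
qed simp

text \<open>Pairwise dependent events are never swapped, so their order is an invariant of the
  commutation class.\<close>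

lemma swap_eq_filter_dep:
  assumes "(xs, ys) \<in> (swaps lab)\<^sup>*" and Q: "\<And>x y. Q x \<Longrightarrow> Q y \<Longrightarrow> dep m (lab x) (lab y)"
  shows "filter Q xs = filter Q ys"
  using assms(1)
proof induction
  case (step y z)
  from step(2) obtain a b e f where 1: "y = a @ [e, f] @ b" "z = a @ [f, e] @ b" "\<not> dep m (lab e) (lab f)"
    unfolding swaps_def by blast
  have "\<not> (Q e \<and> Q f)" using 1 Q by blast
  then have "filter Q y = filter Q z" using 1 by auto
  with step(3) show ?case by simp
qed simp

definition hedge :: "('e \<Rightarrow> 'a) \<Rightarrow> 'e list \<Rightarrow> ('e \<times> 'e) set" where
  "hedge lab xs = {(e, f). bef xs e f \<and> dep m (lab e) (lab f)}"

lemma hedge_swap_eq: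
  assumes "(xs, ys) \<in> (swaps lab)\<^sup>*"
  shows "hedge lab xs = hedge lab ys"
  using assms
proof induction
  case (step y z)
  from step(2) obtain a b e f where 1: "y = a @ [e, f] @ b" "z = a @ [f, e] @ b" "\<not> dep m (lab e) (lab f)"
    unfolding swaps_def by blast
  have "hedge lab y = hedge lab z"
    using 1 dep_sym unfolding hedge_def by (auto simp: bef_append)
  with step(3) show ?case by simp
qed simp

lemma hedge_trancl_bef:
  assumes "distinct xs" "(e, f) \<in> (hedge lab xs)\<^sup>+"
  shows "bef xs e f"
  using assms(2)
proof induction
  case (base y) then show ?case by (simp add: hedge_def)
next
  case (step y z)
  then show ?case using bef_trans[OF assms(1)] unfolding hedge_def by blast
qed

lemma hedge_acyclic: "distinct xs \<Longrightarrow> (e, e) \<notin> (hedge lab xs)\<^sup>+"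
  using hedge_trancl_bef bef_irrefl by metis

lemma hedge_total:
  "x \<in> set xs \<Longrightarrow> y \<in> set xs \<Longrightarrow> x \<noteq> y \<Longrightarrow> dep m (lab x) (lab y) \<Longrightarrow> (x, y) \<in> hedge lab xs \<or> (y, x) \<in> hedge lab xs"
  unfolding hedge_def using bef_total dep_sym by fast

text \<open>An occurrence of \<open>P\<close> up to commutation, the heap counterpart of a factor of
  a word.\<close>

definition contig :: "('e \<Rightarrow> 'a) \<Rightarrow> 'e list \<Rightarrow> 'e list \<Rightarrow> bool" where
  "contig lab xs P \<longleftrightarrow> (\<exists>A B. (xs, A @ P @ B) \<in> (swaps lab)\<^sup>*)"

lemma contig_filter: "contig lab xs P \<Longrightarrow> contig lab (filter Q xs) (filter Q P)"
  unfolding contig_def by (metis swap_eq_filter filter_append)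

lemma contig_set: "contig lab xs P \<Longrightarrow> distinct xs \<Longrightarrow> distinct P \<and> set P \<subseteq> set xs"
  unfolding contig_def using swap_eq_set by (metis distinct_append set_append Un_subset_iff subset_refl)

text \<open>Every word of the class respects the heap order, so an event between two members of
  \<open>P\<close> in the heap also stands between them in \<open>A @ P @ B\<close>.\<close>

lemma contig_convex:
  assumes "contig lab xs P" "distinct xs" "p \<in> set P" "p' \<in> set P"
    and "(p, z) \<in> (hedge lab xs)\<^sup>+" "(z, p') \<in> (hedge lab xs)\<^sup>+"
  shows "z \<in> set P"
proof -
  obtain A B where AB: "(xs, A @ P @ B) \<in> (swaps lab)\<^sup>*" using assms(1) unfolding contig_def by blast
  have d: "distinct (A @ P @ B)" using AB assms(2) swap_eq_set by blast
  have "bef (A @ P @ B) p z" "bef (A @ P @ B) z p'"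
    using assms(5,6) hedge_trancl_bef[OF d] hedge_swap_eq[OF AB] by auto
  then show ?thesis using d assms(3,4) by (auto simp: bef_append dest: bef_set)
qed

text \<open>An event outside the down-closed set \<open>Q\<close> is independent of all later events
  of \<open>Q\<close>, so it can travel to the right past each of them.\<close>

lemma swap_eq_partition:
  assumes "\<And>z d. (z, d) \<in> hedge lab xs \<Longrightarrow> Q d \<Longrightarrow> Q z"
  shows "(xs, filter Q xs @ filter (\<lambda>x. \<not> Q x) xs) \<in> (swaps lab)\<^sup>*"
  using assms
proof (induction xs)
  case (Cons x xs)
  have IH: "(xs, filter Q xs @ filter (\<lambda>x. \<not> Q x) xs) \<in> (swaps lab)\<^sup>*"
    by (rule Cons.IH) (use Cons.prems in \<open>auto simp: hedge_def\<close>)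
  have IH': "(x # xs, x # filter Q xs @ filter (\<lambda>x. \<not> Q x) xs) \<in> (swaps lab)\<^sup>*"
    using swap_eq_context[OF IH, of "[x]" "[]"] by simp
  show ?case
  proof (cases "Q x")
    case False
    have move: "(x # ys, ys @ [x]) \<in> (swaps lab)\<^sup>*" if "\<And>d. d \<in> set ys \<Longrightarrow> \<not> dep m (lab x) (lab d)" for ys
      using that
    proof (induction ys)
      case (Cons y ys)
      have "(x # y # ys, y # x # ys) \<in> swaps lab"
        using swapsI[of lab x y "[]" ys] Cons.prems by simp
      moreover have "(y # x # ys, y # ys @ [x]) \<in> (swaps lab)\<^sup>*"
        using swap_eq_context[of "x # ys" "ys @ [x]" lab "[y]" "[]"] Cons by simp
      ultimately show ?case by simp
    qed simp
    have "\<not> dep m (lab x) (lab d)" if "d \<in> set (filter Q xs)" for d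
      using Cons.prems[of x d] that False by (auto simp: hedge_def)
    then have "(x # filter Q xs, filter Q xs @ [x]) \<in> (swaps lab)\<^sup>*"
      by (rule move)
    from swap_eq_context[OF this, of "[]" "filter (\<lambda>x. \<not> Q x) xs"]
    have "(x # filter Q xs @ filter (\<lambda>x. \<not> Q x) xs, filter Q xs @ x # filter (\<lambda>x. \<not> Q x) xs) \<in> (swaps lab)\<^sup>*"
      by simp
    with IH' False show ?thesis by (auto intro: rtrancl_trans)
  qed (use IH' in simp)
qed simp

text \<open>Converse of \<open>contig_convex\<close>: a convex chain becomes a factor once the
  events below it, and then the chain itself, are moved to the front.\<close>

lemma convex_contig:
  assumes "distinct xs"
    and conv: "\<And>p p' z. p \<in> set P \<Longrightarrow> p' \<in> set P \<Longrightarrow> z \<notin> set P \<Longrightarrow> (p, z) \<in> hedge lab xs \<Longrightarrow> (z, p') \<in> (hedge lab xs)\<^sup>+ \<Longrightarrow> False"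
    and P: "filter (\<lambda>x. x \<in> set P) xs = P"
  shows "contig lab xs P"
proof -
  \<comment> \<open>The events below \<open>P\<close>; convexity makes this set closed
    downwards.\<close>
  define Q where "Q z \<longleftrightarrow> z \<notin> set P \<and> (\<exists>p\<in>set P. (z, p) \<in> (hedge lab xs)\<^sup>+)" for z
  have 1: "(xs, filter Q xs @ filter (\<lambda>x. \<not> Q x) xs) \<in> (swaps lab)\<^sup>*"
  proof (rule swap_eq_partition)
    fix z d assume "(z, d) \<in> hedge lab xs" "Q d"
    then show "Q z" unfolding Q_def using conv by (meson trancl_into_trancl2)
  qed
  define ys where "ys = filter (\<lambda>x. \<not> Q x) xs"
  have 2: "(ys, filter (\<lambda>x. x \<in> set P) ys @ filter (\<lambda>x. x \<notin> set P) ys) \<in> (swaps lab)\<^sup>*"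
  proof (rule swap_eq_partition)
    fix z d assume zd: "(z, d) \<in> hedge lab ys" "d \<in> set P"
    then have "(z, d) \<in> hedge lab xs" "\<not> Q z" unfolding ys_def hedge_def by (auto simp: bef_filter)
    then show "z \<in> set P" using zd(2) unfolding Q_def by blast
  qed
  have "filter (\<lambda>x. x \<in> set P) ys = filter (\<lambda>x. x \<in> set P) xs"
    unfolding ys_def by (simp add: Q_def cong: filter_cong) (metis (mono_tags, lifting) Q_def filter_cong)
  then have "(xs, filter Q xs @ P @ filter (\<lambda>x. x \<notin> set P) ys) \<in> (swaps lab)\<^sup>*"
    using 1 2 swap_eq_context[OF 2, of "filter Q xs" "[]"] P unfolding ys_def by (auto intro: rtrancl_trans)
  then show ?thesis unfolding contig_def by blast
qed

end

text \<open>\<open>cheb k j\<close> is the coefficient of the alternating word of length \<open>k - 2j\<close> in the Chebyshev-like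
  element \<open>U\<^sub>k(s,t) = b\<^sub>s U\<^bsub>k-1\<^esub>(t,s) - U\<^bsub>k-2\<^esub>(s,t)\<close>; the relation imposed for
  \<open>m s t = k\<close> is \<open>U\<^sub>k(s,t) = 0\<close>.\<close>
fun cheb :: "nat \<Rightarrow> nat \<Rightarrow> int" where
  "cheb 0 j = 0"
| "cheb (Suc 0) j = (if j = 0 then 1 else 0)"
| "cheb (Suc (Suc k)) j = cheb (Suc k) j - (if j = 0 then 0 else cheb k (j - 1))"

lemma cheb_0: "cheb (Suc k) 0 = 1"
  by (induction k) auto

lemma cheb_eq_0: "k \<le> 2 * j \<Longrightarrow> cheb k j = 0"
proof (induction k j rule: cheb.induct)
  case (3 k j)
  show ?case
  proof (cases j)
    case (Suc i)
    then show ?thesis using 3 by simp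
  qed (use 3 in simp)
qed auto

section \<open>Rewriting rules and their action on heaps\<close>

text \<open>Allowing \<open>s = t\<close> with \<open>k = 2\<close> treats \<open>b_s b_s\<close> as
  an alternating word, so both rules share one shape and one confluence argument. Order 2 is left
  out because those relations are the commutations.\<close>

definition redex :: "('a \<Rightarrow> 'a \<Rightarrow> enat) \<Rightarrow> 'a \<Rightarrow> 'a \<Rightarrow> nat \<Rightarrow> bool" where
  "redex m s t k \<longleftrightarrow> (s = t \<and> k = 2) \<or> (s \<noteq> t \<and> m s t = enat k \<and> 3 \<le> k)"

text \<open>The coefficient, on the right-hand side of a rule, of the alternating word shortened by
  \<open>i\<close> letters: negated Chebyshev coefficients for a long braid, the loop value
  \<open>\<delta>\<close> for a square.\<close>

definition rcoef :: "'r::comm_ring_1 \<Rightarrow> 'a \<Rightarrow> 'a \<Rightarrow> nat \<Rightarrow> nat \<Rightarrow> 'r" where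
  "rcoef \<delta> s t k i = (if s = t then (if i = 1 then \<delta> else 0)
     else if even i then - of_int (cheb k (i div 2)) else 0)"

definition reduct :: "'r::comm_ring_1 \<Rightarrow> ('a list \<Rightarrow> 'r) \<Rightarrow> 'a list \<Rightarrow> 'a \<Rightarrow> 'a \<Rightarrow> nat \<Rightarrow> 'a list \<Rightarrow> 'r" where
  "reduct \<delta> F a s t k b = (\<Sum>i=1..<k. rcoef \<delta> s t k i * F (a @ alt_word s t (k - i) @ b))"

text \<open>Hence every word that really occurs on the right-hand side arises by deletion at the
  front, and equally well by deletion at the back.\<close>

lemma rcoef_drop: "rcoef \<delta> s t k i \<noteq> 0 \<Longrightarrow> even i \<or> s = t"
  by (auto simp: rcoef_def split: if_splits)

text \<open>The flag chooses the end of the chain at which events are deleted, a freedom on which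
  the overlap arguments rely.\<close>

definition sel :: "bool \<Rightarrow> nat \<Rightarrow> 'e list \<Rightarrow> 'e list" where
  "sel d i P = (if d then take i P else drop (length P - i) P)"

lemma sel_subset: "set (sel d i P) \<subseteq> set P"
  by (auto simp: sel_def dest: in_set_takeD in_set_dropD)

lemma filter_notin_take: "distinct P \<Longrightarrow> filter (\<lambda>x. x \<notin> set (take i P)) P = drop i P"
proof -
  assume "distinct P"
  then have d: "distinct (take i P @ drop i P)" by simp
  have "filter (\<lambda>x. x \<notin> set (take i P)) (take i P @ drop i P) = drop i P"
    using d unfolding filter_append distinct_append by (auto simp: filter_empty_conv filter_id_conv)
  then show ?thesis by simp
qed

lemma filter_notin_drop: "distinct P \<Longrightarrow> filter (\<lambda>x. x \<notin> set (drop i P)) P = take i P"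
proof -
  assume "distinct P"
  then have d: "distinct (take i P @ drop i P)" by simp
  have "filter (\<lambda>x. x \<notin> set (drop i P)) (take i P @ drop i P) = take i P"
    using d unfolding filter_append distinct_append by (auto simp: filter_empty_conv filter_id_conv)
  then show ?thesis by simp
qed

context coxeter_matrix
begin

text \<open>The relations hold on words shorter than \<open>n\<close>. This is the induction
  hypothesis of the confluence proof, since the reducts of a word of length \<open>n\<close> involve
  only shorter words.\<close>

definition good :: "'r::comm_ring_1 \<Rightarrow> nat \<Rightarrow> ('a list \<Rightarrow> 'r) \<Rightarrow> bool" where
  "good \<delta> n F \<longleftrightarrow>
     (\<forall>u v. length u < n \<longrightarrow> (u, v) \<in> (comm_step m)\<^sup>* \<longrightarrow> F u = F v) \<and>
     (\<forall>a s t k b. redex m s t k \<longrightarrow> length (a @ alt_word s t k @ b) < n \<longrightarrow>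
        F (a @ alt_word s t k @ b) = reduct \<delta> F a s t k b)"

lemma good_comm: "good \<delta> n F \<Longrightarrow> length u < n \<Longrightarrow> (u, v) \<in> (comm_step m)\<^sup>* \<Longrightarrow> F u = F v"
  unfolding good_def by blast

lemma good_redex: "good \<delta> n F \<Longrightarrow> redex m s t k \<Longrightarrow> length (a @ alt_word s t k @ b) < n \<Longrightarrow>
        F (a @ alt_word s t k @ b) = reduct \<delta> F a s t k b"
  unfolding good_def by blast

definition rest :: "('e \<Rightarrow> 'a) \<Rightarrow> 'e list \<Rightarrow> 'e set \<Rightarrow> 'a list" where
  "rest lab xs R = map lab (filter (\<lambda>x. x \<notin> R) xs)"

text \<open>\<open>reduct\<close> expressed by deletions from a heap, so that two redexes of the
  same heap can be compared without choosing a common word.\<close>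

definition rval :: "'r::comm_ring_1 \<Rightarrow> ('a list \<Rightarrow> 'r) \<Rightarrow> ('e \<Rightarrow> 'a) \<Rightarrow> 'e list \<Rightarrow> bool \<Rightarrow> 'e list \<Rightarrow> 'a \<Rightarrow> 'a \<Rightarrow> nat \<Rightarrow> 'r" where
  "rval \<delta> F lab xs d P s t k = (\<Sum>i=1..<k. rcoef \<delta> s t k i * F (rest lab xs (set (sel d i P))))"

lemma rest_length:
  assumes "x \<in> R" "x \<in> set xs"
  shows "length (rest lab xs R) < length xs"
  using assms length_filter_less[of x xs "\<lambda>x. x \<notin> R"] by (simp add: rest_def)

text \<open>By \<open>drop_alt_word\<close> and \<open>take_alt_word\<close>, cutting the chain at
  either end leaves the same alternating word between \<open>A\<close> and \<open>B\<close>.\<close>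

lemma rest_sel:
  assumes "(xs, A @ P @ B) \<in> (swaps lab)\<^sup>*" "distinct xs" "map lab P = alt_word s t k" "i \<le> k" "even i \<or> s = t"
  shows "(rest lab xs (set (sel d i P)), map lab A @ alt_word s t (k - i) @ map lab B) \<in> (comm_step m)\<^sup>*"
proof -
  have d: "distinct (A @ P @ B)" using assms swap_eq_set by blast
  have k: "length P = k" using assms(3) by (metis length_map length_alt_word)
  let ?R = "set (sel d i P)"
  have A: "filter (\<lambda>x. x \<notin> ?R) A = A" "filter (\<lambda>x. x \<notin> ?R) B = B"
    using d sel_subset[of d i P] by (auto intro!: filter_True)
  have "map lab (filter (\<lambda>x. x \<notin> ?R) P) = alt_word s t (k - i)"
  proof (cases d)
    case True
    then show ?thesis using d assms(3,5) by (simp add: sel_def filter_notin_take drop_map[symmetric] drop_alt_word)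
  next
    case False
    then show ?thesis using d assms(3,4) k by (simp add: sel_def filter_notin_drop take_map[symmetric] take_alt_word)
  qed
  moreover have "(filter (\<lambda>x. x \<notin> ?R) xs, filter (\<lambda>x. x \<notin> ?R) (A @ P @ B)) \<in> (swaps lab)\<^sup>*"
    using swap_eq_filter[OF assms(1)] .
  ultimately have *: "(filter (\<lambda>x. x \<notin> ?R) xs, A @ filter (\<lambda>x. x \<notin> ?R) P @ B) \<in> (swaps lab)\<^sup>*"
    and **: "map lab (filter (\<lambda>x. x \<notin> ?R) P) = alt_word s t (k - i)"
    unfolding filter_append A by blast+
  show ?thesis using swap_eq_map[OF *] unfolding rest_def map_append ** .
qed

lemma rest_sel_length:
  assumes "set P \<subseteq> set xs" "length P = k" "1 \<le> i" "i < k"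
  shows "length (rest lab xs (set (sel d i P))) < length xs"
proof -
  have "sel d i P \<noteq> []" using assms by (auto simp: sel_def)
  then obtain x where x: "x \<in> set (sel d i P)" by (meson hd_in_set)
  have "x \<in> set xs" using x sel_subset[of d i P] assms(1) by blast
  with x show ?thesis by (rule rest_length)
qed

lemma reduct_rval:
  assumes "(xs, A @ P @ B) \<in> (swaps lab)\<^sup>*" "distinct xs" "map lab P = alt_word s t k"
    and "good \<delta> (length xs) F"
  shows "reduct \<delta> F (map lab A) s t k (map lab B) = rval \<delta> F lab xs d P s t k"
  unfolding reduct_def rval_def
proof (rule sum.cong)
  fix i assume i: "i \<in> {1..<k}"
  have "set P \<subseteq> set xs" using swap_eq_set[OF assms(1)] by auto
  moreover have "length P = k" using assms(3) by (metis length_map length_alt_word)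
  ultimately have l: "length (rest lab xs (set (sel d i P))) < length xs"
    using rest_sel_length i by (metis atLeastLessThan_iff)
  show "rcoef \<delta> s t k i * F (map lab A @ alt_word s t (k - i) @ map lab B) =
         rcoef \<delta> s t k i * F (rest lab xs (set (sel d i P)))"
  proof (cases "rcoef \<delta> s t k i = 0")
    case False
    have "F (rest lab xs (set (sel d i P))) = F (map lab A @ alt_word s t (k - i) @ map lab B)"
      using good_comm[OF assms(4) l rest_sel[OF assms(1-3) _ rcoef_drop[OF False]]] i by simp
    then show ?thesis by simp
  qed simp
qed simp

lemma rval_dir:
  assumes "contig lab xs P" "distinct xs" "map lab P = alt_word s t k" "good \<delta> (length xs) F"
  shows "rval \<delta> F lab xs d P s t k = rval \<delta> F lab xs d' P s t k"
proof -
  obtain A B where AB: "(xs, A @ P @ B) \<in> (swaps lab)\<^sup>*" using assms(1) unfolding contig_def by blast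
  show ?thesis
    using reduct_rval[OF AB assms(2,3,4), of d] reduct_rval[OF AB assms(2,3,4), of d'] by simp
qed

lemma good_mono: "good \<delta> n F \<Longrightarrow> n' \<le> n \<Longrightarrow> good \<delta> n' F"
  unfolding good_def by (meson less_le_trans)

lemma good_rval:
  assumes "contig lab xs P" "distinct xs" "map lab P = alt_word s t k" "redex m s t k"
    "good \<delta> n F" "length xs < n"
  shows "F (map lab xs) = rval \<delta> F lab xs d P s t k"
proof -
  obtain A B where AB: "(xs, A @ P @ B) \<in> (swaps lab)\<^sup>*" using assms(1) unfolding contig_def by blast
  have "F (map lab xs) = F (map lab A @ alt_word s t k @ map lab B)"
    using good_comm[OF assms(5) _ swap_eq_map[OF AB]] assms by simp
  also have "\<dots> = reduct \<delta> F (map lab A) s t k (map lab B)"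
  proof (rule good_redex[OF assms(5,4)])
    have "length P = k" using assms(3) by (metis length_map length_alt_word)
    moreover have "length (A @ P @ B) = length xs" using swap_eq_set[OF AB] by blast
    ultimately show "length (map lab A @ alt_word s t k @ map lab B) < n" using assms(6) by simp
  qed
  also have "\<dots> = rval \<delta> F lab xs d P s t k"
    by (rule reduct_rval[OF AB assms(2,3)]) (use good_mono assms(5,6) in \<open>meson less_imp_le\<close>)
  finally show ?thesis .
qed

lemma rest_rest: "filter (\<lambda>x. x \<notin> R') (filter (\<lambda>x. x \<notin> R) xs) = filter (\<lambda>x. x \<notin> R \<union> R') xs"
  by (simp add: conj_commute)

lemma rval_step:
  assumes "contig lab xs P2" "distinct xs" "map lab P2 = alt_word s2 t2 k2" "redex m s2 t2 k2"
    "good \<delta> (length xs) F" "R \<inter> set P2 = {}" "length (rest lab xs R) < length xs"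
  shows "F (rest lab xs R) = (\<Sum>j=1..<k2. rcoef \<delta> s2 t2 k2 j * F (rest lab xs (R \<union> set (sel d j P2))))"
proof -
  have "filter (\<lambda>x. x \<notin> R) P2 = P2" using assms(6) by (auto intro!: filter_True)
  then have c: "contig lab (filter (\<lambda>x. x \<notin> R) xs) P2" using contig_filter[OF assms(1)] by metis
  show ?thesis
    using good_rval[OF c _ assms(3,4,5), of d] assms(2,7) unfolding rest_def rval_def rest_rest by simp
qed

text \<open>If the deletions at end \<open>d1\<close> of the first redex never touch
  \<open>P2\<close>, the second redex survives each of them and can be reduced next. What remains
  depends only on the union of the deleted sets.\<close>

lemma rval_expand:
  assumes "good \<delta> (length xs) F" "distinct xs"
    and "contig lab xs P1" "map lab P1 = alt_word s1 t1 k1"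
    and "contig lab xs P2" "map lab P2 = alt_word s2 t2 k2" "redex m s2 t2 k2"
    and d1: "\<And>i. i < k1 \<Longrightarrow> set (sel d1 i P1) \<inter> set P2 = {}"
  shows "rval \<delta> F lab xs d1 P1 s1 t1 k1 = (\<Sum>i=1..<k1. \<Sum>j=1..<k2. rcoef \<delta> s1 t1 k1 i * (rcoef \<delta> s2 t2 k2 j
        * F (rest lab xs (set (sel d1 i P1) \<union> set (sel d2 j P2)))))"
  unfolding rval_def
proof (rule sum.cong)
  fix i assume i: "i \<in> {1..<k1}"
  have l: "length P1 = k1" using assms(4) by (metis length_map length_alt_word)
  have s: "set P1 \<subseteq> set xs" using contig_set assms(2,3) by blast
  have "F (rest lab xs (set (sel d1 i P1))) =
      (\<Sum>j=1..<k2. rcoef \<delta> s2 t2 k2 j * F (rest lab xs (set (sel d1 i P1) \<union> set (sel d2 j P2))))"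
    by (rule rval_step[OF assms(5,2,6,7,1) d1 rest_sel_length[OF s l]]) (use i in auto)
  then show "rcoef \<delta> s1 t1 k1 i * F (rest lab xs (set (sel d1 i P1))) = (\<Sum>j=1..<k2. rcoef \<delta> s1 t1 k1 i * (rcoef \<delta> s2 t2 k2 j
        * F (rest lab xs (set (sel d1 i P1) \<union> set (sel d2 j P2)))))"
    by (simp only: sum_distrib_left)
qed simp

text \<open>The easy critical pairs: with ends chosen so that neither deletion meets the other
  redex, both reductions expand to the same double sum.\<close>

lemma commuting_removals:
  assumes "good \<delta> (length xs) F" "distinct xs"
    and "contig lab xs P1" "map lab P1 = alt_word s1 t1 k1" "redex m s1 t1 k1"
    and "contig lab xs P2" "map lab P2 = alt_word s2 t2 k2" "redex m s2 t2 k2"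
    and d1: "\<And>i. i < k1 \<Longrightarrow> set (sel d1 i P1) \<inter> set P2 = {}"
    and d2: "\<And>i. i < k2 \<Longrightarrow> set (sel d2 i P2) \<inter> set P1 = {}"
  shows "rval \<delta> F lab xs d P1 s1 t1 k1 = rval \<delta> F lab xs d' P2 s2 t2 k2"
proof -
  have "rval \<delta> F lab xs d P1 s1 t1 k1 = rval \<delta> F lab xs d1 P1 s1 t1 k1"
    by (rule rval_dir[OF assms(3,2,4,1)])
  also have "\<dots> = rval \<delta> F lab xs d2 P2 s2 t2 k2"
  proof -
    note e1 = rval_expand[where ?d1.0 = d1 and ?d2.0 = d2, OF assms(1-4,6-8) d1]
    note e2 = rval_expand[where ?d1.0 = d2 and ?d2.0 = d1, OF assms(1,2,6,7,3-5) d2]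
    show ?thesis
      by (subst e1, simp, subst e2, simp, subst sum.swap) (simp only: mult.left_commute Un_commute)
  qed
  also have "\<dots> = rval \<delta> F lab xs d' P2 s2 t2 k2"
    by (rule rval_dir[OF assms(6,2,7,1)])
  finally show ?thesis .
qed

lemma redex_dep:
  assumes "redex m s t k" "x \<in> {s, t}" "y \<in> {s, t}"
  shows "dep m x y"
proof -
  have "s \<noteq> t \<Longrightarrow> dep m s t" using assms(1) by (auto simp: redex_def dep_def)
  then show ?thesis using assms dep_sym by (cases "s = t") auto
qed

lemma redex_ge: "redex m s t k \<Longrightarrow> 2 \<le> k" "redex m s t k \<Longrightarrow> s \<noteq> t \<Longrightarrow> 3 \<le> k"
  by (auto simp: redex_def)

lemma redex_labels: "map lab P = alt_word s t k \<Longrightarrow> x \<in> set P \<Longrightarrow> lab x \<in> {s, t}"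
  using set_alt_word[of s t k] by (metis image_eqI list.set_map subsetD)

lemma chain_hedge:
  assumes "contig lab xs (X @ Y)" "distinct xs" "map lab (X @ Y) = alt_word s t k" "redex m s t k"
    "x \<in> set X" "y \<in> set Y"
  shows "(x, y) \<in> hedge lab xs"
proof -
  obtain A B where AB: "(xs, A @ (X @ Y) @ B) \<in> (swaps lab)\<^sup>*" using assms(1) unfolding contig_def by blast
  have "dep m (lab x) (lab y)" using redex_dep[OF assms(4)] redex_labels[OF assms(3)] assms(5,6) by simp
  then show ?thesis unfolding hedge_swap_eq[OF AB] using assms(5,6) by (auto simp: hedge_def bef_append)
qed

end

lemma filter_mem_middle:
  assumes "distinct (A @ P @ B)"
  shows "filter (\<lambda>x. x \<in> set P) (A @ P @ B) = P"
proof -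
  have "filter (\<lambda>x. x \<in> set P) A = []" "filter (\<lambda>x. x \<in> set P) B = []"
    using assms by (auto simp: filter_empty_conv)
  then show ?thesis by simp
qed

context coxeter_matrix
begin

text \<open>The events of a redex are pairwise dependent, so every word of the class lists them in
  the order of \<open>P\<close>.\<close>

lemma contig_filter_self:
  assumes "contig lab xs P" "distinct xs" "map lab P = alt_word s t k" "redex m s t k"
  shows "filter (\<lambda>x. x \<in> set P) xs = P"
proof -
  obtain A B where AB: "(xs, A @ P @ B) \<in> (swaps lab)\<^sup>*" using assms(1) unfolding contig_def by blast
  have d: "distinct (A @ P @ B)" using AB assms(2) swap_eq_set by blast
  have "filter (\<lambda>x. x \<in> set P) xs = filter (\<lambda>x. x \<in> set P) (A @ P @ B)"
    by (rule swap_eq_filter_dep[OF AB]) (use redex_dep[OF assms(4)] redex_labels[OF assms(3)] in blast)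
  also have "\<dots> = P" by (rule filter_mem_middle[OF d])
  finally show ?thesis .
qed

subsection \<open>Local confluence\<close>

text \<open>The union of the two redexes is a longer alternating chain. Cutting \<open>P1\<close> at
  its front cuts the union at its front, cutting \<open>P2\<close> at its back cuts the union at its
  back, and both leave the same alternating word.\<close>

lemma shifted_overlap:
  assumes good: "good \<delta> (length xs) F" and d: "distinct xs"
    and c1: "contig lab xs P1" and l1: "map lab P1 = alt_word s1 t1 k" and r1: "redex m s1 t1 k"
    and c2: "contig lab xs P2" and l2: "map lab P2 = alt_word s2 t2 k" and r2: "redex m s2 t2 k"
    and ne: "s1 \<noteq> t1" and st: "{s2, t2} = {s1, t1}"
    and P1: "P1 = U @ V" and P2: "P2 = V @ Z" and V: "2 \<le> length V"
    and fil: "filter (\<lambda>x. lab x \<in> {s1, t1}) xs = X @ U @ V @ Z @ Y"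
  shows "rval \<delta> F lab xs d1 P1 s1 t1 k = rval \<delta> F lab xs d2 P2 s2 t2 k"
proof -
  define Q where "Q = U @ V @ Z"
  have Q1: "Q = P1 @ Z" and Q2: "Q = U @ P2" by (simp_all add: Q_def P1 P2)
  have k1: "length P1 = k" and k2: "length P2 = k" using l1 l2 by (metis length_map length_alt_word)+
  have lU: "length U = length Z" using k1 k2 P1 P2 by simp
  have dF: "distinct (X @ U @ V @ Z @ Y)" using d fil by (metis distinct_filter)
  have sQ: "set Q = set P1 \<union> set P2" by (auto simp: Q_def P1 P2)
  have labQ: "lab x \<in> {s1, t1}" if "x \<in> set Q" for x
    using that redex_labels[OF l1, of x] redex_labels[OF l2, of x] st sQ by auto
  have fQ: "filter (\<lambda>x. x \<in> set Q) xs = Q"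
  proof -
    have "filter (\<lambda>x. x \<in> set Q) xs = filter (\<lambda>x. x \<in> set Q) (filter (\<lambda>x. lab x \<in> {s1, t1}) xs)"
      using labQ by (auto intro!: filter_cong simp del: insert_iff)
    also have "\<dots> = Q" using filter_mem_middle[of X Q Y] dF unfolding fil Q_def by simp
    finally show ?thesis .
  qed
  have nth1: "lab (P1 ! i) = (if even i then s1 else t1)" if "i < k" for i
    using l1 nth_alt_word[OF that, of s1 t1] k1 that by (metis nth_map)
  have nth2: "lab (P2 ! i) = (if even i then s2 else t2)" if "i < k" for i
    using l2 nth_alt_word[OF that, of s2 t2] k2 that by (metis nth_map)
  \<comment> \<open>\<open>V\<close> has at least two events, so both letters occur in it.\<close>
  have exV: "\<exists>v\<in>set V. lab v = lab p" if "p \<in> set Q" for p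
  proof -
    have kk: "length U + 1 < k" using k1 P1 V by simp
    have "V ! 0 = P1 ! length U" "V ! 1 = P1 ! (length U + 1)"
      using V by (simp_all add: P1 nth_append)
    moreover have mem: "V ! 0 \<in> set V" "V ! 1 \<in> set V" using V by (auto intro!: nth_mem)
    ultimately have "lab (V ! 0) = (if even (length U) then s1 else t1)"
      "lab (V ! 1) = (if even (length U) then t1 else s1)"
      using nth1[of "length U"] nth1[of "length U + 1"] kk by simp_all
    then show ?thesis using labQ[OF that] mem by (cases "even (length U)") (auto intro: bexI[of _ "V ! 0"] bexI[of _ "V ! 1"])
  qed
  have cQ: "contig lab xs Q"
  proof (rule convex_contig[OF d _ fQ])
    fix p p' z
    assume p: "p \<in> set Q" "p' \<in> set Q" "z \<notin> set Q" "(p, z) \<in> hedge lab xs" "(z, p') \<in> (hedge lab xs)\<^sup>+"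
    obtain v where v: "v \<in> set V" "lab v = lab p" using exV[OF p(1)] by blast
    have nz: "z \<notin> set P1" "z \<notin> set P2" using p(3) sQ by auto
    have n1: "\<not> (p \<in> set P1 \<and> p' \<in> set P1)"
      using contig_convex[OF c1 d _ _ r_into_trancl[OF p(4)] p(5)] nz by blast
    have n2: "\<not> (p \<in> set P2 \<and> p' \<in> set P2)"
      using contig_convex[OF c2 d _ _ r_into_trancl[OF p(4)] p(5)] nz by blast
    show False
    proof (cases "p \<in> set U")
      case True
      then have pZ: "p' \<in> set Z" using n1 p(2) by (auto simp: P1 Q_def)
      have zx: "z \<in> set xs" using p(4) bef_set by (fastforce simp: hedge_def)
      have vx: "v \<in> set xs" using v contig_set[OF c1 d] P1 by auto
      \<comment> \<open>Since \<open>v\<close> carries the letter of \<open>p\<close>, it is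
        comparable with \<open>z\<close>; by convexity either order places \<open>z\<close> inside
        \<open>P1\<close> or inside \<open>P2\<close>.\<close>
      have "dep m (lab z) (lab v)" using p(4) v(2) dep_sym by (auto simp: hedge_def)
      moreover have "z \<noteq> v" using nz v P1 by auto
      ultimately consider "(z, v) \<in> hedge lab xs" | "(v, z) \<in> hedge lab xs"
        using hedge_total zx vx by metis
      then show False
      proof cases
        case 1
        then show False
          using contig_convex[OF c1 d _ _ r_into_trancl[OF p(4)] r_into_trancl[OF 1]] nz True v P1 by auto
      next
        case 2
        then show False
          using contig_convex[OF c2 d _ _ r_into_trancl[OF 2] p(5)] nz pZ v P2 by auto
      qed
    next
      case False
      then have pP: "p \<in> set P2" using p(1) by (auto simp: P2 Q_def)
      then have "p' \<in> set U" using n2 p(2) by (auto simp: P2 Q_def)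
      moreover have "p \<in> set Z" using False n1 p(1) calculation by (auto simp: P1 Q_def)
      ultimately have "(p', v) \<in> hedge lab xs" "(v, p) \<in> hedge lab xs"
        using chain_hedge[OF c1[unfolded P1] d l1[unfolded P1] r1] chain_hedge[OF c2[unfolded P2] d l2[unfolded P2] r2] v(1)
        by blast+
      then have "(p', z) \<in> (hedge lab xs)\<^sup>+"
        using p(4) by (auto intro: trancl_into_trancl)
      from trancl_trans[OF this p(5)] show False using hedge_acyclic[OF d] by metis
    qed
  qed
  \<comment> \<open>Beyond the end of \<open>P1\<close> the labels continue with period two, because
    two steps back is still inside \<open>P2\<close> when \<open>V\<close> has two events.\<close>
  have lQ: "map lab Q = alt_word s1 t1 (k + length Z)"
  proof (rule nth_equalityI)
    fix i assume "i < length (map lab Q)"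
    then have "i < k + length Z" using k1 by (simp add: Q1)
    then have "lab (Q ! i) = (if even i then s1 else t1)"
    proof (induction i rule: less_induct)
      case (less i)
      show ?case
      proof (cases "i < k")
        case True
        then show ?thesis using nth1[OF True] k1 by (simp add: Q1 nth_append)
      next
        case False
        let ?u = "length U"
        have kk: "?u + 2 \<le> k" using k1 P1 V by simp
        have "Q ! i = P2 ! (i - ?u)" "Q ! (i - 2) = P2 ! (i - ?u - 2)"
          using False kk by (auto simp: Q2 nth_append diff_commute)
        moreover have "lab (P2 ! (i - ?u)) = lab (P2 ! (i - ?u - 2))"
          using nth2[of "i - ?u"] nth2[of "i - ?u - 2"] False kk less.prems lU
          by (auto)
        ultimately have "lab (Q ! i) = lab (Q ! (i - 2))" by simp
        also have "\<dots> = (if even (i - 2) then s1 else t1)"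
          by (rule less.IH) (use False kk less.prems in auto)
        finally show ?thesis using False kk by auto
      qed
    qed
    then show "map lab Q ! i = alt_word s1 t1 (k + length Z) ! i"
      using \<open>i < length (map lab Q)\<close> \<open>i < k + length Z\<close> by (simp add: nth_alt_word)
  qed (simp add: Q1 k1)
  obtain A B where AB: "(xs, A @ Q @ B) \<in> (swaps lab)\<^sup>*" using cQ unfolding contig_def by blast
  have "rval \<delta> F lab xs True P1 s1 t1 k = rval \<delta> F lab xs False P2 s2 t2 k"
    unfolding rval_def
  proof (rule sum.cong)
    fix i assume i: "i \<in> {1..<k}"
    have s2: "s2 \<noteq> t2" using ne st by (auto simp: doubleton_eq_iff)
    have co: "rcoef \<delta> s2 t2 k i = rcoef \<delta> s1 t1 k i" using ne s2 by (simp add: rcoef_def)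
    have e1: "sel True i P1 = sel True i Q" using i k1 by (simp add: sel_def Q1)
    have e2: "sel False i P2 = sel False i Q" using i k2 by (simp add: sel_def Q2) linarith
    have sub: "set P1 \<subseteq> set xs" "set P2 \<subseteq> set xs" using contig_set d c1 c2 by blast+
    show "rcoef \<delta> s1 t1 k i * F (rest lab xs (set (sel True i P1))) =
        rcoef \<delta> s2 t2 k i * F (rest lab xs (set (sel False i P2)))"
    proof (cases "rcoef \<delta> s1 t1 k i = 0")
      case False
      have "F (rest lab xs (set (sel True i Q))) = F (map lab A @ alt_word s1 t1 (k + length Z - i) @ map lab B)"
        by (rule good_comm[OF good _ rest_sel[OF AB d lQ _ rcoef_drop[OF False]]])
          (use rest_sel_length[OF sub(1) k1, where i = i and d = True and lab = lab] i in \<open>auto simp: e1\<close>)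
      moreover have "F (rest lab xs (set (sel False i Q))) = F (map lab A @ alt_word s1 t1 (k + length Z - i) @ map lab B)"
        by (rule good_comm[OF good _ rest_sel[OF AB d lQ _ rcoef_drop[OF False]]])
          (use rest_sel_length[OF sub(2) k2, where i = i and d = False and lab = lab] i in \<open>auto simp: e2\<close>)
      ultimately show ?thesis unfolding co e1 e2 by simp
    qed (simp add: co)
  qed simp
  then show ?thesis
    using rval_dir[OF c1 d l1 good] rval_dir[OF c2 d l2 good] by metis
qed

text \<open>Every later event of \<open>P1\<close> commutes with \<open>b2\<close>: if they were
  comparable, one would lie between \<open>x\<close> and the other, hence by convexity in both
  redexes. As \<open>b2\<close> depends on \<open>x\<close>, no later event of \<open>P1\<close>
  carries the letter of \<open>x\<close>, so only one event can follow \<open>x\<close>.\<close>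

lemma overlap_up:
  assumes d: "distinct xs"
    and c1: "contig lab xs P1" and l1: "map lab P1 = alt_word s1 t1 k1" and r1: "redex m s1 t1 k1"
    and c2: "contig lab xs P2" and l2: "map lab P2 = alt_word s2 t2 k2" and r2: "redex m s2 t2 k2"
    and I: "set P1 \<inter> set P2 = {x}" and P1: "P1 = A1 @ x # b1 # B1" and P2: "P2 = A2 @ x # b2 # B2"
  shows "B1 = [] \<and> s1 \<noteq> t1"
proof -
  have d1: "distinct P1" and d2: "distinct P2" and sub: "set P1 \<subseteq> set xs" "set P2 \<subseteq> set xs"
    using contig_set c1 c2 d by blast+
  have k1: "length P1 = k1" using l1 by (metis length_map length_alt_word)
  have h1: "(x, y) \<in> hedge lab xs" if "y \<in> set (b1 # B1)" for y
    by (rule chain_hedge[of lab xs "A1 @ [x]" "b1 # B1", OF _ d _ r1]) (use that c1 l1 P1 in auto)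
  have h2: "(x, b2) \<in> hedge lab xs"
    by (rule chain_hedge[of lab xs "A2 @ [x]" "b2 # B2", OF _ d _ r2]) (use c2 l2 P2 in auto)
  have ndep: "\<not> dep m (lab y) (lab b2)" if y: "y \<in> set (b1 # B1)" for y
  proof
    assume dep: "dep m (lab y) (lab b2)"
    have m: "y \<in> set P1" "b2 \<in> set P2" "x \<in> set P1" "x \<in> set P2" using y P1 P2 by auto
    have "y \<noteq> x" "b2 \<noteq> x" using d1 d2 y by (auto simp: P1 P2)
    then have n: "y \<notin> set P2" "b2 \<notin> set P1" using m(1,2) I by blast+
    then have "y \<noteq> b2" using m by blast
    moreover have "y \<in> set xs" "b2 \<in> set xs" using m(1,2) sub by blast+
    ultimately consider "(y, b2) \<in> hedge lab xs" | "(b2, y) \<in> hedge lab xs"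
      using hedge_total[where lab = lab, OF _ _ _ dep] by blast
    then show False
      using contig_convex[OF c2 d m(4,2) r_into_trancl[OF h1[OF y]]] contig_convex[OF c1 d m(3,1) r_into_trancl[OF h2]] n
      by cases blast+
  qed
  have dep2: "dep m (lab x) (lab b2)" using h2 by (simp add: hedge_def)
  have lb: "lab (P1 ! i) = (if even i then s1 else t1)" if "i < k1" for i
    using l1 nth_alt_word[OF that, of s1 t1] k1 that by (metis nth_map)
  have "s1 \<noteq> t1"
  proof
    assume "s1 = t1"
    then have "lab x = lab b1" using redex_labels[OF l1] P1 by auto
    then show False using ndep[of b1] dep2 by simp
  qed
  moreover have "B1 = []"
  proof (rule ccontr)
    assume "B1 \<noteq> []"
    then obtain c B where B: "B1 = c # B" by (meson list.exhaust)
    have "P1 ! length A1 = x" "P1 ! (length A1 + 2) = c" by (simp_all add: P1 B nth_append)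
    then have "lab c = lab x" using lb[of "length A1"] lb[of "length A1 + 2"] k1 P1 B by auto
    then show False using ndep[of c] dep2 B by simp
  qed
  ultimately show ?thesis by blast
qed

text \<open>The argument of \<open>overlap_up\<close> with the heap order reversed.\<close>

lemma overlap_down:
  assumes d: "distinct xs"
    and c1: "contig lab xs P1" and l1: "map lab P1 = alt_word s1 t1 k1" and r1: "redex m s1 t1 k1"
    and c2: "contig lab xs P2" and l2: "map lab P2 = alt_word s2 t2 k2" and r2: "redex m s2 t2 k2"
    and I: "set P1 \<inter> set P2 = {x}" and P1: "P1 = A1 @ b1 # x # B1" and P2: "P2 = A2 @ b2 # x # B2"
  shows "A1 = [] \<and> s1 \<noteq> t1"
proof -
  have d1: "distinct P1" and d2: "distinct P2" and sub: "set P1 \<subseteq> set xs" "set P2 \<subseteq> set xs"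
    using contig_set c1 c2 d by blast+
  have k1: "length P1 = k1" using l1 by (metis length_map length_alt_word)
  have h1: "(y, x) \<in> hedge lab xs" if "y \<in> set (A1 @ [b1])" for y
    by (rule chain_hedge[of lab xs "A1 @ [b1]" "x # B1", OF _ d _ r1]) (use that c1 l1 P1 in auto)
  have h2: "(b2, x) \<in> hedge lab xs"
    by (rule chain_hedge[of lab xs "A2 @ [b2]" "x # B2", OF _ d _ r2]) (use c2 l2 P2 in auto)
  have ndep: "\<not> dep m (lab y) (lab b2)" if y: "y \<in> set (A1 @ [b1])" for y
  proof
    assume dep: "dep m (lab y) (lab b2)"
    have m: "y \<in> set P1" "b2 \<in> set P2" "x \<in> set P1" "x \<in> set P2" using y P1 P2 by auto
    have "y \<noteq> x" "b2 \<noteq> x" using d1 d2 y by (auto simp: P1 P2)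
    then have n: "y \<notin> set P2" "b2 \<notin> set P1" using m(1,2) I by blast+
    then have "y \<noteq> b2" using m by blast
    moreover have "y \<in> set xs" "b2 \<in> set xs" using m(1,2) sub by blast+
    ultimately consider "(y, b2) \<in> hedge lab xs" | "(b2, y) \<in> hedge lab xs"
      using hedge_total[where lab = lab, OF _ _ _ dep] by blast
    then show False
      using contig_convex[OF c1 d m(1,3) _ r_into_trancl[OF h2]] contig_convex[OF c2 d m(2,4) _ r_into_trancl[OF h1[OF y]]] n
      by cases blast+
  qed
  have dep2: "dep m (lab x) (lab b2)" using h2 dep_sym by (simp add: hedge_def)
  have lb: "lab (P1 ! i) = (if even i then s1 else t1)" if "i < k1" for i
    using l1 nth_alt_word[OF that, of s1 t1] k1 that by (metis nth_map)
  have "s1 \<noteq> t1"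
  proof
    assume "s1 = t1"
    then have "lab x = lab b1" using redex_labels[OF l1] P1 by auto
    then show False using ndep[of b1] dep2 by simp
  qed
  moreover have "A1 = []"
  proof (rule ccontr)
    assume "A1 \<noteq> []"
    then obtain c B where B: "A1 = B @ [c]" by (meson rev_exhaust)
    have "P1 ! length B = c" "P1 ! (length B + 2) = x" by (simp_all add: P1 B nth_append)
    then have "lab c = lab x" using lb[of "length B"] lb[of "length B + 2"] k1 P1 B by auto
    then show False using ndep[of c] dep2 B by simp
  qed
  ultimately show ?thesis by blast
qed

text \<open>Deleting \<open>a1\<close> and \<open>x\<close> brings the equal letters of
  \<open>a2\<close> and \<open>b2\<close> together, and the quadratic rule then yields the factor
  \<open>\<delta>\<close>. The deleted set \<open>{a1, x, a2}\<close> is symmetric in the two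
  redexes, which closes the critical pair.\<close>

lemma middle_step:
  assumes good: "good \<delta> (length xs) F" and d: "distinct xs"
    and c1: "contig lab xs [a1, x, b1]" and l1: "map lab [a1, x, b1] = alt_word s1 t1 3" and r1: "redex m s1 t1 3"
    and c2: "contig lab xs [a2, x, b2]" and l2: "map lab [a2, x, b2] = alt_word s2 t2 3" and r2: "redex m s2 t2 3"
    and ne: "s1 \<noteq> t1" and I: "set [a1, x, b1] \<inter> set [a2, x, b2] = {x}"
  shows "rval \<delta> F lab xs True [a1, x, b1] s1 t1 3 = \<delta> * F (rest lab xs {a1, x, a2})"
proof -
  define ys where "ys = filter (\<lambda>z. z \<notin> {a1, x}) xs"
  have d1: "distinct [a1, x, b1]" and d2: "distinct [a2, x, b2]"
    and sub: "set [a1, x, b1] \<subseteq> set xs" "set [a2, x, b2] \<subseteq> set xs"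
    using contig_set c1 c2 d by blast+
  have sub_edge: "hedge lab ys \<subseteq> hedge lab xs" unfolding ys_def hedge_def by (auto simp: bef_filter)
  have a: "a2 \<notin> {a1, x}" "b2 \<notin> {a1, x}" using d2 I by (simp_all add: set_eq_iff) metis+
  have "filter (\<lambda>z. z \<in> set [a2, b2]) ys = filter (\<lambda>z. z \<in> set [a2, b2]) (filter (\<lambda>z. z \<in> set [a2, x, b2]) xs)"
    unfolding ys_def filter_filter using a by (intro filter_cong) auto
  also have "\<dots> = [a2, b2]" unfolding contig_filter_self[OF c2 d l2 r2] using d2 by auto
  finally have f: "filter (\<lambda>z. z \<in> set [a2, b2]) ys = [a2, b2]" .
  have c: "contig lab ys [a2, b2]"
  proof (rule convex_contig[OF _ _ f])
    show "distinct ys" using d by (simp add: ys_def)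
    fix p p' z
    assume p: "p \<in> set [a2, b2]" "p' \<in> set [a2, b2]" "z \<notin> set [a2, b2]"
      "(p, z) \<in> hedge lab ys" "(z, p') \<in> (hedge lab ys)\<^sup>+"
    have "(p, z) \<in> (hedge lab xs)\<^sup>+" "(z, p') \<in> (hedge lab xs)\<^sup>+"
      using p(4,5) sub_edge trancl_mono[OF p(5) sub_edge] by auto
    then have "z \<in> set [a2, x, b2]" using contig_convex[OF c2 d] p(1,2) by auto
    moreover have "z \<in> set ys" using p(4) bef_set by (fastforce simp: hedge_def)
    ultimately show False using p(3) by (auto simp: ys_def)
  qed
  have lab2: "map lab [a2, b2] = alt_word s2 s2 2" using l2 by (simp add: numeral_eq_Suc)
  have ly: "length ys < length xs" unfolding ys_def by (rule length_filter_less[of x]) (use sub in auto)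
  have rd: "redex m s2 s2 2" by (simp add: redex_def)
  have sum3: "{1..<3} = {1::nat, 2}" and sum2: "{1..<2} = {1::nat}" by auto
  \<comment> \<open>The rule for order 3 reads \<open>b_s b_t b_s = b_s\<close>.\<close>
  have rc: "rcoef \<delta> s1 t1 3 1 = 0" "rcoef \<delta> s1 t1 3 2 = 1"
    using ne by (simp_all add: rcoef_def numeral_eq_Suc)
  have "rval \<delta> F lab xs True [a1, x, b1] s1 t1 3 = F (map lab ys)"
    unfolding rval_def sum3 using rc by (simp add: sel_def rest_def ys_def numeral_2_eq_2)
  also have "\<dots> = rval \<delta> F lab ys True [a2, b2] s2 s2 2"
    by (rule good_rval[OF c _ lab2 rd good ly]) (simp add: ys_def d)
  also have "\<dots> = \<delta> * F (rest lab ys {a2})"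
    unfolding rval_def sum2 by (simp add: sel_def rcoef_def)
  also have "rest lab ys {a2} = rest lab xs {a1, x, a2}"
    unfolding rest_def ys_def filter_filter by (rule arg_cong[where f = "map lab"], rule filter_cong) auto
  finally show ?thesis .
qed


text \<open>If both redexes continue on the same side of \<open>x\<close>, then
  \<open>overlap_up\<close> and \<open>overlap_down\<close> force length 3 with \<open>x\<close> in
  the middle. Otherwise \<open>x\<close> ends one redex and starts the other, and each is shortened
  at its far end.\<close>

lemma overlap_one:
  assumes good: "good \<delta> (length xs) F" and d: "distinct xs"
    and c1: "contig lab xs P1" and l1: "map lab P1 = alt_word s1 t1 k1" and r1: "redex m s1 t1 k1"
    and c2: "contig lab xs P2" and l2: "map lab P2 = alt_word s2 t2 k2" and r2: "redex m s2 t2 k2"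
    and I: "set P1 \<inter> set P2 = {x}"
  shows "rval \<delta> F lab xs d1 P1 s1 t1 k1 = rval \<delta> F lab xs d2 P2 s2 t2 k2"
proof -
  have I': "set P2 \<inter> set P1 = {x}" using I by blast
  have k1: "length P1 = k1" and k2: "length P2 = k2" using l1 l2 by (metis length_map length_alt_word)+
  have di: "distinct P1" "distinct P2" using contig_set c1 c2 d by blast+
  obtain A1 B1 where P1: "P1 = A1 @ x # B1" using I by (metis IntE insertI1 split_list)
  obtain A2 B2 where P2: "P2 = A2 @ x # B2" using I by (metis IntE insertI1 split_list)
  have up: "\<exists>b1 b2. B1 = [b1] \<and> B2 = [b2] \<and> s1 \<noteq> t1 \<and> s2 \<noteq> t2" if ne: "B1 \<noteq> []" "B2 \<noteq> []"
  proof -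
    obtain b1 C1 b2 C2 where B: "B1 = b1 # C1" "B2 = b2 # C2" using ne by (cases B1; cases B2) auto
    show ?thesis
      using overlap_up[OF d c1 l1 r1 c2 l2 r2 I P1[unfolded B] P2[unfolded B]]
        overlap_up[OF d c2 l2 r2 c1 l1 r1 I' P2[unfolded B] P1[unfolded B]] B by blast
  qed
  have down: "\<exists>a1 a2. A1 = [a1] \<and> A2 = [a2] \<and> s1 \<noteq> t1 \<and> s2 \<noteq> t2" if ne: "A1 \<noteq> []" "A2 \<noteq> []"
  proof -
    obtain a1 C1 a2 C2 where A: "A1 = C1 @ [a1]" "A2 = C2 @ [a2]" using ne by (cases A1 rule: rev_cases; cases A2 rule: rev_cases) auto
    have Q: "P1 = C1 @ a1 # x # B1" "P2 = C2 @ a2 # x # B2" using P1 P2 A by simp_all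
    show ?thesis
      using overlap_down[OF d c1 l1 r1 c2 l2 r2 I Q]
        overlap_down[OF d c2 l2 r2 c1 l1 r1 I' Q(2) Q(1)] A by simp
  qed
  have len: "length A1 + length B1 + 1 = k1" "length A2 + length B2 + 1 = k2" using k1 k2 P1 P2 by auto
  show ?thesis
  proof (cases "A1 \<noteq> [] \<and> A2 \<noteq> [] \<or> B1 \<noteq> [] \<and> B2 \<noteq> []")
    case True
    have "A1 \<noteq> [] \<and> A2 \<noteq> [] \<and> B1 \<noteq> [] \<and> B2 \<noteq> []"
      using True
    proof
      assume "A1 \<noteq> [] \<and> A2 \<noteq> []"
      with down redex_ge(2)[OF r1] redex_ge(2)[OF r2] len show ?thesis by (cases B1; cases B2) auto
    next
      assume "B1 \<noteq> [] \<and> B2 \<noteq> []"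
      with up redex_ge(2)[OF r1] redex_ge(2)[OF r2] len show ?thesis by (cases A1; cases A2) auto
    qed
    then obtain a1 a2 b1 b2 where *: "A1 = [a1]" "A2 = [a2]" "B1 = [b1]" "B2 = [b2]" and ne: "s1 \<noteq> t1" "s2 \<noteq> t2"
      using up down by blast
    then have k: "k1 = 3" "k2 = 3" using len by auto
    have Q: "P1 = [a1, x, b1]" "P2 = [a2, x, b2]" using P1 P2 * by auto
    note f1 = c1[unfolded Q] l1[unfolded Q k] r1[unfolded k]
    note f2 = c2[unfolded Q] l2[unfolded Q k] r2[unfolded k]
    have "rval \<delta> F lab xs d1 P1 s1 t1 k1 = rval \<delta> F lab xs True P1 s1 t1 k1"
      by (rule rval_dir[OF c1 d l1 good])
    also have "\<dots> = \<delta> * F (rest lab xs {a1, x, a2})"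
      unfolding Q k by (rule middle_step[OF good d f1 f2 ne(1) I[unfolded Q]])
    also have "\<dots> = \<delta> * F (rest lab xs {a2, x, a1})"
      by (simp add: insert_commute)
    also have "\<dots> = rval \<delta> F lab xs True P2 s2 t2 k2"
      unfolding Q k by (rule middle_step[OF good d f2 f1 ne(2) I'[unfolded Q], symmetric])
    also have "\<dots> = rval \<delta> F lab xs d2 P2 s2 t2 k2"
      by (rule rval_dir[OF c2 d l2 good])
    finally show ?thesis .
  next
    case False
    have first: "set (sel True i (A @ [x])) \<inter> T = {}"
      if "distinct (A @ [x])" "set (A @ [x]) \<inter> T = {x}" "i < length (A @ [x])" for A T i
      using that by (auto simp: sel_def dest!: in_set_takeD)
    have last: "set (sel False i (x # B)) \<inter> T = {}"
      if "distinct (x # B)" "set (x # B) \<inter> T = {x}" "i < length (x # B)" for B T i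
    proof -
      have "set (sel False i (x # B)) \<subseteq> set B"
        using that(3) by (cases "length (x # B) - i") (auto simp: sel_def dest!: in_set_dropD)
      then show ?thesis using that(1,2) by auto
    qed
    show ?thesis
    proof (cases "A1 = []")
      case True
      then have "B2 = []" using False redex_ge(1)[OF r1] len by auto
      then have Q: "P1 = x # B1" "P2 = A2 @ [x]" using P1 P2 True by auto
      show ?thesis
        by (rule commuting_removals[where ?d1.0 = False and ?d2.0 = True, OF good d c1 l1 r1 c2 l2 r2])
          (use last[of B1 "set P2"] first[of A2 "set P1"] di I I' k1 k2 in \<open>simp_all add: Q\<close>)
    next
      case neq: False
      then have "A2 = []" using False by auto
      then have "B1 = []" using False redex_ge(1)[OF r2] len by auto
      then have Q: "P1 = A1 @ [x]" "P2 = x # B2" using P1 P2 \<open>A2 = []\<close> by auto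
      show ?thesis
        by (rule commuting_removals[where ?d1.0 = True and ?d2.0 = False, OF good d c1 l1 r1 c2 l2 r2])
          (use first[of A1 "set P2"] last[of B2 "set P1"] di I I' k1 k2 in \<open>simp_all add: Q\<close>)
    qed
  qed
qed

text \<open>By convexity two consecutive events of \<open>P1\<close> lie in \<open>P2\<close>, and
  consecutive events carry both letters.\<close>

lemma overlap_two_labels:
  assumes d: "distinct xs"
    and c1: "contig lab xs P1" and l1: "map lab P1 = alt_word s1 t1 k1" and r1: "redex m s1 t1 k1"
    and c2: "contig lab xs P2" and l2: "map lab P2 = alt_word s2 t2 k2"
    and x: "x \<in> set P1" "x \<in> set P2" and y: "y \<in> set P1" "y \<in> set P2" and xy: "x \<noteq> y"
  shows "{s1, t1} \<subseteq> {s2, t2}"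
proof -
  have k1: "length P1 = k1" using l1 by (metis length_map length_alt_word)
  have lb: "lab (P1 ! i) = (if even i then s1 else t1)" if "i < k1" for i
    using l1 nth_alt_word[OF that, of s1 t1] k1 that by (metis nth_map)
  have main: "{s1, t1} \<subseteq> {s2, t2}" if ij: "i < j" "j < k1" "P1 ! i \<in> set P2" "P1 ! j \<in> set P2" for i j
  proof -
    have e: "(P1 ! a, P1 ! b) \<in> hedge lab xs" if "a < b" "b < k1" for a b
    proof (rule chain_hedge[of lab xs "take b P1" "drop b P1", OF _ d _ r1])
      show "P1 ! a \<in> set (take b P1)" using that k1 by (auto simp: in_set_conv_nth intro!: exI[of _ a])
      show "P1 ! b \<in> set (drop b P1)" using that k1 by (metis Cons_nth_drop_Suc list.set_intros(1))
    qed (use c1 l1 in auto)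
    have "P1 ! (i + 1) \<in> set P2"
    proof (cases "i + 1 = j")
      case False
      then show ?thesis
        using contig_convex[OF c2 d ij(3,4) r_into_trancl[OF e] r_into_trancl[OF e]] ij by simp
    qed (use ij in simp)
    then have "lab (P1 ! i) \<in> {s2, t2}" "lab (P1 ! (i + 1)) \<in> {s2, t2}"
      using redex_labels[OF l2] ij by blast+
    then show ?thesis using lb[of i] lb[of "i + 1"] ij by (cases "even i") auto
  qed
  obtain i j where "i < k1" "j < k1" "P1 ! i = x" "P1 ! j = y" using x y k1 by (metis in_set_conv_nth)
  then show ?thesis using main[of i j] main[of j i] x y xy by (cases i j rule: linorder_cases) auto
qed

text \<open>Equal letter pairs give equal lengths, so different redexes are two windows of one size
  in the sequence of all events with these letters, a sequence that commutations cannot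
  change.\<close>

lemma overlap_two:
  assumes good: "good \<delta> (length xs) F" and d: "distinct xs"
    and c1: "contig lab xs P1" and l1: "map lab P1 = alt_word s1 t1 k1" and r1: "redex m s1 t1 k1"
    and c2: "contig lab xs P2" and l2: "map lab P2 = alt_word s2 t2 k2" and r2: "redex m s2 t2 k2"
    and x: "x \<in> set P1" "x \<in> set P2" and y: "y \<in> set P1" "y \<in> set P2" and xy: "x \<noteq> y"
  shows "rval \<delta> F lab xs d1 P1 s1 t1 k1 = rval \<delta> F lab xs d2 P2 s2 t2 k2"
proof -
  have st: "{s2, t2} = {s1, t1}"
    using overlap_two_labels[OF d c1 l1 r1 c2 l2 x y xy] overlap_two_labels[OF d c2 l2 r2 c1 l1 x(2,1) y(2,1) xy] by blast
  have k1: "length P1 = k1" and k2: "length P2 = k2" using l1 l2 by (metis length_map length_alt_word)+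
  have di: "distinct P1" "distinct P2" using contig_set c1 c2 d by blast+
  have kk: "k1 = k2"
    using r1 r2 st m_sym by (auto simp: redex_def doubleton_eq_iff)
  show ?thesis
  proof (cases "set P1 = set P2")
    case True
    then have "filter (\<lambda>x. x \<in> set P1) xs = filter (\<lambda>x. x \<in> set P2) xs" by (simp only:)
    then have P: "P1 = P2" unfolding contig_filter_self[OF c1 d l1 r1] contig_filter_self[OF c2 d l2 r2] .
    have "2 \<le> k1" using redex_ge r1 by blast
    then have "alt_word s1 t1 k1 ! 0 = s1" "alt_word s1 t1 k1 ! 1 = t1"
      "alt_word s2 t2 k1 ! 0 = s2" "alt_word s2 t2 k1 ! 1 = t2" by (simp_all add: nth_alt_word)
    then have "s1 = s2" "t1 = t2" using l1 l2 P kk by metis+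
    then show ?thesis using rval_dir[OF c1 d l1 good] P kk by metis
  next
    case False
    \<comment> \<open>With equal letters a redex has two events only; both would be shared and the
      redexes would coincide.\<close>
    have ne: "s1 \<noteq> t1"
    proof
      assume "s1 = t1"
      then have "k1 = 2" using r1 by (auto simp: redex_def)
      then have "card (set P1) = 2" "card (set P2) = 2" using k1 k2 kk di by (simp_all add: distinct_card)
      moreover have "card {x, y} = 2" using xy by simp
      moreover have "{x, y} \<subseteq> set P1" "{x, y} \<subseteq> set P2" using x y by auto
      ultimately have "{x, y} = set P1" "{x, y} = set P2"
        by (metis card_subset_eq finite_set)+
      then show False using False by simp
    qed
    have ne2: "s2 \<noteq> t2" using ne st by (auto simp: doubleton_eq_iff)
    define L where "L = filter (\<lambda>z. lab z \<in> {s1, t1}) xs"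
    have dL: "distinct L" using d by (simp add: L_def)
    have ex: "\<exists>X Y. L = X @ P @ Y" if h: "contig lab xs P" "map lab P = alt_word s t k1" "{s, t} = {s1, t1}" for P s t
    proof -
      obtain A B where AB: "(xs, A @ P @ B) \<in> (swaps lab)\<^sup>*" using h(1) unfolding contig_def by blast
      have "L = filter (\<lambda>z. lab z \<in> {s1, t1}) (A @ P @ B)"
        unfolding L_def by (rule swap_eq_filter_dep[OF AB]) (use redex_dep[OF r1] in blast)
      moreover have "filter (\<lambda>z. lab z \<in> {s1, t1}) P = P"
        using redex_labels[OF h(2)] h(3) by (auto intro!: filter_True)
      ultimately show ?thesis by auto
    qed
    obtain X1 Y1 where X1: "L = X1 @ P1 @ Y1" using ex c1 l1 by blast
    obtain X2 Y2 where X2: "L = X2 @ P2 @ Y2" using ex c2 l2 kk st by metis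
    \<comment> \<open>The shared events \<open>x\<close> and \<open>y\<close> cannot lie in the part
      \<open>U\<close> that precedes the second window, so the windows overlap in at least two
      events.\<close>
    have decomp: "\<exists>X U V Z Y. P = U @ V \<and> P' = V @ Z \<and> 2 \<le> length V \<and> L = X @ U @ V @ Z @ Y"
      if L: "L = X @ P @ Y" "L = X' @ P' @ Y'" "length X \<le> length X'" "length P = length P'"
        "x \<in> set P" "x \<in> set P'" "y \<in> set P" "y \<in> set P'" for P P' X X' Y Y'
    proof -
      obtain U where U: "X' = X @ U" "P @ Y = U @ P' @ Y'"
        using L(1,2,3) by (metis append_eq_append_conv_if append_take_drop_id append_eq_conv_conj append_assoc)
      have nU: "x \<notin> set U" "y \<notin> set U" using dL L(6,8) unfolding L(2) U(1) by auto
      show ?thesis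
      proof (cases "length U \<le> length P")
        case True
        then obtain V where V: "P = U @ V" "V @ Y = P' @ Y'"
          using U(2) by (metis append_eq_append_conv_if append_take_drop_id append_eq_conv_conj append_assoc)
        then have "length V \<le> length P'" using L(4) by simp
        then obtain Z where Z: "P' = V @ Z" "Y = Z @ Y'"
          using V(2) by (metis append_eq_append_conv_if append_take_drop_id append_eq_conv_conj append_assoc)
        have "{x, y} \<subseteq> set V" using L(5,7) nU V(1) by auto
        then have "card {x, y} \<le> card (set V)" by (intro card_mono) auto
        then have "2 \<le> length V" using card_length[of V] xy by simp
        then show ?thesis using V Z L(1) by (intro exI[of _ X] exI[of _ U] exI[of _ V] exI[of _ Z] exI[of _ "Y'"]) simp
      next
        case False
        then have "set P \<subseteq> set U" using U(2)
          by (metis append_eq_append_conv_if append_eq_conv_conj nat_le_linear set_take_subset)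
        then show ?thesis using nU L(5) by blast
      qed
    qed
    show ?thesis
    proof (cases "length X1 \<le> length X2")
      case True
      obtain X U V Z Y where D: "P1 = U @ V" "P2 = V @ Z" "2 \<le> length V" "L = X @ U @ V @ Z @ Y"
        using decomp[OF X1 X2 True] k1 k2 kk x y by auto
      show ?thesis unfolding kk[symmetric]
        by (rule shifted_overlap[OF good d c1 l1 r1 c2 l2[folded kk] r2[folded kk] ne st D(1-3) D(4)[unfolded L_def]])
    next
      case False
      obtain X U V Z Y where D: "P2 = U @ V" "P1 = V @ Z" "2 \<le> length V" "L = X @ U @ V @ Z @ Y"
        using decomp[OF X2 X1] False k1 k2 kk x y by auto
      show ?thesis unfolding kk[symmetric]
        by (rule shifted_overlap[OF good d c2 l2[folded kk] r2[folded kk] c1 l1 r1 ne2 st[symmetric] D(1-3)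
              D(4)[unfolded L_def st[symmetric]], symmetric])
    qed
  qed
qed

text \<open>The cases are governed by the number of common events: none, one, or at least
  two.\<close>

lemma local_confluence:
  assumes good: "good \<delta> n F" and r1: "redex m s1 t1 k1" and r2: "redex m s2 t2 k2"
    and eq: "(a1 @ alt_word s1 t1 k1 @ b1, a2 @ alt_word s2 t2 k2 @ b2) \<in> (comm_step m)\<^sup>*"
    and n: "length (a1 @ alt_word s1 t1 k1 @ b1) = n"
  shows "reduct \<delta> F a1 s1 t1 k1 b1 = reduct \<delta> F a2 s2 t2 k2 b2"
proof -
  define w where "w = a1 @ alt_word s1 t1 k1 @ b1"
  \<comment> \<open>Positions serve as events, so that repeated letters stay apart.\<close>
  define xs where "xs = [0..<n]"
  define lab where "lab = (\<lambda>i. w ! i)"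
  have xs: "map lab xs = w" "distinct xs" "length xs = n"
    using n by (auto simp: xs_def lab_def w_def[symmetric] map_nth)
  obtain A1 P1 B1 where 1: "xs = A1 @ P1 @ B1" "map lab A1 = a1" "map lab P1 = alt_word s1 t1 k1" "map lab B1 = b1"
    using xs(1) unfolding w_def by (auto simp: map_eq_append_conv append_eq_map_conv)
  obtain ys where ys: "(xs, ys) \<in> (swaps lab)\<^sup>*" "map lab ys = a2 @ alt_word s2 t2 k2 @ b2"
    using swap_eq_lift[of lab xs] eq xs(1) unfolding w_def by metis
  obtain A2 P2 B2 where 2: "ys = A2 @ P2 @ B2" "map lab A2 = a2" "map lab P2 = alt_word s2 t2 k2" "map lab B2 = b2"
    using ys(2) by (auto simp: map_eq_append_conv append_eq_map_conv)
  have sw1: "(xs, A1 @ P1 @ B1) \<in> (swaps lab)\<^sup>*" using 1 by simp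
  have sw2: "(xs, A2 @ P2 @ B2) \<in> (swaps lab)\<^sup>*" using ys(1) 2 by simp
  have c1: "contig lab xs P1" and c2: "contig lab xs P2" using sw1 sw2 unfolding contig_def by blast+
  have g: "good \<delta> (length xs) F" using good xs by simp
  have "rval \<delta> F lab xs True P1 s1 t1 k1 = rval \<delta> F lab xs True P2 s2 t2 k2"
  proof -
    consider "set P1 \<inter> set P2 = {}" | x where "set P1 \<inter> set P2 = {x}"
      | x y where "x \<in> set P1" "x \<in> set P2" "y \<in> set P1" "y \<in> set P2" "x \<noteq> y"
      by blast
    then show ?thesis
    proof cases
      case 1
      show ?thesis
        by (rule commuting_removals[where ?d1.0 = True and ?d2.0 = True, OF g xs(2) c1 \<open>map lab P1 = _\<close> r1 c2 2(3) r2])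
          (use 1 sel_subset[of True _ P1] sel_subset[of True _ P2] in blast)+
    next
      case (2 x)
      show ?thesis by (rule overlap_one[OF g xs(2) c1 \<open>map lab P1 = _\<close> r1 c2 \<open>map lab P2 = _\<close> r2 2])
    next
      case (3 x y)
      show ?thesis by (rule overlap_two[OF g xs(2) c1 \<open>map lab P1 = _\<close> r1 c2 \<open>map lab P2 = _\<close> r2 3])
    qed
  qed
  then show ?thesis
    using reduct_rval[OF sw1 xs(2) 1(3) g, of True] reduct_rval[OF sw2 xs(2) 2(3) g, of True] 1 2 by simp
qed


subsection \<open>Normal forms\<close>

definition has_redex :: "'a list \<Rightarrow> bool" where
  "has_redex w \<longleftrightarrow> (\<exists>a s t k b. redex m s t k \<and> (w, a @ alt_word s t k @ b) \<in> (comm_step m)\<^sup>*)"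

definition red_vals :: "'r::comm_ring_1 \<Rightarrow> ('a list \<Rightarrow> 'r) \<Rightarrow> 'a list \<Rightarrow> 'r set" where
  "red_vals \<delta> F w = {reduct \<delta> F a s t k b | a s t k b.
     redex m s t k \<and> (w, a @ alt_word s t k @ b) \<in> (comm_step m)\<^sup>*}"

text \<open>Stage \<open>Suc n\<close> settles the words of length \<open>n\<close>. If such a word
  has a redex, the value is that of an arbitrary reduct, which \<open>local_confluence\<close> makes
  independent of the choice; on irreducible words \<open>g\<close> prescribes the value.\<close>

primrec nf :: "'r::comm_ring_1 \<Rightarrow> ('a list \<Rightarrow> 'r) \<Rightarrow> nat \<Rightarrow> 'a list \<Rightarrow> 'r" where
  "nf \<delta> g 0 w = 0"
| "nf \<delta> g (Suc n) w = (if length w < n then nf \<delta> g n w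
     else if has_redex w then SOME r. r \<in> red_vals \<delta> (nf \<delta> g n) w else g w)"

lemma comm_eq_sym: "(u, v) \<in> (comm_step m)\<^sup>* \<Longrightarrow> (v, u) \<in> (comm_step m)\<^sup>*"
  unfolding comm_step_eq by (rule swap_eq_sym)

lemma comm_eq_length: "(u, v) \<in> (comm_step m)\<^sup>* \<Longrightarrow> length v = length u"
  unfolding comm_step_eq using swap_eq_set by blast

lemma comm_eq_iff: "(u, v) \<in> (comm_step m)\<^sup>* \<Longrightarrow> (u, w) \<in> (comm_step m)\<^sup>* \<longleftrightarrow> (v, w) \<in> (comm_step m)\<^sup>*"
  using comm_eq_sym rtrancl_trans by metis

lemma has_redex_comm: "(u, v) \<in> (comm_step m)\<^sup>* \<Longrightarrow> has_redex u \<longleftrightarrow> has_redex v"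
  unfolding has_redex_def using comm_eq_iff by blast

lemma red_vals_comm: "(u, v) \<in> (comm_step m)\<^sup>* \<Longrightarrow> red_vals \<delta> F u = red_vals \<delta> F v"
  unfolding red_vals_def using comm_eq_iff by blast

lemma reduct_cong:
  assumes "\<And>w. length w < length a + k + length b \<Longrightarrow> F w = G w"
  shows "reduct \<delta> F a s t k b = reduct \<delta> G a s t k b"
  unfolding reduct_def by (rule sum.cong) (use assms in auto)

text \<open>Goodness up to \<open>n\<close> is exactly what \<open>local_confluence\<close> needs
  for the stage of length \<open>n\<close> to be well defined.\<close>

lemma nf_good:
  assumes g: "\<And>u v. (u, v) \<in> (comm_step m)\<^sup>* \<Longrightarrow> g u = g v"
  shows "good \<delta> n (nf \<delta> g n)"
proof (induction n)
  case (Suc n)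
  have c: "nf \<delta> g (Suc n) u = nf \<delta> g (Suc n) v" if "length u < Suc n" "(u, v) \<in> (comm_step m)\<^sup>*" for u v
    using good_comm[OF Suc _ that(2)] comm_eq_length[OF that(2)] that(1) has_redex_comm[OF that(2)]
      red_vals_comm[OF that(2), of \<delta> "nf \<delta> g n"] g[OF that(2)] by auto
  have r: "nf \<delta> g (Suc n) (a @ alt_word s t k @ b) = reduct \<delta> (nf \<delta> g (Suc n)) a s t k b"
    if rd: "redex m s t k" and l: "length (a @ alt_word s t k @ b) < Suc n" for a s t k b
  proof -
    have e: "reduct \<delta> (nf \<delta> g (Suc n)) a s t k b = reduct \<delta> (nf \<delta> g n) a s t k b"
      by (rule reduct_cong) (use l in simp)
    show ?thesis
    proof (cases "length (a @ alt_word s t k @ b) < n")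
      case True
      then show ?thesis using good_redex[OF Suc rd True] e by simp
    next
      case False
      let ?w = "a @ alt_word s t k @ b"
      have n: "length ?w = n" using False l by simp
      have hr: "has_redex ?w" unfolding has_redex_def using rd by blast
      have "r = reduct \<delta> (nf \<delta> g n) a s t k b" if r: "r \<in> red_vals \<delta> (nf \<delta> g n) ?w" for r
      proof -
        obtain a' s' t' k' b' where 1: "r = reduct \<delta> (nf \<delta> g n) a' s' t' k' b'" "redex m s' t' k'"
          "(?w, a' @ alt_word s' t' k' @ b') \<in> (comm_step m)\<^sup>*"
          using r unfolding red_vals_def by blast
        show ?thesis unfolding 1(1) by (rule local_confluence[OF Suc rd 1(2,3) n, symmetric])
      qed
      moreover have "reduct \<delta> (nf \<delta> g n) a s t k b \<in> red_vals \<delta> (nf \<delta> g n) ?w"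
        unfolding red_vals_def using rd by blast
      ultimately have "(SOME r. r \<in> red_vals \<delta> (nf \<delta> g n) ?w) = reduct \<delta> (nf \<delta> g n) a s t k b"
        by (metis someI)
      then show ?thesis using False hr e by simp
    qed
  qed
  show ?case unfolding good_def using c r by blast
qed (simp add: good_def)

lemma nf_mono:
  fixes \<delta> :: "'r::comm_ring_1"
  shows "length w < n \<Longrightarrow> nf \<delta> g n w = nf \<delta> g (Suc (length w)) w"
proof (induction n)
  case (Suc n)
  show ?case
  proof (cases "length w < n")
    case False
    then have "n = length w" using Suc.prems by simp
    then show ?thesis by (simp only:)
  next
    case True
    then have "nf \<delta> g (Suc n) w = nf \<delta> g n w" by (simp only: nf.simps if_True)
    then show ?thesis unfolding Suc.IH[OF True] .
  qed
qed simp

text \<open>Any class function on irreducible words extends to a functional satisfying all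
  relations; this is the independence of irreducible monomials up to commutation. Vanishing below
  \<open>N\<close> is inherited because reducts are shorter.\<close>

lemma nf_exists:
  fixes \<delta> :: "'r::comm_ring_1"
  assumes g: "\<And>u v. (u, v) \<in> (comm_step m)\<^sup>* \<Longrightarrow> g u = g v"
    and g0: "\<And>u. length u < N \<Longrightarrow> g u = 0"
  obtains F where "\<And>n. good \<delta> n F" "\<And>u. \<not> has_redex u \<Longrightarrow> F u = g u" "\<And>u. length u < N \<Longrightarrow> F u = 0"
proof
  define F where "F w = nf \<delta> g (Suc (length w)) w" for w
  have FN: "nf \<delta> g n w = F w" if "length w < n" for n w
    unfolding F_def by (rule nf_mono[OF that])
  show good: "good \<delta> n F" for n
    unfolding good_def
  proof (intro conjI allI impI)
    fix u v assume uv: "length u < n" "(u, v) \<in> (comm_step m)\<^sup>*"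
    have "nf \<delta> g n u = nf \<delta> g n v" by (rule good_comm[OF nf_good[OF g] uv])
    moreover have "length v < n" using uv comm_eq_length by simp
    ultimately show "F u = F v" using FN uv(1) by simp
  next
    fix a s t k b assume 1: "redex m s t k" "length (a @ alt_word s t k @ b) < n"
    have "F (a @ alt_word s t k @ b) = nf \<delta> g n (a @ alt_word s t k @ b)" using FN[OF 1(2)] by simp
    also have "\<dots> = reduct \<delta> (nf \<delta> g n) a s t k b" by (rule good_redex[OF nf_good[OF g] 1])
    also have "\<dots> = reduct \<delta> F a s t k b"
      by (rule reduct_cong, rule FN) (use 1 in auto)
    finally show "F (a @ alt_word s t k @ b) = reduct \<delta> F a s t k b" .
  qed
  show "F u = g u" if "\<not> has_redex u" for u using that by (simp add: F_def)
  then have irr: "F u = g u" if "\<not> has_redex u" for u using that by blast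
  show "F u = 0" if "length u < N" for u
    using that
  proof (induction u rule: length_induct)
    case (1 u)
    show ?case
    proof (cases "has_redex u")
      case True
      then obtain a s t k b where r: "redex m s t k" "(u, a @ alt_word s t k @ b) \<in> (comm_step m)\<^sup>*"
        unfolding has_redex_def by blast
      have l: "length a + k + length b = length u" using comm_eq_length[OF r(2)] by simp
      have "F u = F (a @ alt_word s t k @ b)"
        by (rule good_comm[OF good _ r(2)]) (rule lessI)
      also have "\<dots> = reduct \<delta> F a s t k b"
        by (rule good_redex[OF good r(1)]) (rule lessI)
      also have "\<dots> = 0"
        unfolding reduct_def by (rule sum.neutral) (use 1 l in auto)
      finally show ?thesis .
    qed (use irr g0 1 in simp)
  qed
qed

end

text \<open>Functionals on words form a module over the free algebra, with \<open>b\<^sub>s\<close> acting by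
  \<open>F \<mapsto> (\<lambda>p. F (p @ [s]))\<close>; \<open>rho v u\<close> is the action of the product of the
  \<open>T\<^sub>s = v b\<^sub>s - 1\<close> over the word \<open>u\<close>.\<close>
primrec rho :: "'r::comm_ring_1 \<Rightarrow> 'a list \<Rightarrow> ('a list \<Rightarrow> 'r) \<Rightarrow> 'a list \<Rightarrow> 'r" where
  "rho v [] F = F"
| "rho v (s # u) F = (\<lambda>p. v * rho v u F (p @ [s]) - rho v u F p)"

lemma rho_append: "rho v (a @ b) F = rho v a (rho v b F)"
  by (induction a) auto

context coxeter_matrix
begin

section \<open>Functionals satisfying the relations, and Hecke operators on them\<close>

definition tl_fun :: "'r::comm_ring_1 \<Rightarrow> ('a list \<Rightarrow> 'r) \<Rightarrow> bool" where
  "tl_fun \<delta> F \<longleftrightarrow> (\<forall>n. good \<delta> n F)"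

lemma tl_fun_comm: "tl_fun \<delta> F \<Longrightarrow> m s t = 2 \<Longrightarrow> F (a @ s # t # b) = F (a @ t # s # b)"
proof -
  assume F: "tl_fun \<delta> F" and st: "m s t = 2"
  have "(a @ [s, t] @ b, a @ [t, s] @ b) \<in> comm_step m"
    unfolding comm_step_def using st by (auto simp: numeral_eq_enat)
  then have "(a @ s # t # b, a @ t # s # b) \<in> (comm_step m)\<^sup>*" by auto
  then show ?thesis using F good_comm unfolding tl_fun_def by blast
qed

lemma tl_fun_redex: "tl_fun \<delta> F \<Longrightarrow> redex m s t k \<Longrightarrow> F (a @ alt_word s t k @ b) = reduct \<delta> F a s t k b"
  unfolding tl_fun_def using good_redex by blast

lemma tl_funI:
  assumes "\<And>a b s t. m s t = 2 \<Longrightarrow> F (a @ s # t # b) = F (a @ t # s # b)"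
    and "\<And>a s t k b. redex m s t k \<Longrightarrow> F (a @ alt_word s t k @ b) = reduct \<delta> F a s t k b"
  shows "tl_fun \<delta> F"
proof -
  have "F u = F v" if "(u, v) \<in> (comm_step m)\<^sup>*" for u v
    using that
  proof induction
    case (step y z)
    then show ?case using assms(1) by (auto simp: comm_step_def numeral_eq_enat)
  qed simp
  then show ?thesis unfolding tl_fun_def good_def using assms(2) by blast
qed

lemma tl_fun_shift: "tl_fun \<delta> F \<Longrightarrow> tl_fun \<delta> (\<lambda>p. F (p @ q))"
proof (rule tl_funI)
  fix a b s t assume "tl_fun \<delta> F" "m s t = 2"
  then show "F ((a @ s # t # b) @ q) = F ((a @ t # s # b) @ q)"
    using tl_fun_comm[of \<delta> F s t a "b @ q"] by simp
next
  fix a s t k b assume "tl_fun \<delta> F" "redex m s t k"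
  from tl_fun_redex[OF this, of a "b @ q"]
  show "F ((a @ alt_word s t k @ b) @ q) = reduct \<delta> (\<lambda>p. F (p @ q)) a s t k b"
    by (simp add: reduct_def)
qed

lemma tl_fun_lincomb: "tl_fun \<delta> F \<Longrightarrow> tl_fun \<delta> G \<Longrightarrow> tl_fun \<delta> (\<lambda>p. c * F p - G p)"
proof (rule tl_funI)
  fix a b s t assume "tl_fun \<delta> F" "tl_fun \<delta> G" "m s t = 2"
  then show "c * F (a @ s # t # b) - G (a @ s # t # b) = c * F (a @ t # s # b) - G (a @ t # s # b)"
    using tl_fun_comm by metis
next
  fix a s t k b assume "tl_fun \<delta> F" "tl_fun \<delta> G" and r: "redex m s t k"
  then show "c * F (a @ alt_word s t k @ b) - G (a @ alt_word s t k @ b) =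
       reduct \<delta> (\<lambda>p. c * F p - G p) a s t k b"
    unfolding tl_fun_redex[OF \<open>tl_fun \<delta> F\<close> r] tl_fun_redex[OF \<open>tl_fun \<delta> G\<close> r] reduct_def
    by (simp add: sum_distrib_left sum_subtractf[symmetric] algebra_simps)
qed

lemma tl_fun_rho: "tl_fun \<delta> F \<Longrightarrow> tl_fun \<delta> (rho v u F)"
  by (induction u) (auto intro: tl_fun_lincomb tl_fun_shift)

text \<open>The loop value \<open>v + v'\<close> is what makes \<open>v b_s - 1\<close> satisfy the
  Hecke relation with \<open>q = v * v\<close>. The ring is kept general to include
  \<open>v = 1\<close> over the integers.\<close>

lemma rho_quadratic:
  assumes F: "tl_fun \<delta> F" and v: "v * v' = 1" and \<delta>: "\<delta> = v + v'"
  shows "rho v [s, s] F p = (v * v - 1) * rho v [s] F p + v * v * F p"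
proof -
  have "redex m s s 2" by (simp add: redex_def)
  from tl_fun_redex[OF F this, of p "[]"] have "F (p @ [s, s]) = \<delta> * F (p @ [s])"
    by (simp add: reduct_def rcoef_def numeral_2_eq_2)
  moreover have "v * v * \<delta> = v * v * v + v"
  proof -
    have "v * v * \<delta> = v * v * v + v * (v * v')" unfolding \<delta> by (simp add: algebra_simps)
    then show ?thesis by (simp add: v)
  qed
  then have "v * (v * (\<delta> * F (p @ [s]))) = (v * v * v + v) * F (p @ [s])"
    by (metis mult.assoc)
  ultimately show ?thesis by (simp add: algebra_simps)
qed

text \<open>The action of \<open>v\<^sup>k U\<^sub>k(s,t)\<close>.\<close>
fun chebop :: "'r::comm_ring_1 \<Rightarrow> nat \<Rightarrow> 'a \<Rightarrow> 'a \<Rightarrow> ('a list \<Rightarrow> 'r) \<Rightarrow> 'a list \<Rightarrow> 'r" where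
  "chebop v 0 s t F p = 0"
| "chebop v (Suc 0) s t F p = v * F (p @ [s])"
| "chebop v (Suc (Suc k)) s t F p = v * chebop v (Suc k) t s F (p @ [s]) - v * v * chebop v k s t F p"

text \<open>Unrolls the recursion. Coefficients with \<open>k \<le> 2 * j\<close> are zero, which
  takes care of the truncated subtraction in the word length.\<close>

lemma chebop_expand:
  "chebop v k s t F p = (\<Sum>j<k. v ^ k * of_int (cheb k j) * F (p @ alt_word s t (k - 2 * j)))"
proof (induction v k s t F p rule: chebop.induct)
  case (3 v k s t F p)
  let ?A = "\<lambda>j. F (p @ alt_word s t (Suc (Suc k) - 2 * j))"
  have alt: "of_int (cheb (Suc k) j) * F ((p @ [s]) @ alt_word t s (Suc k - 2 * j)) = of_int (cheb (Suc k) j) * ?A j" for j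
  proof (cases "Suc k \<le> 2 * j")
    case False
    then have "Suc (Suc k) - 2 * j = Suc (Suc k - 2 * j)" by simp
    then show ?thesis by simp
  qed (simp add: cheb_eq_0)
  have 1: "v * chebop v (Suc k) t s F (p @ [s]) = (\<Sum>j<Suc (Suc k). v ^ Suc (Suc k) * of_int (cheb (Suc k) j) * ?A j)"
  proof -
    have "v * chebop v (Suc k) t s F (p @ [s]) = (\<Sum>j<Suc k. v ^ Suc (Suc k) * (of_int (cheb (Suc k) j) * F ((p @ [s]) @ alt_word t s (Suc k - 2 * j))))"
      unfolding 3(1) by (simp add: sum_distrib_left mult.assoc del: sum.lessThan_Suc)
    also have "\<dots> = (\<Sum>j<Suc k. v ^ Suc (Suc k) * of_int (cheb (Suc k) j) * ?A j)"
      unfolding alt by (simp add: mult.assoc del: sum.lessThan_Suc)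
    also have "\<dots> = (\<Sum>j<Suc (Suc k). v ^ Suc (Suc k) * of_int (cheb (Suc k) j) * ?A j)"
      unfolding sum.lessThan_Suc[of _ "Suc k"] by (subst (3) cheb_eq_0) simp_all
    finally show ?thesis .
  qed
  have 2: "v * v * chebop v k s t F p = (\<Sum>j<Suc (Suc k). v ^ Suc (Suc k) * of_int (if j = 0 then 0 else cheb k (j - 1)) * ?A j)"
  proof -
    have "v * v * chebop v k s t F p = (\<Sum>j<k. v ^ Suc (Suc k) * of_int (cheb k j) * ?A (Suc j))"
      unfolding 3(2) by (simp add: sum_distrib_left mult.assoc)
    also have "\<dots> = (\<Sum>j<Suc k. v ^ Suc (Suc k) * of_int (cheb k j) * ?A (Suc j))"
      by (simp add: cheb_eq_0)
    also have "\<dots> = (\<Sum>j<Suc (Suc k). v ^ Suc (Suc k) * of_int (if j = 0 then 0 else cheb k (j - 1)) * ?A j)"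
      by (subst (2) sum.lessThan_Suc_shift) simp
    finally show ?thesis .
  qed
  show ?case
    unfolding chebop.simps(3) 1 2 sum_subtractf[symmetric]
    by (rule sum.cong) (auto simp: algebra_simps)
qed simp_all

text \<open>The rewriting rule with all terms on one side; odd deletions have coefficient 0, so only
  \<open>i = 2 * j\<close> remains.\<close>

lemma chebop_zero:
  assumes F: "tl_fun \<delta> F" and st: "s \<noteq> t" "m s t = enat k" "3 \<le> k"
  shows "chebop v k s t F p = 0"
proof -
  have "redex m s t k" using st by (simp add: redex_def)
  from tl_fun_redex[OF F this, of p "[]"]
  have "F (p @ alt_word s t k) = (\<Sum>i=1..<k. if even i then - of_int (cheb k (i div 2)) * F (p @ alt_word s t (k - i)) else 0)"
    using st(1) by (simp add: reduct_def rcoef_def if_distrib[of "\<lambda>x. x * _"] cong: if_cong)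
  also have "\<dots> = (\<Sum>i\<in>(\<lambda>j. 2 * j) ` {j. 1 \<le> j \<and> 2 * j < k}. - of_int (cheb k (i div 2)) * F (p @ alt_word s t (k - i)))"
    by (subst sum.inter_filter[symmetric], simp, rule sum.cong) (auto elim!: evenE)
  also have "\<dots> = (\<Sum>j\<in>{j. 1 \<le> j \<and> 2 * j < k}. - of_int (cheb k j) * F (p @ alt_word s t (k - 2 * j)))"
    by (subst sum.reindex) (auto simp: inj_on_def)
  also have "\<dots> = (\<Sum>j=1..<k. - of_int (cheb k j) * F (p @ alt_word s t (k - 2 * j)))"
    by (rule sum.mono_neutral_left) (auto simp: cheb_eq_0 not_less intro: ccontr)
  finally have "F (p @ alt_word s t k) + (\<Sum>j=1..<k. of_int (cheb k j) * F (p @ alt_word s t (k - 2 * j))) = 0"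
    by (simp add: sum_negf)
  moreover have "{..<k} = insert 0 {1..<k}" using st by auto
  moreover have "cheb k 0 = 1" using st cheb_0[of "k - 1"] by simp
  ultimately have "(\<Sum>j<k. of_int (cheb k j) * F (p @ alt_word s t (k - 2 * j))) = 0"
    by simp
  then have "v ^ k * (\<Sum>j<k. of_int (cheb k j) * F (p @ alt_word s t (k - 2 * j))) = 0" by simp
  then show ?thesis unfolding chebop_expand by (simp add: sum_distrib_left mult.assoc)
qed

text \<open>The Chebyshev elements are the Kazhdan--Lusztig elements of a dihedral group, so the rewriting rule
  \<open>U\<^sub>k = 0\<close> is the vanishing of the generator of the ideal.\<close>
lemma chebop_rho:
  assumes F: "tl_fun \<delta> F" and v: "v * v' = 1" and \<delta>: "\<delta> = v + v'"
  shows "chebop v (Suc k) s t F p = rho v (alt_word s t (Suc k)) F p + F p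
     + (\<Sum>j=1..<Suc k. rho v (alt_word s t j) F p + rho v (alt_word t s j) F p)"
proof (induction k arbitrary: s t p rule: less_induct)
  case (less k)
  let ?R = "\<lambda>s t j. rho v (alt_word s t j) F"
  show ?case
  proof (cases k)
    case (Suc n)
    have G: "tl_fun \<delta> (rho v u F)" for u by (rule tl_fun_rho[OF F])
    have bs: "v * G (p @ [s]) = rho v [s] G p + G p" for G :: "'a list \<Rightarrow> 'b" by simp
    \<comment> \<open>\<open>v b_s\<close> acts as \<open>T_s + 1\<close>, and
      \<open>(T_s + 1) T_s = q (T_s + 1)\<close>.\<close>
    have bb: "v * ?R s t (Suc j) (p @ [s]) = v * v * (?R t s j p + ?R s t (Suc j) p)" for j
    proof -
      have "v * ?R s t (Suc j) (p @ [s]) = rho v [s] (rho v [s] (?R t s j)) p + rho v [s] (?R t s j) p"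
        by (simp only: bs) (simp add: rho_append[symmetric])
      also have "rho v [s] (rho v [s] (?R t s j)) p = rho v [s, s] (?R t s j) p" by simp
      also have "\<dots> = (v * v - 1) * rho v [s] (?R t s j) p + v * v * ?R t s j p"
        by (rule rho_quadratic[OF G v \<delta>])
      finally show ?thesis by (simp add: algebra_simps)
    qed
    have a: "v * ?R t s j (p @ [s]) = ?R s t (Suc j) p + ?R t s j p" for j by simp
    have L: "v * chebop v (Suc n) t s F (p @ [s]) = ?R s t (Suc (Suc n)) p + ?R t s (Suc n) p
       + (?R s t 1 p + F p) + (\<Sum>j=1..<Suc n. (?R s t (Suc j) p + ?R t s j p)
       + v * v * (?R t s (j - 1) p + ?R s t j p))"
    proof -
      have "v * chebop v (Suc n) t s F (p @ [s]) = v * ?R t s (Suc n) (p @ [s]) + v * F (p @ [s])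
         + (\<Sum>j=1..<Suc n. v * ?R t s j (p @ [s]) + v * ?R s t j (p @ [s]))"
      proof -
        have "chebop v (Suc n) t s F (p @ [s]) = ?R t s (Suc n) (p @ [s]) + F (p @ [s])
          + (\<Sum>j=1..<Suc n. ?R t s j (p @ [s]) + ?R s t j (p @ [s]))"
          by (rule less) (use Suc in simp)
        then show ?thesis by (simp only: distrib_left sum_distrib_left)
      qed
      also have "\<dots> = (?R s t (Suc (Suc n)) p + ?R t s (Suc n) p) + (?R s t 1 p + F p)
         + (\<Sum>j=1..<Suc n. (?R s t (Suc j) p + ?R t s j p) + v * v * (?R t s (j - 1) p + ?R s t j p))"
      proof -
        have "(\<Sum>j=1..<Suc n. v * ?R t s j (p @ [s]) + v * ?R s t j (p @ [s])) =
           (\<Sum>j=1..<Suc n. (?R s t (Suc j) p + ?R t s j p) + v * v * (?R t s (j - 1) p + ?R s t j p))"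
        proof (rule sum.cong)
          fix j assume "j \<in> {1..<Suc n}"
          then obtain i where "j = Suc i" by (cases j) auto
          then show "v * ?R t s j (p @ [s]) + v * ?R s t j (p @ [s]) =
             (?R s t (Suc j) p + ?R t s j p) + v * v * (?R t s (j - 1) p + ?R s t j p)"
            using a[of j] bb[of i] by simp
        qed simp
        then show ?thesis using a[of "Suc n"] bs[of F] by simp
      qed
      finally show ?thesis by simp
    qed
    \<comment> \<open>The formula for the smaller element, arranged to cancel the terms with factor
      \<open>v * v\<close> in \<open>L\<close>.\<close>
    have M: "chebop v n s t F p = (\<Sum>j=1..<Suc n. ?R t s (j - 1) p + ?R s t j p)"
    proof (cases n)
      case (Suc i)
      have sh: "(\<Sum>j=1..<Suc (Suc i). ?R t s (j - 1) p) = F p + (\<Sum>j=1..<Suc i. ?R t s j p)"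
      proof -
        have "(\<Sum>j=1..<Suc (Suc i). ?R t s (j - 1) p) = (\<Sum>j=0..<Suc i. ?R t s j p)"
          using sum.shift_bounds_Suc_ivl[of "\<lambda>j. ?R t s (j - 1) p" 0 "Suc i"] by simp
        also have "\<dots> = F p + (\<Sum>j=1..<Suc i. ?R t s j p)"
          by (subst sum.atLeast_Suc_lessThan) simp_all
        finally show ?thesis .
      qed
      show ?thesis
        using less[of i] \<open>k = Suc n\<close> Suc sh by (simp add: sum.distrib algebra_simps)
    qed simp
    have sh: "?R s t 1 p + (\<Sum>j=1..<Suc n. ?R s t (Suc j) p) = (\<Sum>j=1..<Suc (Suc n). ?R s t j p)"
      using sum.shift_bounds_Suc_ivl[of "\<lambda>j. ?R s t j p" 1 "Suc n"]
        sum.atLeast_Suc_lessThan[of 1 "Suc (Suc n)" "\<lambda>j. ?R s t j p"] by (simp add: numeral_2_eq_2)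
    have "chebop v (Suc k) s t F p = v * chebop v (Suc n) t s F (p @ [s]) - v * v * chebop v n s t F p"
      using Suc by simp
    also have "\<dots> = ?R s t (Suc (Suc n)) p + F p + (?R s t 1 p + (\<Sum>j=1..<Suc n. ?R s t (Suc j) p))
        + ((\<Sum>j=1..<Suc n. ?R t s j p) + ?R t s (Suc n) p)"
      unfolding L M sum.distrib sum_distrib_left[symmetric]
      by (simp add: algebra_simps del: alt_word.simps sum.op_ivl_Suc)
    also have "(\<Sum>j=1..<Suc n. ?R t s j p) + ?R t s (Suc n) p = (\<Sum>j=1..<Suc (Suc n). ?R t s j p)"
      by simp
    finally show ?thesis unfolding sh using Suc by (simp add: sum.distrib del: alt_word.simps sum.atLeastLessThan_Suc)
  qed simp
qed


text \<open>For order at least 3 both Chebyshev elements vanish, and by \<open>chebop_rho\<close>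
  they differ only in their leading terms. Order 2 is a commutation.\<close>

lemma rho_braid:
  assumes F: "tl_fun \<delta> F" and v: "v * v' = 1" and \<delta>: "\<delta> = v + v'" and st: "s \<noteq> t" "m s t = enat k"
  shows "rho v (alt_word s t k) F = rho v (alt_word t s k) F"
proof
  fix p
  have "2 \<le> enat k" using m_off[OF st(1)] st(2) by simp
  then have "2 \<le> k" by (simp add: numeral_eq_enat)
  then consider "k = 2" | n where "3 \<le> k" "k = Suc n" by (cases k) force+
  then show "rho v (alt_word s t k) F p = rho v (alt_word t s k) F p"
  proof cases
    case 1
    have "F (p @ [s, t]) = F (p @ [t, s])"
      using tl_fun_comm[OF F, of s t p "[]"] st 1 by (simp add: numeral_eq_enat)
    then show ?thesis using 1 by (simp add: numeral_2_eq_2 algebra_simps)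
  next
    case 2
    have "m t s = enat k" using st(2) m_sym by simp
    then have "chebop v (Suc n) s t F p = 0" "chebop v (Suc n) t s F p = 0"
      using chebop_zero[OF F] st 2 by metis+
    note z = this[unfolded chebop_rho[OF F v \<delta>], folded 2(2)]
    have e: "(\<Sum>j=1..<k. rho v (alt_word t s j) F p + rho v (alt_word s t j) F p) =
        (\<Sum>j=1..<k. rho v (alt_word s t j) F p + rho v (alt_word t s j) F p)"
      by (rule sum.cong[OF refl add.commute])
    have "rho v (alt_word s t k) F p + F p = rho v (alt_word t s k) F p + F p"
      by (rule trans[OF eq_neg_iff_add_eq_0[THEN iffD2, OF z(1)] eq_neg_iff_add_eq_0[THEN iffD2, OF z(2)[unfolded e], symmetric]])
    then show ?thesis by (rule add_right_imp_eq)
  qed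
qed

text \<open>When the product of the factors \<open>v b_s - 1\<close> is expanded, every proper
  subword is too short for \<open>F\<close>.\<close>

lemma rho_low:
  assumes "\<And>p. length p < N \<Longrightarrow> F p = 0" "length p + length u \<le> N"
  shows "rho v u F p = v ^ length u * F (p @ u)"
  using assms(2)
proof (induction u arbitrary: p)
  case (Cons s u)
  have "rho v u F p = v ^ length u * F (p @ u)" by (rule Cons.IH) (use Cons.prems in simp)
  also have "F (p @ u) = 0" by (rule assms(1)) (use Cons.prems in simp)
  finally show ?case using Cons.IH[of "p @ [s]"] Cons.prems by (simp add: mult.assoc)
qed simp

text \<open>Adjacent letters could commute only if \<open>m s t = 2\<close>, and then the word would
  have fewer than two letters.\<close>

lemma alt_word_comm:
  assumes "(alt_word s t j, v) \<in> (comm_step m)\<^sup>*" "s \<noteq> t" "enat j < m s t"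
  shows "v = alt_word s t j"
  using assms(1)
proof induction
  case (step y z)
  obtain a b x x' where 1: "y = a @ [x, x'] @ b" "m x x' = enat 2"
    using step(2) unfolding comm_step_def by blast
  let ?i = "length a"
  have "length (a @ [x, x'] @ b) = j" using step(3) 1 by (metis length_alt_word)
  then have j: "?i + 1 < j" by simp
  have "(a @ [x, x'] @ b) ! ?i = x" "(a @ [x, x'] @ b) ! (?i + 1) = x'" by (simp_all add: nth_append)
  then have "alt_word s t j ! ?i = x" "alt_word s t j ! (?i + 1) = x'"
    unfolding step(3)[symmetric] 1(1) .
  then have "{x, x'} = {s, t}" using j by (auto simp: nth_alt_word split: if_splits)
  then have "m s t = enat 2" using 1 m_sym by (auto simp: doubleton_eq_iff)
  then show ?case using assms(3) j by simp
qed simp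

lemma alt_word_no_redex:
  assumes "s \<noteq> t" "enat j < m s t"
  shows "\<not> has_redex (alt_word s t j)"
proof
  assume "has_redex (alt_word s t j)"
  then obtain a s' t' k b where r: "redex m s' t' k" and c: "(alt_word s t j, a @ alt_word s' t' k @ b) \<in> (comm_step m)\<^sup>*"
    unfolding has_redex_def by blast
  have e: "a @ alt_word s' t' k @ b = alt_word s t j" by (rule alt_word_comm[OF c assms])
  then have l: "length a + k + length b = j" using length_alt_word[of s t j] by (metis length_append length_alt_word add.assoc)
  have n: "alt_word s t j ! (length a + i) = alt_word s' t' k ! i" if "i < k" for i
    unfolding e[symmetric] using that by (simp add: nth_append)
  have k2: "2 \<le> k" using redex_ge[OF r] by simp
  have "s' = (if even (length a) then s else t)" "t' = (if even (length a) then t else s)"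
    using n[of 0] n[of 1] k2 l by (auto simp: nth_alt_word)
  then have "s' \<noteq> t'" "m s' t' = m s t" using assms m_sym by auto
  then have "m s t = enat k" using r by (simp add: redex_def)
  then show False using assms(2) l by simp
qed

end

subsection \<open>Coxeter groups\<close>

text \<open>The heap locale has no carrier set. Letters outside \<open>S\<close> get order infinity
  with all other letters, which adds neither commutations nor long braids.\<close>

definition total_matrix :: "'a set \<Rightarrow> ('a \<Rightarrow> 'a \<Rightarrow> enat) \<Rightarrow> 'a \<Rightarrow> 'a \<Rightarrow> enat" where
  "total_matrix S m s t = (if s \<in> S \<and> t \<in> S then m s t else if s = t then 1 else \<infinity>)"

lemma coxeter_matrix_total: "coxeter_graph S m \<Longrightarrow> coxeter_matrix (total_matrix S m)"
  by unfold_locales (auto simp: total_matrix_def coxeter_graph_def)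

locale coxeter =
  fixes S :: "'a set" and m :: "'a \<Rightarrow> 'a \<Rightarrow> enat"
  assumes graph: "coxeter_graph S m"
begin

sublocale T: coxeter_matrix "total_matrix S m"
  using coxeter_matrix_total[OF graph] .

abbreviation cl where "cl \<equiv> cox_cls S m"
abbreviation W where "W \<equiv> cox_W S m"
abbreviation mul (infixl "\<cdot>" 70) where "x \<cdot> y \<equiv> cox_mult S m x y"
abbreviation gn where "gn \<equiv> cox_gen S m"
abbreviation len where "len \<equiv> cox_len"

lemma m_sym: "s \<in> S \<Longrightarrow> t \<in> S \<Longrightarrow> m s t = m t s"
  using graph by (simp add: coxeter_graph_def)

lemma m_ge: "s \<in> S \<Longrightarrow> t \<in> S \<Longrightarrow> s \<noteq> t \<Longrightarrow> 2 \<le> m s t"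
  using graph by (simp add: coxeter_graph_def)

lemma alt_word_lists: "s \<in> S \<Longrightarrow> t \<in> S \<Longrightarrow> alt_word s t k \<in> lists S"
  using set_alt_word[of s t k] by auto

lemma step_lists: "(u, v) \<in> cox_step S m \<Longrightarrow> u \<in> lists S \<and> v \<in> lists S"
  by (induction rule: cox_step.induct) (auto simp: alt_word_lists simp del: in_lists_conv_set)

lemma step_parity: "(u, v) \<in> cox_step S m \<Longrightarrow> even (length u) \<longleftrightarrow> even (length v)"
  by (induction rule: cox_step.induct) auto

lemma equiv_refl: "(u, u) \<in> cox_equiv S m"
  by (simp add: cox_equiv_def)

lemma equiv_sym: "(u, v) \<in> cox_equiv S m \<Longrightarrow> (v, u) \<in> cox_equiv S m"
proof -
  have "sym ((cox_step S m \<union> (cox_step S m)\<inverse>)\<^sup>*)" by (rule sym_rtrancl) (auto simp: sym_def)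
  then show "(u, v) \<in> cox_equiv S m \<Longrightarrow> (v, u) \<in> cox_equiv S m"
    unfolding cox_equiv_def by (rule symD)
qed

lemma equiv_trans: "(u, v) \<in> cox_equiv S m \<Longrightarrow> (v, w) \<in> cox_equiv S m \<Longrightarrow> (u, w) \<in> cox_equiv S m"
  unfolding cox_equiv_def by (rule rtrancl_trans)

lemma equiv_induct [consumes 1, case_names refl step]:
  assumes "(u, v) \<in> cox_equiv S m" "P u u"
    and "\<And>y z. (y, z) \<in> cox_step S m \<or> (z, y) \<in> cox_step S m \<Longrightarrow> P u y \<Longrightarrow> P u z"
  shows "P u v"
  using assms(1) unfolding cox_equiv_def
  by (induction rule: rtrancl_induct) (use assms(2,3) in auto)

lemma equiv_lists: "(u, v) \<in> cox_equiv S m \<Longrightarrow> u \<in> lists S \<Longrightarrow> v \<in> lists S"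
  by (induction rule: equiv_induct) (use step_lists in blast)+

lemma equiv_parity: "(u, v) \<in> cox_equiv S m \<Longrightarrow> even (length u) \<longleftrightarrow> even (length v)"
  by (induction rule: equiv_induct) (use step_parity in blast)+

lemma step_context: "(u, v) \<in> cox_step S m \<Longrightarrow> a \<in> lists S \<Longrightarrow> b \<in> lists S \<Longrightarrow> (a @ u @ b, a @ v @ b) \<in> cox_step S m"
proof (induction rule: cox_step.induct)
  case (del u v s)
  then show ?case using cox_step.del[of "a @ u" S "v @ b" s m] by simp
next
  case (braid u v s t k)
  then show ?case using cox_step.braid[of "a @ u" S "v @ b" s t m k] by simp
qed

lemma equiv_context: "(u, v) \<in> cox_equiv S m \<Longrightarrow> a \<in> lists S \<Longrightarrow> b \<in> lists S \<Longrightarrow> (a @ u @ b, a @ v @ b) \<in> cox_equiv S m"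
proof (induction rule: equiv_induct)
  case refl
  then show ?case by (simp add: equiv_refl)
next
  case (step y z)
  have "(a @ y @ b, a @ z @ b) \<in> cox_equiv S m"
    using step(1) step_context[OF _ step(3,4)] unfolding cox_equiv_def by blast
  then show ?case using step(2-4) equiv_trans by blast
qed

lemma cl_eq_iff: "cl u = cl v \<longleftrightarrow> (u, v) \<in> cox_equiv S m"
  unfolding cox_cls_def using equiv_sym equiv_trans equiv_refl by blast

lemma mem_cl: "v \<in> cl u \<longleftrightarrow> (u, v) \<in> cox_equiv S m"
  by (simp add: cox_cls_def)

lemma cl_in_W: "u \<in> lists S \<Longrightarrow> cl u \<in> W"
  by (simp add: cox_W_def)

lemma W_cases:
  assumes "w \<in> W" obtains u where "u \<in> lists S" "w = cl u"
  using assms by (auto simp: cox_W_def)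

lemma rep_in: "cox_rep (cl u) \<in> cl u"
  unfolding cox_rep_def by (rule someI[of _ u]) (simp add: mem_cl equiv_refl)

lemma rep_equiv: "(u, cox_rep (cl u)) \<in> cox_equiv S m"
  using rep_in mem_cl by blast

lemma cl_append_cong:
  assumes "cl u = cl u'" "cl v = cl v'" "u \<in> lists S" "v \<in> lists S"
  shows "cl (u @ v) = cl (u' @ v')"
proof -
  have "u' \<in> lists S" using assms equiv_lists cl_eq_iff by blast
  then have "(u @ v, u' @ v) \<in> cox_equiv S m" "(u' @ v, u' @ v') \<in> cox_equiv S m"
    using equiv_context[of u u' "[]" v] equiv_context[of v v' u' "[]"] assms cl_eq_iff by auto
  then show ?thesis using cl_eq_iff equiv_trans by blast
qed

lemma mul_cl: "u \<in> lists S \<Longrightarrow> v \<in> lists S \<Longrightarrow> cl u \<cdot> cl v = cl (u @ v)"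
  unfolding cox_mult_def by (rule cl_append_cong[symmetric]) (use rep_equiv cl_eq_iff in blast)+

lemma gn_cl: "gn s = cl [s]"
  by (simp add: cox_gen_def)

lemma rev_alt_word: "rev (alt_word s t k) = (if even k then alt_word t s k else alt_word s t k)"
  by (rule nth_equalityI) (auto simp: rev_nth nth_alt_word)

lemma step_rev: "(u, v) \<in> cox_step S m \<Longrightarrow> (rev u, rev v) \<in> cox_step S m \<or> (rev v, rev u) \<in> cox_step S m"
proof (induction rule: cox_step.induct)
  case (del u v s)
  then show ?case using cox_step.del[of "rev v" S "rev u" s m] by (simp add: in_lists_conv_set)
next
  case (braid u v s t k)
  have "m t s = enat k" using braid m_sym by simp
  then show ?case using braid cox_step.braid[of "rev v" S "rev u" s t m k] cox_step.braid[of "rev v" S "rev u" t s m k]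
    by (auto simp: in_lists_conv_set rev_alt_word)
qed

lemma cl_rev_cong: "cl u = cl v \<Longrightarrow> cl (rev u) = cl (rev v)"
  unfolding cl_eq_iff
proof (induction rule: equiv_induct)
  case refl
  then show ?case by (rule equiv_refl)
next
  case (step y z)
  then have "(rev y, rev z) \<in> cox_equiv S m" using step_rev unfolding cox_equiv_def by blast
  then show ?case using step equiv_trans by blast
qed

lemma inv_cl: "cox_inv S m (cl u) = cl (rev u)"
  unfolding cox_inv_def using cl_rev_cong rep_equiv cl_eq_iff by metis

lemma cl_del: "u \<in> lists S \<Longrightarrow> v \<in> lists S \<Longrightarrow> s \<in> S \<Longrightarrow> cl (u @ s # s # v) = cl (u @ v)"
  unfolding cl_eq_iff cox_equiv_def using cox_step.del[of u S v s m] by auto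

lemma cl_braid: "u \<in> lists S \<Longrightarrow> v \<in> lists S \<Longrightarrow> s \<in> S \<Longrightarrow> t \<in> S \<Longrightarrow> s \<noteq> t \<Longrightarrow> m s t = enat k \<Longrightarrow>
     cl (u @ alt_word s t k @ v) = cl (u @ alt_word t s k @ v)"
  unfolding cl_eq_iff cox_equiv_def using cox_step.braid[of u S v s t m k] by auto

lemma cl_rev_cancel: "u \<in> lists S \<Longrightarrow> a \<in> lists S \<Longrightarrow> b \<in> lists S \<Longrightarrow> cl (a @ u @ rev u @ b) = cl (a @ b)"
proof (induction u arbitrary: a b)
  case (Cons s u)
  have "cl (a @ (s # u) @ rev (s # u) @ b) = cl ((a @ [s]) @ u @ rev u @ (s # b))" by simp
  also have "\<dots> = cl ((a @ [s]) @ s # b)" by (rule Cons.IH) (use Cons.prems in auto)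
  also have "\<dots> = cl (a @ b)" using cl_del[of a b s] Cons.prems by simp
  finally show ?case .
qed simp

lemma cl_rev_cancel': "u \<in> lists S \<Longrightarrow> a \<in> lists S \<Longrightarrow> b \<in> lists S \<Longrightarrow> cl (a @ rev u @ u @ b) = cl (a @ b)"
  using cl_rev_cancel[of "rev u" a b] by (simp add: in_lists_conv_set)

lemma W_nonempty_word: "w \<in> W \<Longrightarrow> u \<in> w \<Longrightarrow> u \<in> lists S \<and> cl u = w"
  by (metis W_cases cl_eq_iff mem_cl equiv_lists)

lemma len_le: "len (cl u) \<le> length u"
  unfolding cox_len_def by (rule Least_le) (use mem_cl equiv_refl in blast)

lemma len_attained: "\<exists>v. cl v = cl u \<and> length v = len (cl u)"
proof -
  have "\<exists>v\<in>cl u. length v = len (cl u)" unfolding cox_len_def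
    by (rule LeastI[of _ "length u"]) (use mem_cl equiv_refl in blast)
  then show ?thesis using mem_cl cl_eq_iff by metis
qed

definition red :: "'a list \<Rightarrow> bool" where
  "red u \<longleftrightarrow> u \<in> lists S \<and> length u = len (cl u)"

lemma red_exists:
  assumes "w \<in> W" obtains u where "red u" "cl u = w"
  using assms len_attained unfolding red_def by (metis W_cases cl_eq_iff equiv_lists)

lemma red_words_iff: "w \<in> W \<Longrightarrow> u \<in> red_words w \<longleftrightarrow> red u \<and> cl u = w"
proof -
  assume w: "w \<in> W"
  have "u \<in> w \<longleftrightarrow> u \<in> lists S \<and> cl u = w"
  proof
    assume "u \<in> lists S \<and> cl u = w"
    then show "u \<in> w" using mem_cl[of u u] equiv_refl by simp
  qed (use W_nonempty_word[OF w] in blast)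
  then show ?thesis unfolding red_words_def red_def by (simp del: in_lists_conv_set) metis
qed

lemma red_word_red: "w \<in> W \<Longrightarrow> red (red_word w) \<and> cl (red_word w) = w"
proof -
  assume w: "w \<in> W"
  obtain u where "red u" "cl u = w" by (rule red_exists[OF w])
  then have "u \<in> red_words w" using red_words_iff[OF w] by blast
  then have "red_word w \<in> red_words w" unfolding red_word_def by (rule someI)
  then show ?thesis using red_words_iff[OF w] by blast
qed

lemma len_parity: "even (len (cl u)) \<longleftrightarrow> even (length u)"
  using len_attained[of u] equiv_parity cl_eq_iff by metis

lemma cl_cons_cong: "cl u = cl v \<Longrightarrow> u \<in> lists S \<Longrightarrow> s \<in> S \<Longrightarrow> cl (s # u) = cl (s # v)"
  using cl_append_cong[of "[s]" "[s]" u v] by simp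

lemma cl_snoc_cong: "cl u = cl v \<Longrightarrow> u \<in> lists S \<Longrightarrow> s \<in> S \<Longrightarrow> cl (u @ [s]) = cl (v @ [s])"
  using cl_append_cong[of u v "[s]" "[s]"] by simp

lemma len_cons_le:
  assumes "u \<in> lists S" "s \<in> S"
  shows "len (cl (s # u)) \<le> Suc (len (cl u))"
proof -
  obtain v where v: "cl v = cl u" "length v = len (cl u)" using len_attained by blast
  have "cl (s # u) = cl (s # v)" by (rule cl_cons_cong[OF v(1)[symmetric] assms])
  then show ?thesis using len_le[of "s # v"] v(2) by simp
qed

lemma len_snoc_le:
  assumes "u \<in> lists S" "s \<in> S"
  shows "len (cl (u @ [s])) \<le> Suc (len (cl u))"
proof -
  obtain v where v: "cl v = cl u" "length v = len (cl u)" using len_attained by blast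
  have "cl (u @ [s]) = cl (v @ [s])" by (rule cl_snoc_cong[OF v(1)[symmetric] assms])
  then show ?thesis using len_le[of "v @ [s]"] v(2) by simp
qed

lemma len_cons:
  assumes "u \<in> lists S" "s \<in> S"
  shows "len (cl (s # u)) = Suc (len (cl u)) \<or> len (cl u) = Suc (len (cl (s # u)))"
proof -
  have "len (cl u) \<le> Suc (len (cl (s # u)))"
    using len_cons_le[of "s # u" s] cl_del[of "[]" u s] assms by simp
  moreover have "even (len (cl (s # u))) \<noteq> even (len (cl u))" by (simp add: len_parity)
  ultimately show ?thesis using len_cons_le[OF assms] by (metis le_SucE le_antisym)
qed

lemma len_snoc:
  assumes "u \<in> lists S" "s \<in> S"
  shows "len (cl (u @ [s])) = Suc (len (cl u)) \<or> len (cl u) = Suc (len (cl (u @ [s])))"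
proof -
  have "len (cl u) \<le> Suc (len (cl (u @ [s])))"
    using len_snoc_le[of "u @ [s]" s] cl_del[of u "[]" s] assms by simp
  moreover have "even (len (cl (u @ [s]))) \<noteq> even (len (cl u))" by (simp add: len_parity)
  ultimately show ?thesis using len_snoc_le[OF assms] by (metis le_SucE le_antisym)
qed

subsection \<open>The strong exchange property\<close>

text \<open>\<open>nl u\<close> lists, letter by letter, the reflections whose right multiplication deletes that letter from \<open>u\<close>.
  The parity of the number of occurrences of a fixed reflection depends only on the group element.\<close>
primrec nl :: "'a list \<Rightarrow> 'a list set list" where
  "nl [] = []"
| "nl (s # u) = cl (rev u @ s # u) # nl u"

text \<open>Seen from the end of \<open>u @ v\<close>, a reflection belonging to a letter of
  \<open>u\<close> is conjugated by \<open>v\<close>; hence the shifted argument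
  \<open>v @ q @ rev v\<close>.\<close>

lemma cnt_append:
  assumes "u \<in> lists S" "v \<in> lists S" "q \<in> lists S"
  shows "count_list (nl (u @ v)) (cl q) = count_list (nl u) (cl (v @ q @ rev v)) + count_list (nl v) (cl q)"
  using assms(1)
proof (induction u rule: list.induct)
  case (Cons s u)
  have s: "s \<in> S" "u \<in> lists S" "rev u \<in> lists S" "rev v \<in> lists S" using Cons.prems assms(2) by (auto simp: in_lists_conv_set)
  have "cl (rev (u @ v) @ s # u @ v) = cl q \<longleftrightarrow> cl (rev u @ s # u) = cl (v @ q @ rev v)"
  proof
    assume "cl (rev (u @ v) @ s # u @ v) = cl q"
    then have "cl (v @ (rev (u @ v) @ s # u @ v) @ rev v) = cl (v @ q @ rev v)"
      using s assms by (simp only: cl_eq_iff) (rule equiv_context, auto)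
    moreover have "cl (v @ (rev (u @ v) @ s # u @ v) @ rev v) = cl ([] @ v @ rev v @ ((rev u @ s # u) @ v @ rev v))" by simp
    moreover have "\<dots> = cl ([] @ ((rev u @ s # u) @ v @ rev v))" by (rule cl_rev_cancel) (use s assms in auto)
    moreover have "\<dots> = cl ((rev u @ s # u) @ v @ rev v @ [])" by simp
    moreover have "\<dots> = cl ((rev u @ s # u) @ [])" by (rule cl_rev_cancel) (use s assms in auto)
    ultimately show "cl (rev u @ s # u) = cl (v @ q @ rev v)" by simp
  next
    assume "cl (rev u @ s # u) = cl (v @ q @ rev v)"
    then have "cl (rev v @ (rev u @ s # u) @ v) = cl (rev v @ (v @ q @ rev v) @ v)"
      using s assms by (simp only: cl_eq_iff) (rule equiv_context, auto)
    moreover have "cl (rev v @ (v @ q @ rev v) @ v) = cl ([] @ rev v @ v @ (q @ rev v @ v))" by simp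
    moreover have "\<dots> = cl ([] @ (q @ rev v @ v))" by (rule cl_rev_cancel') (use s assms in auto)
    moreover have "\<dots> = cl (q @ rev v @ v @ [])" by simp
    moreover have "\<dots> = cl (q @ [])" by (rule cl_rev_cancel') (use s assms in auto)
    ultimately show "cl (rev (u @ v) @ s # u @ v) = cl q" by simp
  qed
  then show ?case using Cons.IH s by simp
qed simp

text \<open>The reflections of a dihedral subgroup are its alternating words of odd length.\<close>

lemma nl_alt_word:
  "nl (alt_word s t k) = rev (map (\<lambda>j. cl (if odd k then alt_word s t (2 * j + 1) else alt_word t s (2 * j + 1))) [0..<k])"
proof (induction k arbitrary: s t)
  case (Suc k)
  have "rev (alt_word t s k) @ s # alt_word t s k = (if even k then alt_word s t (2 * k + 1) else alt_word t s (2 * k + 1))"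
  proof (rule nth_equalityI)
    have nth2: "(s # alt_word t s k) ! j = (if even j then s else t)" if "j < Suc k" for j
      using nth_alt_word[of j "Suc k" s t] that by simp
    fix i assume "i < length (rev (alt_word t s k) @ s # alt_word t s k)"
    then have "i < 2 * k + 1" by simp
    then consider "i < k" | "i = k" | n where "i = Suc (k + n)" "n < k"
      by (metis add_Suc_right less_iff_Suc_add linorder_neqE_nat mult_2 Suc_eq_plus1 add_less_cancel_left not_less_eq)
    then show "(rev (alt_word t s k) @ s # alt_word t s k) ! i =
        (if even k then alt_word s t (2 * k + 1) else alt_word t s (2 * k + 1)) ! i"
      by cases (auto simp: nth_append rev_nth nth_alt_word nth2 simp del: alt_word.simps)
  qed simp
  then show ?case using Suc[of t s] by auto
qed simp

lemma alt_word_Suc: "alt_word s t (Suc k) = alt_word s t k @ [if even k then s else t]"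
  by (induction k arbitrary: s t) auto

text \<open>Past length \<open>k\<close> an alternating word folds back: each further letter cancels
  one letter of the opposite alternating word.\<close>

lemma cl_alt_word_reflect:
  assumes "s \<in> S" "t \<in> S" "s \<noteq> t" "m s t = enat k" "i \<le> k"
  shows "cl (alt_word s t (k + i)) = cl (alt_word t s (k - i))"
  using assms(5)
proof (induction i)
  case 0
  then show ?case using cl_braid[of "[]" "[]" s t k] assms by simp
next
  case (Suc i)
  let ?x = "if even (k + i) then s else t"
  have "cl (alt_word s t (k + Suc i)) = cl (alt_word s t (k + i) @ [?x])" by (simp only: add_Suc_right alt_word_Suc)
  also have "\<dots> = cl (alt_word t s (k - i) @ [?x])"
    by (rule cl_snoc_cong) (use Suc assms alt_word_lists in auto)
  also have "k - i = Suc (k - Suc i)" using Suc.prems by simp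
  also have "alt_word t s (Suc (k - Suc i)) = alt_word t s (k - Suc i) @ [?x]"
    unfolding alt_word_Suc using Suc.prems by auto
  also have "cl ((alt_word t s (k - Suc i) @ [?x]) @ [?x]) = cl (alt_word t s (k - Suc i))"
    using cl_del[of "alt_word t s (k - Suc i)" "[]" ?x] alt_word_lists assms by auto
  finally show ?case .
qed

text \<open>Both sides run through the same \<open>k\<close> reflections in opposite order: the
  lengths \<open>2 * j + 1\<close> and \<open>2 * (k - 1 - j) + 1\<close> add up to
  \<open>2 * k\<close>, so folding identifies the corresponding words.\<close>

lemma nl_braid:
  assumes "s \<in> S" "t \<in> S" "s \<noteq> t" "m s t = enat k"
  shows "nl (alt_word s t k) = rev (nl (alt_word t s k))"
proof -
  have e: "cl (alt_word x y (2 * j + 1)) = cl (alt_word y x (2 * (k - 1 - j) + 1))"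
    if "j < k" "x \<in> S" "y \<in> S" "x \<noteq> y" "m x y = enat k" "m y x = enat k" for x y j
  proof (cases "k \<le> 2 * j + 1")
    case True
    have "k + (2 * j + 1 - k) = 2 * j + 1" "k - (2 * j + 1 - k) = 2 * (k - 1 - j) + 1" using True that(1) by auto
    then show ?thesis using cl_alt_word_reflect[of x y k "2 * j + 1 - k"] that by simp
  next
    case False
    have "k + (k - (2 * j + 1)) = 2 * (k - 1 - j) + 1" "k - (k - (2 * j + 1)) = 2 * j + 1" using False that(1) by auto
    then show ?thesis using cl_alt_word_reflect[of y x k "k - (2 * j + 1)"] that False by simp
  qed
  have ts: "m t s = enat k" using assms m_sym by simp
  show ?thesis
    unfolding nl_alt_word rev_rev_ident
  proof (rule nth_equalityI)
    fix i assume "i < length (rev (map (\<lambda>j. cl (if odd k then alt_word s t (2 * j + 1) else alt_word t s (2 * j + 1))) [0..<k]))"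
    then have i: "i < k" by simp
    show "rev (map (\<lambda>j. cl (if odd k then alt_word s t (2 * j + 1) else alt_word t s (2 * j + 1))) [0..<k]) ! i =
      map (\<lambda>j. cl (if odd k then alt_word t s (2 * j + 1) else alt_word s t (2 * j + 1))) [0..<k] ! i"
      using i e[of i s t] e[of i t s] assms ts by (cases "odd k") (simp_all add: rev_nth)
  qed simp
qed

text \<open>A cancelled square contributes one reflection twice, and a braid move only reverses the
  order of its reflections.\<close>

lemma cnt_parity:
  assumes "(u, v) \<in> cox_equiv S m" "q \<in> lists S"
  shows "odd (count_list (nl u) (cl q)) = odd (count_list (nl v) (cl q))"
proof -
  have st: "odd (count_list (nl u) (cl q)) = odd (count_list (nl v) (cl q))" if "(u, v) \<in> cox_step S m" for u v
    using that
  proof (cases rule: cox_step.cases)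
    case (del a b s)
    have "rev b \<in> lists S" using del by (auto simp: in_lists_conv_set)
    have e: "cl ([s, s] @ b) = cl b" using cl_del[of "[]" b s] del by simp
    have e2: "cl (rev ([s, s] @ b)) = cl (rev b)" by (rule cl_rev_cong[OF e])
    have "cl ([s, s] @ b @ q @ rev b @ [s, s]) = cl (b @ q @ rev b)"
    proof -
      have "cl (([s, s] @ b) @ q @ rev ([s, s] @ b)) = cl (b @ q @ rev b)"
        by (rule cl_append_cong[OF e cl_append_cong[OF refl e2]]) (use del assms(2) \<open>rev b \<in> lists S\<close> in auto)
      then show ?thesis by simp
    qed
    then have "count_list (nl u) (cl q) = count_list (nl v) (cl q) + count_list (nl [s, s]) (cl (b @ q @ rev b))"
      unfolding del(1,2) using cnt_append[of a "[s, s] @ b" q] cnt_append[of "[s, s]" b q] cnt_append[of a b q] del assms(2) by simp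
    moreover have "cl [s, s, s] = cl [s]" using cl_del[of "[]" "[s]" s] del by simp
    ultimately show ?thesis by simp
  next
    case (braid a b s t k)
    have rb: "rev b \<in> lists S" using braid by (auto simp: in_lists_conv_set)
    note al = alt_word_lists[of s t k] alt_word_lists[of t s k]
    have e: "cl (alt_word s t k @ b) = cl (alt_word t s k @ b)" using cl_braid[of "[]" b s t k] braid by simp
    have "cl ((alt_word s t k @ b) @ q @ rev (alt_word s t k @ b)) = cl ((alt_word t s k @ b) @ q @ rev (alt_word t s k @ b))"
      by (rule cl_append_cong[OF e cl_append_cong[OF refl cl_rev_cong[OF e]]]) (use braid assms(2) rb al in \<open>auto simp: in_lists_conv_set\<close>)
    moreover have "nl (alt_word s t k) = rev (nl (alt_word t s k))" by (rule nl_braid) (use braid in auto)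
    ultimately show ?thesis
      unfolding braid(1,2) using cnt_append[of a "alt_word s t k @ b" q] cnt_append[of "alt_word s t k" b q]
        cnt_append[of a "alt_word t s k @ b" q] cnt_append[of "alt_word t s k" b q] braid al assms(2) by simp
  qed
  show ?thesis using assms(1) by (induction rule: equiv_induct) (use st in blast)+
qed

definition refl_word :: "'a list \<Rightarrow> bool" where
  "refl_word q \<longleftrightarrow> (\<exists>p\<in>lists S. \<exists>s\<in>S. q = p @ s # rev p)"

lemma refl_word_lists: "refl_word q \<Longrightarrow> q \<in> lists S"
  unfolding refl_word_def by (auto simp: in_lists_conv_set)

lemma reflections_iff: "t \<in> cox_reflections S m \<longleftrightarrow> (\<exists>q. refl_word q \<and> t = cl q)"
proof -
  have "cl p \<cdot> (gn s \<cdot> cox_inv S m (cl p)) = cl (p @ s # rev p)" if "p \<in> lists S" "s \<in> S" for p s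
    unfolding inv_cl gn_cl using that mul_cl[of "[s]" "rev p"] mul_cl[of p "s # rev p"] by (simp add: in_lists_conv_set)
  then have "t \<in> cox_reflections S m \<longleftrightarrow> (\<exists>p\<in>lists S. \<exists>s\<in>S. t = cl (p @ s # rev p))"
    unfolding cox_reflections_def cox_W_def Bex_def image_iff mem_Collect_eq by metis
  then show ?thesis unfolding refl_word_def by blast
qed

lemma refl_square: "refl_word q \<Longrightarrow> cl (q @ q) = cl []"
proof -
  assume "refl_word q"
  then obtain p s where q: "p \<in> lists S" "s \<in> S" "q = p @ s # rev p" unfolding refl_word_def by blast
  have "cl (q @ q) = cl ((p @ [s]) @ rev p @ p @ (s # rev p))" unfolding q by simp
  also have "\<dots> = cl ((p @ [s]) @ (s # rev p))" by (rule cl_rev_cancel') (use q in \<open>auto simp: in_lists_conv_set\<close>)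
  also have "\<dots> = cl ([] @ p @ rev p @ [])" using cl_del[of p "rev p" s] q by (simp add: in_lists_conv_set)
  also have "\<dots> = cl []" using cl_rev_cancel[of p "[]" "[]"] q by simp
  finally show ?thesis .
qed

text \<open>The outer halves \<open>p\<close> and \<open>rev p\<close> contribute an even number,
  since \<open>p @ rev p\<close> represents the identity, whose list may be taken empty; the middle
  letter contributes one.\<close>

lemma cnt_self:
  assumes "refl_word q"
  shows "odd (count_list (nl q) (cl q))"
proof -
  obtain p s where q: "p \<in> lists S" "s \<in> S" "q = p @ s # rev p" using assms unfolding refl_word_def by blast
  have l: "rev p \<in> lists S" "q \<in> lists S" using q by (auto simp: in_lists_conv_set)
  have e: "cl (rev p @ q @ rev (rev p)) = cl [s]"
  proof -
    have "cl (rev p @ q @ rev (rev p)) = cl ([] @ rev p @ p @ ([s] @ rev p @ p))" unfolding q by simp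
    also have "\<dots> = cl ([] @ ([s] @ rev p @ p))" by (rule cl_rev_cancel') (use q l in auto)
    also have "\<dots> = cl ([s] @ rev p @ p @ [])" by simp
    also have "\<dots> = cl ([s] @ [])" by (rule cl_rev_cancel') (use q l in auto)
    finally show ?thesis by simp
  qed
  have "cl ([s] @ (rev p @ q @ rev (rev p)) @ [s]) = cl ([s] @ [s] @ [s])"
    by (rule cl_append_cong[OF refl cl_append_cong[OF e refl]]) (use q l in auto)
  also have "\<dots> = cl [s]" using cl_del[of "[]" "[s]" s] q by simp
  finally have e2: "cl (s # rev p @ q @ p @ [s]) = cl [s]" by simp
  have "count_list (nl q) (cl q) = count_list (nl p) (cl [s]) + 1 + count_list (nl (rev p)) (cl q)"
    using cnt_append[of p "s # rev p" q] cnt_append[of "[s]" "rev p" q] q l e e2 by simp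
  moreover have "count_list (nl (p @ rev p)) (cl q) = count_list (nl p) (cl [s]) + count_list (nl (rev p)) (cl q)"
    using cnt_append[of p "rev p" q] q l e by simp
  moreover have "odd (count_list (nl (p @ rev p)) (cl q)) = odd (count_list (nl []) (cl q))"
    by (rule cnt_parity) (use cl_rev_cancel[of p "[]" "[]"] q l cl_eq_iff in auto)
  ultimately show ?thesis by simp
qed

lemma nl_delete:
  assumes "u \<in> lists S" "q \<in> lists S" "cl q \<in> set (nl u)"
  shows "\<exists>i<length u. cl (u @ q) = cl (take i u @ drop (Suc i) u)"
  using assms(1,3)
proof (induction u rule: list.induct)
  case (Cons s u)
  have s: "s \<in> S" "u \<in> lists S" "rev u \<in> lists S" using Cons.prems by (auto simp: in_lists_conv_set)
  show ?case
  proof (cases "cl q = cl (rev u @ s # u)")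
    case True
    have "cl ((s # u) @ q) = cl ((s # u) @ rev u @ s # u)"
      by (rule cl_append_cong[OF refl True]) (use s assms in auto)
    also have "\<dots> = cl ([s] @ u @ rev u @ (s # u))" by simp
    also have "\<dots> = cl ([s] @ (s # u))" by (rule cl_rev_cancel) (use s in auto)
    also have "\<dots> = cl u" using cl_del[of "[]" u s] s by simp
    finally show ?thesis by (intro exI[of _ 0]) simp
  next
    case False
    then obtain i where i: "i < length u" "cl (u @ q) = cl (take i u @ drop (Suc i) u)" using Cons s by auto
    have "cl (s # u @ q) = cl (s # take i u @ drop (Suc i) u)"
      by (rule cl_cons_cong[OF i(2)]) (use s assms in auto)
    then show ?thesis using i(1) by (intro exI[of _ "Suc i"]) simp
  qed
qed simp

lemma delete_lists: "u \<in> lists S \<Longrightarrow> take i u @ drop j u \<in> lists S"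
  by (auto simp: in_lists_conv_set dest: in_set_takeD in_set_dropD)

text \<open>If \<open>q\<close> occurred an even number of times for \<open>u\<close>, it would
  occur an odd number of times for \<open>u @ q\<close>. It would then delete a letter from a
  reduced word of \<open>u @ q\<close>, making \<open>u\<close> shorter than
  \<open>u @ q\<close>.\<close>

theorem strong_exchange:
  assumes u: "u \<in> lists S" and q: "refl_word q" and l: "len (cl (u @ q)) < len (cl u)"
  shows "\<exists>i<length u. cl (u @ q) = cl (take i u @ drop (Suc i) u)"
proof -
  have ql: "q \<in> lists S" using q refl_word_lists by blast
  have "odd (count_list (nl u) (cl q))"
  proof (rule ccontr)
    assume ev: "\<not> odd (count_list (nl u) (cl q))"
    have "cl (q @ q @ rev q) = cl q" using cl_rev_cancel[of q q "[]"] ql by simp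
    then have "odd (count_list (nl (u @ q)) (cl q))"
      using cnt_append[of u q q] cnt_self[OF q] ev u ql by simp
    moreover obtain v where v: "red v" "cl v = cl (u @ q)"
      using red_exists[of "cl (u @ q)"] cl_in_W u ql by auto
    ultimately have "odd (count_list (nl v) (cl q))"
      using cnt_parity[of v "u @ q" q] ql v cl_eq_iff by blast
    then have "cl q \<in> set (nl v)" using count_list_0_iff by (metis even_zero)
    then obtain i where i: "i < length v" "cl (v @ q) = cl (take i v @ drop (Suc i) v)"
      using nl_delete[of v q] v ql unfolding red_def by blast
    have "cl (v @ q) = cl ((u @ q) @ q)"
      by (rule cl_append_cong[OF v(2) refl]) (use v ql in \<open>auto simp: red_def\<close>)
    also have "\<dots> = cl (u @ (q @ q))" by simp
    also have "\<dots> = cl (u @ [])" by (rule cl_append_cong[OF refl refl_square[OF q]]) (use u ql in auto)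
    finally have "len (cl u) \<le> length (take i v @ drop (Suc i) v)" using i(2) len_le by (metis append_Nil2)
    then show False using i(1) v l unfolding red_def by simp
  qed
  then have "cl q \<in> set (nl u)" using count_list_0_iff by (metis even_zero)
  then show ?thesis using nl_delete u ql by blast
qed

text \<open>Left multiplication by \<open>s\<close> is right multiplication by the reflection
  \<open>rev u @ s # u\<close>.\<close>

lemma exchange_left:
  assumes u: "u \<in> lists S" and s: "s \<in> S" and l: "len (cl (s # u)) < len (cl u)"
  shows "\<exists>i<length u. cl (s # u) = cl (take i u @ drop (Suc i) u)"
proof -
  have ru: "rev u \<in> lists S" using u by (simp add: in_lists_conv_set)
  have r: "refl_word (rev u @ s # rev (rev u))" unfolding refl_word_def using u s ru by blast
  have "cl (u @ rev u @ s # rev (rev u)) = cl (s # u)"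
    using cl_rev_cancel[of u "[]" "s # u"] u s by simp
  then show ?thesis using strong_exchange[OF u r] l by simp
qed


section \<open>Lengths of alternating words, from the functionals at q = 1\<close>

abbreviation tm where "tm \<equiv> total_matrix S m"

lemma tm_eq: "s \<in> S \<Longrightarrow> t \<in> S \<Longrightarrow> tm s t = m s t"
  by (simp add: total_matrix_def)

text \<open>At \<open>v = 1\<close> the quadratic relation reads \<open>T_s T_s = 1\<close>, so all
  defining relations of the group hold, for arbitrary words.\<close>

lemma rho_equiv_q1:
  assumes F: "T.tl_fun (2::int) F" and uv: "(u, v) \<in> cox_equiv S m"
  shows "rho 1 u F = rho 1 v F"
proof -
  have step: "rho 1 u F = rho 1 v F" if "(u, v) \<in> cox_step S m" for u v
    using that
  proof (cases rule: cox_step.cases)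
    case (del a b s)
    have "rho 1 [s, s] (rho 1 b F) p = rho 1 b F p" for p
      using T.rho_quadratic[OF T.tl_fun_rho[OF F], where v = 1 and v' = 1 and s = s and p = p] by simp
    then have "rho 1 [s, s] (rho 1 b F) = rho 1 b F" by blast
    then show ?thesis unfolding del rho_append by (simp only:)
  next
    case (braid a b s t k)
    have "rho 1 (alt_word s t k) (rho 1 b F) = rho 1 (alt_word t s k) (rho 1 b F)"
      by (rule T.rho_braid[OF T.tl_fun_rho[OF F], where v' = 1]) (use braid tm_eq in auto)
    then show ?thesis unfolding braid rho_append by simp
  qed
  show ?thesis using uv
  proof (induction rule: equiv_induct)
    case (step y z)
    then show ?case using \<open>\<And>u v. (u, v) \<in> cox_step S m \<Longrightarrow> rho 1 u F = rho 1 v F\<close> by metis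
  qed simp
qed

text \<open>Below order \<open>m s t\<close> the commutation class of an alternating word is a
  singleton without redex, so its indicator function may be prescribed.\<close>

lemma alt_functional:
  assumes "s \<in> S" "t \<in> S" "s \<noteq> t" "enat j < m s t"
  obtains F where "T.tl_fun (\<delta>::'r::comm_ring_1) F" "\<And>p. length p < j \<Longrightarrow> F p = 0" "F (alt_word s t j) = 1"
    "0 < j \<Longrightarrow> F (alt_word t s j) = 0"
proof -
  let ?g = "\<lambda>u. if u = alt_word s t j then 1 else 0 :: 'r"
  have j: "enat j < tm s t" "enat j < tm t s" using assms tm_eq m_sym by auto
  have g: "?g u = ?g v" if "(u, v) \<in> (comm_step tm)\<^sup>*" for u v
    using T.alt_word_comm[OF _ assms(3) j(1)] that T.comm_eq_sym[OF that] by auto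
  obtain F where F: "\<And>n. T.good \<delta> n F" "\<And>u. \<not> T.has_redex u \<Longrightarrow> F u = ?g u" "\<And>u. length u < j \<Longrightarrow> F u = 0"
    by (rule T.nf_exists[of ?g j \<delta>, OF g]) auto
  show thesis
  proof
    show "T.tl_fun \<delta> F" unfolding T.tl_fun_def using F(1) by blast
    show "F (alt_word s t j) = 1" using F(2)[OF T.alt_word_no_redex[OF assms(3) j(1)]] by simp
    show "F (alt_word t s j) = 0" if "0 < j"
    proof -
      have "alt_word t s j \<noteq> alt_word s t j" using that assms(3) by (cases j) auto
      then show ?thesis using F(2)[OF T.alt_word_no_redex[OF assms(3)[symmetric] j(2)]] by simp
    qed
  qed (use F(3) in blast)
qed

text \<open>A shorter word for the same element would be killed by the functional that is 1 on the
  alternating word; the opposite alternating word is killed as well.\<close>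

lemma alt_word_distinct:
  assumes "s \<in> S" "t \<in> S" "s \<noteq> t" "enat j < m s t"
  shows "len (cl (alt_word s t j)) = j" and "0 < j \<Longrightarrow> cl (alt_word s t j) \<noteq> cl (alt_word t s j)"
proof -
  obtain F where F: "T.tl_fun (2::int) F" "\<And>p. length p < j \<Longrightarrow> F p = 0" "F (alt_word s t j) = 1"
    "0 < j \<Longrightarrow> F (alt_word t s j) = 0" by (rule alt_functional[OF assms]) blast
  have low: "rho 1 u F [] = F u" if "length u \<le> j" for u
    using T.rho_low[where F = F and v = 1 and N = j and p = "[]", OF F(2)] that by simp
  have 1: "rho 1 (alt_word s t j) F [] = 1" using low F(3) by simp
  obtain v where v: "cl v = cl (alt_word s t j)" "length v = len (cl (alt_word s t j))" using len_attained by blast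
  have "rho 1 v F = rho 1 (alt_word s t j) F" by (rule rho_equiv_q1[OF F(1)]) (use v cl_eq_iff in blast)
  then have "\<not> length v < j" using 1 low[of v] F(2)[of v] by auto
  moreover have "len (cl (alt_word s t j)) \<le> j" using len_le[of "alt_word s t j"] by simp
  ultimately show "len (cl (alt_word s t j)) = j" using v by simp
  show "cl (alt_word s t j) \<noteq> cl (alt_word t s j)" if "0 < j"
  proof
    assume "cl (alt_word s t j) = cl (alt_word t s j)"
    then have "rho 1 (alt_word s t j) F = rho 1 (alt_word t s j) F" using rho_equiv_q1[OF F(1)] cl_eq_iff by blast
    then show False using 1 low[of "alt_word t s j"] F(4)[OF that] by simp
  qed
qed

text \<open>At full length the word is itself a redex, and the Chebyshev relation computes its value
  from the words one letter shorter. The value -1 excludes lengths below \<open>n\<close>, and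
  parity excludes \<open>n\<close> itself.\<close>

lemma len_alt_word:
  assumes "s \<in> S" "t \<in> S" "s \<noteq> t" "enat j \<le> m s t"
  shows "len (cl (alt_word s t j)) = j"
proof (cases "enat j < m s t")
  case False
  then have k: "m s t = enat j" using assms(4) by simp
  have "2 \<le> j" using m_ge[OF assms(1-3)] k by (simp add: numeral_eq_enat)
  then obtain n where n: "j = Suc n" "1 \<le> n" by (cases j) auto
  have le: "len (cl (alt_word s t j)) \<le> j" using len_le[of "alt_word s t j"] by simp
  have par: "even (len (cl (alt_word s t j))) = even j" by (simp add: len_parity)
  show ?thesis
  proof (cases "n = 1")
    case True
    then have j2: "j = 2" using n by simp
    \<comment> \<open>Order 2 has no Chebyshev relation; a trivial product of \<open>s\<close> and
      \<open>t\<close> would identify the two generators.\<close>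
    have "len (cl (alt_word s t j)) \<noteq> 0"
    proof
      assume "len (cl (alt_word s t j)) = 0"
      then obtain v where "cl v = cl (alt_word s t j)" "v = []" using len_attained by (metis length_0_conv)
      then have "cl [s, t] = cl []" using j2 by (simp add: numeral_2_eq_2)
      then have "cl ([s, t] @ [t]) = cl ([] @ [t])" by (rule cl_append_cong[OF _ refl]) (use assms in auto)
      moreover have "cl ([s, t] @ [t]) = cl [s]" using cl_del[of "[s]" "[]" t] assms by simp
      ultimately have "cl (alt_word s t 1) = cl (alt_word t s 1)" by simp
      moreover have "enat 1 < m s t" using k j2 by simp
      ultimately show False using alt_word_distinct(2)[OF assms(1-3), of 1] by simp
    qed
    then show ?thesis using par le unfolding j2 by (auto simp: le_Suc_eq numeral_2_eq_2)
  next
    case False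
    then have j3: "3 \<le> j" using n by simp
    have nj: "enat n < m s t" using k n by simp
    obtain F where F: "T.tl_fun (2::int) F" "\<And>p. length p < n \<Longrightarrow> F p = 0" "F (alt_word s t n) = 1"
      "0 < n \<Longrightarrow> F (alt_word t s n) = 0" by (rule alt_functional[OF assms(1-3) nj]) blast
    have low: "rho 1 u F [] = F u" if "length u \<le> n" for u
      using T.rho_low[where F = F and v = 1 and N = n and p = "[]", OF F(2)] that by simp
    \<comment> \<open>Among the lower terms only the two words of length \<open>n\<close> survive,
      with values 1 and 0.\<close>
    have "0 = rho 1 (alt_word s t (Suc n)) F [] + F [] + (\<Sum>i=1..<Suc n. rho 1 (alt_word s t i) F [] + rho 1 (alt_word t s i) F [])"
      using T.chebop_rho[OF F(1), where v = 1 and v' = 1 and k = n and s = s and t = t and p = "[]"]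
        T.chebop_zero[OF F(1) assms(3), where v = 1 and p = "[]" and k = j] k tm_eq assms j3 n by simp
    also have "(\<Sum>i=1..<Suc n. rho 1 (alt_word s t i) F [] + rho 1 (alt_word t s i) F []) =
        (\<Sum>i=1..<n. rho 1 (alt_word s t i) F [] + rho 1 (alt_word t s i) F []) + 1"
      using n low F(3,4) by simp
    also have "(\<Sum>i=1..<n. rho 1 (alt_word s t i) F [] + rho 1 (alt_word t s i) F []) = 0"
      by (rule sum.neutral) (use low F(2) in auto)
    also have "F [] = 0" using F(2) n by simp
    finally have r: "rho 1 (alt_word s t j) F [] = -1" using n by simp
    obtain v where v: "cl v = cl (alt_word s t j)" "length v = len (cl (alt_word s t j))" using len_attained by blast
    have "rho 1 v F = rho 1 (alt_word s t j) F" by (rule rho_equiv_q1[OF F(1)]) (use v cl_eq_iff in blast)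
    then have "\<not> length v < n" using r low[of v] F(2)[of v] by auto
    then have "n \<le> len (cl (alt_word s t j))" using v by simp
    then show ?thesis using par le n by (metis even_Suc le_SucE le_antisym)
  qed
qed (use alt_word_distinct assms in blast)

subsection \<open>Matsumoto's theorem\<close>

definition braid_step :: "('a list \<times> 'a list) set" where
  "braid_step = {(a @ alt_word s t k @ b, a @ alt_word t s k @ b) | a b s t k.
     a \<in> lists S \<and> b \<in> lists S \<and> s \<in> S \<and> t \<in> S \<and> s \<noteq> t \<and> m s t = enat k}"

lemma braid_step_cl: "(u, v) \<in> braid_step \<Longrightarrow> cl u = cl v \<and> length u = length v \<and> v \<in> lists S"
proof -
  assume "(u, v) \<in> braid_step"
  then obtain a b s t k where 1: "u = a @ alt_word s t k @ b" "v = a @ alt_word t s k @ b" "a \<in> lists S" "b \<in> lists S"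
    "s \<in> S" "t \<in> S" "s \<noteq> t" "m s t = enat k"
    unfolding braid_step_def by blast
  then show ?thesis using cl_braid[of a b s t k] alt_word_lists[of t s k] by simp
qed

lemma braid_red: "(u, v) \<in> braid_step\<^sup>* \<Longrightarrow> red u \<Longrightarrow> red v \<and> cl v = cl u"
  by (induction rule: rtrancl_induct) (use braid_step_cl in \<open>auto simp: red_def\<close>)

lemma braid_step_cons: "(u, v) \<in> braid_step \<Longrightarrow> s \<in> S \<Longrightarrow> (s # u, s # v) \<in> braid_step"
proof -
  assume "(u, v) \<in> braid_step" "s \<in> S"
  then obtain a b x t k where 1: "u = a @ alt_word x t k @ b" "v = a @ alt_word t x k @ b" "a \<in> lists S" "b \<in> lists S"
    "x \<in> S" "t \<in> S" "x \<noteq> t" "m x t = enat k"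
    unfolding braid_step_def by blast
  then have "s # u = (s # a) @ alt_word x t k @ b" "s # v = (s # a) @ alt_word t x k @ b" "s # a \<in> lists S"
    using \<open>s \<in> S\<close> by auto
  then show ?thesis unfolding braid_step_def using 1(4-) by blast
qed

lemma braid_eq_cons: "(u, v) \<in> braid_step\<^sup>* \<Longrightarrow> s \<in> S \<Longrightarrow> (s # u, s # v) \<in> braid_step\<^sup>*"
  by (induction rule: rtrancl_induct) (use braid_step_cons in \<open>auto intro: rtrancl_into_rtrancl\<close>)

lemma red_append: "red (a @ b) \<Longrightarrow> red a \<and> red b"
proof -
  assume r: "red (a @ b)"
  then have l: "a \<in> lists S" "b \<in> lists S" by (auto simp: red_def)
  obtain a' where a': "cl a' = cl a" "length a' = len (cl a)" using len_attained by blast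
  obtain b' where b': "cl b' = cl b" "length b' = len (cl b)" using len_attained by blast
  have "cl (a @ b) = cl (a' @ b')" by (rule cl_append_cong) (use a' b' l in auto)
  then have "length a + length b \<le> length a' + length b'"
    using r len_le[of "a' @ b'"] by (simp add: red_def)
  moreover have "length a' \<le> length a" "length b' \<le> length b" using a' b' len_le by simp_all
  ultimately show ?thesis using a' b' l by (simp add: red_def)
qed

lemma cl_cons_cancel: "cl (s # u) = cl (s # v) \<Longrightarrow> u \<in> lists S \<Longrightarrow> v \<in> lists S \<Longrightarrow> s \<in> S \<Longrightarrow> cl u = cl v"
  using cl_cons_cong[of "s # u" "s # v" s] cl_del[of "[]" u s] cl_del[of "[]" v s] by simp

lemma cl_append_cancel:
  assumes "cl (u @ b) = cl (v @ b)" "u \<in> lists S" "v \<in> lists S" "b \<in> lists S"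
  shows "cl u = cl v"
proof -
  have "rev b \<in> lists S" using assms by (simp add: in_lists_conv_set)
  then have "cl ((u @ b) @ rev b) = cl ((v @ b) @ rev b)" by (intro cl_append_cong[OF assms(1) refl]) (use assms in auto)
  then show ?thesis using cl_rev_cancel[of b u "[]"] cl_rev_cancel[of b v "[]"] assms by simp
qed

text \<open>Multiplying the word that begins with \<open>t\<close> by \<open>s\<close> deletes a
  letter. A deletion inside the alternating prefix would shorten an alternating word beyond what
  \<open>len_alt_word\<close> permits, so it happens in \<open>b\<close>.\<close>

lemma alt_prefixes:
  assumes "red (s # p)" "cl (s # p) = w" "red (t # p')" "cl (t # p') = w" "s \<noteq> t" "enat j \<le> m s t"
  shows "(\<exists>b. red (alt_word s t j @ b) \<and> cl (alt_word s t j @ b) = w)"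
  using assms
proof (induction j arbitrary: s t p p')
  case 0
  then show ?case by (intro exI[of _ "s # p"]) simp
next
  case (Suc j)
  have st: "s \<in> S" "t \<in> S" "p \<in> lists S" using Suc.prems by (auto simp: red_def)
  have jm: "enat j \<le> m t s" using Suc.prems(6) st m_sym by (metis Suc_leD enat_ord_code(1) order_trans lessI less_imp_le)
  obtain b where b: "red (alt_word t s j @ b)" "cl (alt_word t s j @ b) = w"
    using Suc.IH[OF Suc.prems(3,4,1,2) _ jm] Suc.prems(5) by auto
  have bl: "alt_word t s j @ b \<in> lists S" "b \<in> lists S" using b by (auto simp: red_def)
  have "cl (s # alt_word t s j @ b) = cl (s # s # p)"
    by (rule cl_cons_cong) (use b Suc.prems(2) bl st in auto)
  also have "\<dots> = cl p" using cl_del[of "[]" p s] st by simp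
  finally have c: "cl (s # alt_word t s j @ b) = cl p" .
  have lw: "len w = Suc (length p)" using Suc.prems(1,2) by (auto simp: red_def)
  have "len (cl (s # alt_word t s j @ b)) < len (cl (alt_word t s j @ b))"
    using c b(2) lw len_le[of p] by simp
  then obtain i where i: "i < length (alt_word t s j @ b)"
    "cl (s # alt_word t s j @ b) = cl (take i (alt_word t s j @ b) @ drop (Suc i) (alt_word t s j @ b))"
    using exchange_left[OF bl(1) st(1)] by blast
  show ?case
  proof (cases "i < j")
    case True
    define x where "x = take i (alt_word t s j) @ drop (Suc i) (alt_word t s j)"
    have x: "x \<in> lists S" "length x = j - 1" unfolding x_def using delete_lists[OF alt_word_lists] st True by auto
    have "cl (alt_word s t (Suc j) @ b) = cl (x @ b)" using i True by (simp add: x_def)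
    then have "cl (alt_word s t (Suc j)) = cl x"
      by (rule cl_append_cancel) (use x bl alt_word_lists st in auto)
    then have "Suc j \<le> length x" using len_alt_word[OF st(1,2) Suc.prems(5,6)] len_le[of x] by simp
    then show ?thesis using x by simp
  next
    case False
    define b' where "b' = take (i - j) b @ drop (Suc i - j) b"
    have b': "b' \<in> lists S" "Suc (length b') = length b"
      unfolding b'_def using delete_lists[OF bl(2)] i(1) False by auto
    have e: "cl (s # alt_word t s j @ b) = cl (alt_word t s j @ b')"
      using i False by (simp add: b'_def)
    have "cl (alt_word t s j @ b) = cl (s # s # alt_word t s j @ b)"
      using cl_del[of "[]" "alt_word t s j @ b" s] st bl by simp
    also have "\<dots> = cl (s # alt_word t s j @ b')" by (rule cl_cons_cong[OF e]) (use st bl in auto)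
    finally have "cl (alt_word s t (Suc j) @ b') = w" using b(2) by simp
    moreover have "length (alt_word s t (Suc j) @ b') = len w" using b b' by (simp add: red_def)
    moreover have "alt_word s t (Suc j) @ b' \<in> lists S" using alt_word_lists[OF st(1,2), of "Suc j"] b' by auto
    ultimately show ?thesis unfolding red_def by blast
  qed
qed

text \<open>Words with different first letters are joined through one that begins with the full
  alternating word. Infinite order is impossible, as it would give an alternating prefix longer than
  the word.\<close>

theorem matsumoto:
  assumes "red u" "red v" "cl u = cl v"
  shows "(u, v) \<in> braid_step\<^sup>*"
  using assms
proof (induction "length u" arbitrary: u v rule: less_induct)
  case less
  have luv: "length u = length v" using less.prems by (simp add: red_def)
  show ?case
  proof (cases u)
    case Nil
    then show ?thesis using luv by simp
  next
    case (Cons s p)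
    then obtain t p' where v: "v = t # p'" using luv by (cases v) auto
    note ru = less.prems(1)[unfolded Cons] and rv = less.prems(2)[unfolded v]
    have l: "s \<in> S" "t \<in> S" "p \<in> lists S" "p' \<in> lists S" using ru rv by (auto simp: red_def)
    have same: "(x # c, x # d) \<in> braid_step\<^sup>*"
      if "red (x # c)" "red (x # d)" "cl (x # c) = cl (x # d)" "length (x # c) = length u" for x c d
    proof -
      have "x \<in> S" "c \<in> lists S" "d \<in> lists S" using that by (auto simp: red_def)
      moreover have "red c" "red d" using red_append[of "[x]" c] red_append[of "[x]" d] that by simp_all
      moreover have "length c < length u" using that(4) by simp
      moreover have "cl c = cl d" by (rule cl_cons_cancel[OF that(3)]) fact+
      ultimately have "(c, d) \<in> braid_step\<^sup>*" using less.hyps by metis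
      then show ?thesis using braid_eq_cons \<open>x \<in> S\<close> by blast
    qed
    show ?thesis
    proof (cases "s = t")
      case True
      then show ?thesis using same less.prems Cons v by blast
    next
      case False
      have cuv: "cl (t # p') = cl (s # p)" using less.prems Cons v by simp
      have "m s t \<noteq> \<infinity>"
      proof
        assume "m s t = \<infinity>"
        then obtain b where "red (alt_word s t (Suc (length u)) @ b)" "cl (alt_word s t (Suc (length u)) @ b) = cl (s # p)"
          using alt_prefixes[OF ru refl rv cuv False, of "Suc (length u)"] by auto
        then show False using less.prems(1) Cons by (simp add: red_def)
      qed
      then obtain k where k: "m s t = enat k" by blast
      obtain b where b: "red (alt_word s t k @ b)" "cl (alt_word s t k @ b) = cl (s # p)"
        using alt_prefixes[OF ru refl rv cuv False, of k] k by auto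
      have "2 \<le> k" using m_ge[OF l(1,2) False] k by (simp add: numeral_eq_enat)
      then obtain n where n: "k = Suc n" by (cases k) auto
      have bl: "b \<in> lists S" using b by (auto simp: red_def)
      have st: "(alt_word s t k @ b, alt_word t s k @ b) \<in> braid_step"
        unfolding braid_step_def mem_Collect_eq
        by (intro exI[of _ "[]"] exI[of _ b] exI[of _ s] exI[of _ t] exI[of _ k]) (use l False k bl in simp)
      then have b2: "red (alt_word t s k @ b)" "cl (alt_word t s k @ b) = cl (s # p)"
        using braid_red b by (auto simp: r_into_rtrancl)
      have len: "length (alt_word s t k @ b) = length u" using b less.prems(1) Cons by (simp add: red_def)
      have "(s # p, alt_word s t k @ b) \<in> braid_step\<^sup>*"
        using same[of s p "alt_word t s n @ b"] ru b Cons n by simp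
      moreover have "(alt_word t s k @ b, t # p') \<in> braid_step\<^sup>*"
        using same[of t "alt_word s t n @ b" p'] rv b2 cuv len n v luv by simp
      ultimately show ?thesis unfolding Cons v using st by (meson rtrancl.rtrancl_into_rtrancl rtrancl_trans)
    qed
  qed
qed

text \<open>For general \<open>v\<close> the operators are not involutions, so only braid moves
  preserve \<open>rho\<close>; reduced words are connected by these.\<close>

lemma rho_red:
  assumes F: "T.tl_fun \<delta> F" and v: "v * v' = 1" and \<delta>: "\<delta> = v + v'" and "red u" "red u'" "cl u = cl u'"
  shows "rho v u F = rho v u' F"
  using matsumoto[OF assms(4-6)]
proof induction
  case (step y z)
  obtain a b s t k where 1: "y = a @ alt_word s t k @ b" "z = a @ alt_word t s k @ b" "s \<in> S" "t \<in> S" "s \<noteq> t" "m s t = enat k"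
    using step(2) unfolding braid_step_def by blast
  have "rho v (alt_word s t k) (rho v b F) = rho v (alt_word t s k) (rho v b F)"
    by (rule T.rho_braid[OF T.tl_fun_rho[OF F] v \<delta> 1(5)]) (use 1 tm_eq in simp)
  then show ?case using step(3) 1 by (simp add: rho_append)
qed simp


section \<open>Multiplication by generators and descents\<close>

abbreviation lm where "lm s y \<equiv> cox_mult S m (cox_gen S m s) y"
abbreviation rm where "rm y s \<equiv> cox_mult S m y (cox_gen S m s)"

lemma lm_cl: "u \<in> lists S \<Longrightarrow> s \<in> S \<Longrightarrow> lm s (cl u) = cl (s # u)"
  by (simp add: gn_cl mul_cl)

lemma rm_cl: "u \<in> lists S \<Longrightarrow> s \<in> S \<Longrightarrow> rm (cl u) s = cl (u @ [s])"
  by (simp add: gn_cl mul_cl)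

lemma lm_W [simp]: "y \<in> W \<Longrightarrow> s \<in> S \<Longrightarrow> lm s y \<in> W"
  by (elim W_cases) (simp add: lm_cl cl_in_W)

lemma rm_W [simp]: "y \<in> W \<Longrightarrow> s \<in> S \<Longrightarrow> rm y s \<in> W"
  by (elim W_cases) (simp add: rm_cl cl_in_W)

lemma lm_lm [simp]: "y \<in> W \<Longrightarrow> s \<in> S \<Longrightarrow> lm s (lm s y) = y"
  by (elim W_cases) (use cl_del[of "[]" _ s] in \<open>simp add: lm_cl\<close>)

lemma rm_rm [simp]: "y \<in> W \<Longrightarrow> s \<in> S \<Longrightarrow> rm (rm y s) s = y"
  by (elim W_cases) (use cl_del[of _ "[]" s] in \<open>simp add: rm_cl\<close>)

lemma lm_rm: "y \<in> W \<Longrightarrow> s \<in> S \<Longrightarrow> t \<in> S \<Longrightarrow> lm s (rm y t) = rm (lm s y) t"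
  by (elim W_cases) (simp add: lm_cl rm_cl)

lemma len_lm: "y \<in> W \<Longrightarrow> s \<in> S \<Longrightarrow> len (lm s y) = Suc (len y) \<or> len y = Suc (len (lm s y))"
  by (elim W_cases) (use len_cons in \<open>simp add: lm_cl\<close>)

lemma len_rm: "y \<in> W \<Longrightarrow> s \<in> S \<Longrightarrow> len (rm y s) = Suc (len y) \<or> len y = Suc (len (rm y s))"
  by (elim W_cases) (use len_snoc in \<open>simp add: rm_cl\<close>)

lemma one_cl: "cox_one S m = cl []"
  by (simp add: cox_one_def)

lemma one_W [simp]: "cl [] \<in> W"
  by (simp add: cl_in_W)

lemma len_one [simp]: "len (cl []) = 0"
  using len_le[of "[]"] by simp

text \<open>Exchange in the reduced word \<open>u @ [t]\<close>: deleting a letter of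
  \<open>u\<close> would make \<open>s\<close> a descent of \<open>y\<close>, so the deleted letter
  is the final \<open>t\<close>.\<close>

lemma descent_core:
  assumes y: "y \<in> W" "s \<in> S" "t \<in> S" and up: "len y < len (lm s y)" "len y < len (rm y t)"
    and down: "len (lm s (rm y t)) < len (rm y t)"
  shows "lm s y = rm y t"
proof -
  obtain u where u: "red u" "cl u = y" by (rule red_exists[OF y(1)])
  have ul: "u \<in> lists S" using u by (simp add: red_def)
  have e: "rm y t = cl (u @ [t])" "lm s (rm y t) = cl (s # u @ [t])" "lm s y = cl (s # u)"
    unfolding u(2)[symmetric] using ul y by (simp_all add: rm_cl lm_cl)
  have ut: "u @ [t] \<in> lists S" using ul y by simp
  obtain i where i: "i < length (u @ [t])" "cl (s # u @ [t]) = cl (take i (u @ [t]) @ drop (Suc i) (u @ [t]))"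
    using exchange_left[OF ut y(2)] down e by auto
  show ?thesis
  proof (cases "i = length u")
    case True
    then have "lm s (rm y t) = y" using i(2) e u by simp
    then show ?thesis using lm_lm[of "rm y t" s] y by simp
  next
    case False
    define x where "x = take i u @ drop (Suc i) u"
    have x: "x \<in> lists S" "length x < length u" unfolding x_def using delete_lists[OF ul] i(1) False by auto
    have "cl ((s # u) @ [t]) = cl (x @ [t])" using i False by (simp add: x_def)
    then have "cl (s # u) = cl x" by (rule cl_append_cancel) (use ul x y in auto)
    then have "len (lm s y) < len y" using len_le[of x] x u e by (simp add: red_def)
    then show ?thesis using up by simp
  qed
qed

text \<open>This is what makes left and right multiplication commute in the Hecke algebra. If
  \<open>t\<close> lowers the length of \<open>y\<close>, the ascending case is applied to
  \<open>rm y t\<close>.\<close>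

lemma descent_iff:
  assumes y: "y \<in> W" "s \<in> S" "t \<in> S" and ne: "lm s y \<noteq> rm y t"
  shows "len (lm s (rm y t)) < len (rm y t) \<longleftrightarrow> len (lm s y) < len y"
proof -
  have up: "len (lm s (rm z t)) < len (rm z t) \<longleftrightarrow> len (lm s z) < len z"
    if z: "z \<in> W" "lm s z \<noteq> rm z t" "len z < len (rm z t)" for z
  proof (cases "len z < len (lm s z)")
    case True
    then show ?thesis using descent_core[OF z(1) y(2,3) True z(3)] z by auto
  next
    case False
    then have "len z = Suc (len (lm s z))" using len_lm z y by fastforce
    then show ?thesis using len_rm[of "lm s z" t] lm_rm[of z s t] z y by auto
  qed
  show ?thesis
  proof (cases "len y < len (rm y t)")
    case False
    have "lm s (rm y t) \<noteq> rm (rm y t) t"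
    proof
      assume "lm s (rm y t) = rm (rm y t) t"
      then have "lm s (rm y t) = y" using y by simp
      then have "lm s (lm s (rm y t)) = lm s y" by simp
      then show False using ne y by simp
    qed
    then show ?thesis using up[of "rm y t"] False len_rm[OF y(1,3)] y by auto
  qed (use up y ne in blast)
qed

subsection \<open>Bruhat order\<close>

definition bedge :: "'a list set \<Rightarrow> 'a list set \<Rightarrow> bool" where
  "bedge y z \<longleftrightarrow> (\<exists>t\<in>cox_reflections S m. z = y \<cdot> t \<and> len y < len z)"

abbreviation ble where "ble \<equiv> bruhat_le S m"

lemma ble_def': "ble x w \<longleftrightarrow> x \<in> W \<and> w \<in> W \<and> bedge\<^sup>*\<^sup>* x w"
  unfolding bruhat_le_def bedge_def by simp

lemma bedge_cl:
  assumes "u \<in> lists S"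
  shows "bedge (cl u) z \<longleftrightarrow> (\<exists>q. refl_word q \<and> z = cl (u @ q) \<and> len (cl u) < len z)"
  unfolding bedge_def Bex_def reflections_iff using mul_cl[OF assms] refl_word_lists by metis

lemma bedge_W: "y \<in> W \<Longrightarrow> bedge y z \<Longrightarrow> z \<in> W"
proof -
  assume "y \<in> W" and e: "bedge y z"
  then obtain u where u: "u \<in> lists S" "y = cl u" by (elim W_cases)
  then obtain q where "refl_word q" "z = cl (u @ q)" using e bedge_cl by auto
  then show "z \<in> W" using u refl_word_lists cl_in_W by simp
qed

lemma ble_refl [simp]: "x \<in> W \<Longrightarrow> ble x x"
  by (simp add: ble_def')

lemma ble_trans: "ble x y \<Longrightarrow> ble y z \<Longrightarrow> ble x z"
  unfolding ble_def' by auto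

lemma ble_W: "ble x w \<Longrightarrow> x \<in> W \<and> w \<in> W"
  by (simp add: ble_def')

lemma bedge_ble: "y \<in> W \<Longrightarrow> bedge y z \<Longrightarrow> ble y z"
  unfolding ble_def' using bedge_W by blast

lemma refl_word_odd: "refl_word q \<Longrightarrow> odd (length q)"
  unfolding refl_word_def by auto

lemma bedge_parity: "u \<in> lists S \<Longrightarrow> refl_word q \<Longrightarrow> len (cl (u @ q)) \<noteq> len (cl u)"
  using refl_word_odd len_parity by (metis even_add length_append)

lemma ble_induct [consumes 1, case_names refl step]:
  assumes "ble y z" "P z" "\<And>y y'. y \<in> W \<Longrightarrow> y' \<in> W \<Longrightarrow> bedge y y' \<Longrightarrow> ble y' z \<Longrightarrow> P y' \<Longrightarrow> P y"
  shows "P y"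
proof -
  have "bedge\<^sup>*\<^sup>* y z" "y \<in> W" "z \<in> W" using assms(1) by (auto simp: ble_def')
  then show ?thesis
  proof (induction rule: converse_rtranclp_induct)
    case (step y y')
    then show ?case using bedge_W assms(3)[of y y'] by (auto simp: ble_def')
  qed (rule assms(2))
qed

lemma ble_len: "ble x w \<Longrightarrow> len x < len w \<or> x = w"
  by (induction rule: ble_induct) (auto simp: bedge_def)

text \<open>If \<open>s\<close> reversed the edge, strong exchange in \<open>s # u\<close> would
  delete either the leading \<open>s\<close>, so that \<open>s y = z\<close>, or a letter of
  \<open>u\<close>, so that \<open>z\<close> is shorter than \<open>y\<close>.\<close>

lemma bedge_left:
  assumes y: "y \<in> W" "s \<in> S" and e: "bedge y z" and ne: "lm s y \<noteq> z"
  shows "bedge (lm s y) (lm s z)"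
proof -
  obtain u where u: "red u" "cl u = y" by (rule red_exists[OF y(1)])
  have ul: "u \<in> lists S" using u by (simp add: red_def)
  obtain q where q: "refl_word q" "z = cl (u @ q)" "len y < len z" using e bedge_cl[OF ul] u by auto
  have ql: "q \<in> lists S" using refl_word_lists q by blast
  have sz: "lm s z = cl ((s # u) @ q)" "lm s y = cl (s # u)" unfolding q(2) u(2)[symmetric] using ql ul y by (simp_all add: lm_cl)
  have su: "s # u \<in> lists S" using ul y by simp
  have "\<not> len (lm s z) < len (lm s y)"
  proof
    assume "len (lm s z) < len (lm s y)"
    then obtain i where i: "i < length (s # u)" "cl ((s # u) @ q) = cl (take i (s # u) @ drop (Suc i) (s # u))"
      using strong_exchange[OF su q(1)] sz by auto
    show False
    proof (cases i)
      case 0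
      then have "lm s z = y" using i sz u by simp
      then have "lm s (lm s z) = lm s y" by simp
      moreover have "z \<in> W" using q ul ql by (auto intro!: cl_in_W)
      ultimately show False using ne y by simp
    next
      case (Suc j)
      define x where "x = take j u @ drop (Suc j) u"
      have x: "x \<in> lists S" "length x < length u" unfolding x_def using delete_lists[OF ul] i(1) Suc by auto
      have "cl (s # u @ q) = cl (s # x)" using i Suc by (simp add: x_def)
      then have "cl (u @ q) = cl x" by (rule cl_cons_cancel) (use ul ql x y in auto)
      then show False using q(2,3) len_le[of x] x u by (simp add: red_def)
    qed
  qed
  moreover have "len (lm s z) \<noteq> len (lm s y)" unfolding sz by (rule bedge_parity[OF su q(1)])
  ultimately show ?thesis unfolding sz(2) bedge_cl[OF su] using q(1) sz by auto
qed

text \<open>The same argument on the right, with the reflection conjugated by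
  \<open>s\<close>.\<close>

lemma bedge_right:
  assumes y: "y \<in> W" "s \<in> S" and e: "bedge y z" and ne: "rm y s \<noteq> z"
  shows "bedge (rm y s) (rm z s)"
proof -
  obtain u where u: "red u" "cl u = y" by (rule red_exists[OF y(1)])
  have ul: "u \<in> lists S" using u by (simp add: red_def)
  obtain q where q: "refl_word q" "z = cl (u @ q)" "len y < len z" using e bedge_cl[OF ul] u by auto
  have ql: "q \<in> lists S" using refl_word_lists q by blast
  have q': "refl_word (s # q @ [s])"
  proof -
    obtain p t where p: "q = p @ t # rev p" "p \<in> lists S" "t \<in> S" using q(1) unfolding refl_word_def by blast
    have "s # q @ [s] = (s # p) @ t # rev (s # p)" "s # p \<in> lists S" using p y by auto
    then show ?thesis unfolding refl_word_def using p(3) by blast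
  qed
  have "cl ((u @ [s]) @ s # q @ [s]) = cl (u @ q @ [s])" using cl_del[of u "q @ [s]" s] ul ql y by simp
  then have sz: "rm z s = cl ((u @ [s]) @ s # q @ [s])" "rm z s = cl ((u @ q) @ [s])" "rm y s = cl (u @ [s])"
    unfolding q(2) u(2)[symmetric] using ql ul y by (simp_all add: rm_cl)
  have su: "u @ [s] \<in> lists S" using ul y by simp
  have "\<not> len (rm z s) < len (rm y s)"
  proof
    assume "len (rm z s) < len (rm y s)"
    then obtain i where i: "i < length (u @ [s])" "rm z s = cl (take i (u @ [s]) @ drop (Suc i) (u @ [s]))"
      using strong_exchange[OF su q'] sz by auto
    show False
    proof (cases "i = length u")
      case True
      then have "rm z s = y" using i u by simp
      then have "rm (rm z s) s = rm y s" by simp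
      moreover have "z \<in> W" using q ul ql by (auto intro!: cl_in_W)
      ultimately show False using ne y by simp
    next
      case False
      define x where "x = take i u @ drop (Suc i) u"
      have x: "x \<in> lists S" "length x < length u" unfolding x_def using delete_lists[OF ul] i(1) False by auto
      have "cl ((u @ q) @ [s]) = cl (x @ [s])" using i False sz by (simp add: x_def)
      then have "cl (u @ q) = cl x" by (rule cl_append_cancel) (use ul ql x y in auto)
      then show False using q(2,3) len_le[of x] x u by (simp add: red_def)
    qed
  qed
  moreover have "len (rm z s) \<noteq> len (rm y s)" unfolding sz(1,3) by (rule bedge_parity[OF su q'])
  ultimately show ?thesis unfolding sz(3) bedge_cl[OF su] using q' sz by auto
qed

text \<open>Multiply a Bruhat chain from \<open>y\<close> to \<open>z\<close> by \<open>s\<close>.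
  Either all edges survive and the chain ends at \<open>s z\<close>, or some edge joins an element
  to its product with \<open>s\<close>, and the old chain is followed from there.\<close>

lemma ble_lm_cases:
  assumes "ble y z" "s \<in> S"
  shows "ble (lm s y) z \<or> ble (lm s y) (lm s z)"
proof -
  have zW: "z \<in> W" using ble_W assms by blast
  show ?thesis using assms
proof (induction rule: ble_induct)
  case refl
  then show ?case using zW by simp
next
  case (step y y')
  show ?case
  proof (cases "lm s y = y'")
    case False
    then have "ble (lm s y) (lm s y')" using bedge_left bedge_ble step by simp
    then show ?thesis using step ble_trans by blast
  qed (use step in simp)
qed
qed

lemma ble_lm_cases':
  assumes "ble y z" "s \<in> S"
  shows "ble y (lm s z) \<or> ble (lm s y) (lm s z)"
proof -
  have zW: "z \<in> W" using ble_W assms by blast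
  show ?thesis using assms
proof (induction rule: ble_induct)
  case refl
  then show ?case using zW by simp
next
  case (step y y')
  have yy: "ble y y'" using bedge_ble step by simp
  show ?case
  proof (cases "lm s y = y'")
    case True
    then have "lm s y' = y" using step by auto
    then show ?thesis using step True by auto
  next
    case False
    then have "ble (lm s y) (lm s y')" using bedge_left bedge_ble step by simp
    then show ?thesis using step yy ble_trans by blast
  qed
qed
qed

lemma ble_rm_cases:
  assumes "ble y z" "s \<in> S"
  shows "ble (rm y s) z \<or> ble (rm y s) (rm z s)"
proof -
  have zW: "z \<in> W" using ble_W assms by blast
  show ?thesis using assms
proof (induction rule: ble_induct)
  case refl
  then show ?case using zW by simp
next
  case (step y y')
  show ?case
  proof (cases "rm y s = y'")
    case False
    then have "ble (rm y s) (rm y' s)" using bedge_right bedge_ble step by simp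
    then show ?thesis using step ble_trans by blast
  qed (use step in simp)
qed
qed

lemma bedge_lm:
  assumes "y \<in> W" "s \<in> S" "len y < len (lm s y)"
  shows "ble y (lm s y)"
proof -
  obtain u where u: "u \<in> lists S" "y = cl u" by (rule W_cases[OF assms(1)])
  have ru: "rev u \<in> lists S" using u by (simp add: in_lists_conv_set)
  have "refl_word (rev u @ s # rev (rev u))" unfolding refl_word_def using assms ru by blast
  moreover have "lm s y = cl (u @ rev u @ s # rev (rev u))"
    using cl_rev_cancel[of u "[]" "s # u"] u assms by (simp add: lm_cl)
  ultimately have "bedge y (lm s y)" using assms(3) bedge_cl[OF u(1)] u by blast
  then show ?thesis using bedge_ble assms by blast
qed

lemma bedge_rm:
  assumes "y \<in> W" "s \<in> S" "len y < len (rm y s)"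
  shows "ble y (rm y s)"
proof -
  obtain u where u: "u \<in> lists S" "y = cl u" by (rule W_cases[OF assms(1)])
  have "refl_word ([] @ s # rev [])" unfolding refl_word_def using assms by blast
  then have "refl_word [s]" by simp
  moreover have "rm y s = cl (u @ [s])" using u assms by (simp add: rm_cl)
  ultimately have "bedge y (rm y s)" using assms(3) bedge_cl[OF u(1)] u by blast
  then show ?thesis using bedge_ble assms by blast
qed

lemma lm_lt_ble: "y \<in> W \<Longrightarrow> s \<in> S \<Longrightarrow> len (lm s y) < len y \<Longrightarrow> ble (lm s y) y"
  using bedge_lm[of "lm s y" s] by simp

lemma ble_lift_up: "ble x w \<Longrightarrow> s \<in> S \<Longrightarrow> len (lm s w) < len w \<Longrightarrow> ble (lm s x) w"
  using ble_lm_cases[of x w s] lm_lt_ble[of w s] ble_trans ble_W by blast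

text \<open>Used to pass from \<open>sx \<le> sz\<close> to \<open>x \<le> z\<close> in the
  recursion.\<close>

lemma ble_lift_down:
  assumes "ble x w" "s \<in> S" "len (lm s x) < len x"
  shows "ble (lm s x) (lm s w)"
  using ble_lm_cases'[OF assms(1,2)] lm_lt_ble[of x s] ble_trans ble_W assms by blast

text \<open>Choose a left descent \<open>s\<close> of \<open>w\<close>: every element below
  \<open>w\<close> is \<open>y\<close> or \<open>s y\<close> for some \<open>y\<close> below the
  shorter \<open>s w\<close>.\<close>

lemma finite_ble: "w \<in> W \<Longrightarrow> finite {x. ble x w}"
proof (induction "len w" arbitrary: w)
  case 0
  then have "{x. ble x w} \<subseteq> {w}" using ble_len by force
  then show ?case by (rule finite_subset) simp
next
  case (Suc n)
  obtain u where u: "red u" "cl u = w" by (rule red_exists[OF Suc.prems])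
  then obtain s p where sp: "u = s # p" using Suc(2) by (cases u) (auto simp: red_def)
  have l: "s \<in> S" "p \<in> lists S" using u sp by (auto simp: red_def)
  have "lm s w = cl p" using u sp l lm_cl[of p s] lm_lm[of "cl p" s] by (simp add: cl_in_W)
  moreover have "len (cl p) = n" using red_append[of "[s]" p] u sp Suc(2) by (simp add: red_def)
  ultimately have f: "finite {x. ble x (lm s w)}" using Suc(1)[of "cl p"] l cl_in_W by simp
  have "{x. ble x w} \<subseteq> {x. ble x (lm s w)} \<union> lm s ` {x. ble x (lm s w)}"
  proof
    fix x assume "x \<in> {x. ble x w}"
    then have x: "ble x w" "x \<in> W" using ble_W by auto
    have "x = lm s (lm s x)" using x l by simp
    then show "x \<in> {x. ble x (lm s w)} \<union> lm s ` {x. ble x (lm s w)}"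
      using ble_lm_cases'[OF x(1) l(1)] by auto
  qed
  then show ?case by (rule finite_subset) (use f in simp)
qed

subsection \<open>Fully commutative elements\<close>

abbreviation Wc where "Wc \<equiv> cox_Wc S m"

lemma Wc_iff: "w \<in> Wc \<longleftrightarrow> w \<in> W \<and> (\<forall>u u'. red u \<longrightarrow> cl u = w \<longrightarrow> red u' \<longrightarrow> cl u' = w \<longrightarrow> (u, u') \<in> (comm_step m)\<^sup>*)"
proof (cases "w \<in> W")
  case True
  then show ?thesis unfolding cox_Wc_def Ball_def mem_Collect_eq red_words_iff[OF True] by blast
qed (simp add: cox_Wc_def)

lemma Wc_W: "w \<in> Wc \<Longrightarrow> w \<in> W"
  by (simp add: Wc_iff)

lemma comm_step_total:
  assumes "(u, v) \<in> comm_step m" "u \<in> lists S"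
  shows "(u, v) \<in> comm_step tm"
proof -
  obtain a b s t where 1: "u = a @ [s, t] @ b" "v = a @ [t, s] @ b" "m s t = enat 2"
    using assms(1) unfolding comm_step_def by blast
  then have "tm s t = enat 2" using assms(2) by (simp add: total_matrix_def)
  then show ?thesis using 1 unfolding comm_step_def by blast
qed

lemma comm_step_equiv:
  assumes "(u, v) \<in> comm_step tm" "u \<in> lists S"
  shows "(u, v) \<in> cox_step S m"
proof -
  obtain a b s t where 1: "u = a @ [s, t] @ b" "v = a @ [t, s] @ b" "tm s t = enat 2"
    using assms(1) unfolding comm_step_def by blast
  have st: "s \<in> S" "t \<in> S" "m s t = enat 2" using 1 by (auto simp: total_matrix_def one_enat_def split: if_splits)
  have "m s s = 1" using graph st by (simp add: coxeter_graph_def)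
  then have "s \<noteq> t" using st by (auto simp: one_enat_def)
  then show ?thesis using cox_step.braid[of a S b s t m 2] 1 assms(2) st by (simp add: numeral_2_eq_2)
qed

lemma comm_eq_total:
  assumes "(u, v) \<in> (comm_step m)\<^sup>*" "u \<in> lists S"
  shows "(u, v) \<in> (comm_step tm)\<^sup>* \<and> v \<in> lists S"
  using assms
proof (induction rule: rtrancl_induct)
  case (step y z)
  then have "(y, z) \<in> comm_step tm" "y \<in> lists S" using comm_step_total by blast+
  moreover have "z \<in> lists S" using comm_step_equiv calculation step_lists by blast
  ultimately show ?case using step by (meson rtrancl.rtrancl_into_rtrancl)
qed simp

lemma comm_eq_cl:
  assumes "(u, v) \<in> (comm_step tm)\<^sup>*" "u \<in> lists S"
  shows "cl u = cl v \<and> v \<in> lists S"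
  using assms
proof (induction rule: rtrancl_induct)
  case (step y z)
  then have "(y, z) \<in> cox_step S m" using comm_step_equiv by blast
  then show ?case using step step_lists cl_eq_iff unfolding cox_equiv_def by (metis UnI1 r_into_rtrancl rtrancl_trans)
qed simp

text \<open>A square would shorten the word. A long braid could be replaced by its other side,
  reachable by commutations since the element is fully commutative; but commutations preserve the
  order of the dependent letters \<open>s\<close> and \<open>t\<close>.\<close>

lemma Wc_no_redex:
  assumes u: "red u" "cl u \<in> Wc"
  shows "\<not> T.has_redex u"
proof
  assume "T.has_redex u"
  then obtain a s t k b where r: "redex tm s t k" and c: "(u, a @ alt_word s t k @ b) \<in> (comm_step tm)\<^sup>*"
    unfolding T.has_redex_def by blast
  let ?v = "a @ alt_word s t k @ b"
  have ul: "u \<in> lists S" using u by (simp add: red_def)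
  have v: "cl ?v = cl u" "?v \<in> lists S" using comm_eq_cl[OF c ul] by auto
  have lv: "length ?v = len (cl u)" using T.comm_eq_length[OF c] u by (simp add: red_def)
  have rv: "red ?v" using v lv by (simp only: red_def)
  have k2: "2 \<le> k" using T.redex_ge(1)[OF r] .
  have "{s, t} \<subseteq> set (alt_word s t k)"
    using k2 nth_mem[of 0 "alt_word s t k"] nth_mem[of 1 "alt_word s t k"] by (simp add: nth_alt_word)
  then have st: "s \<in> S" "t \<in> S" and ab: "a \<in> lists S" "b \<in> lists S" using v(2) by (auto simp: in_lists_conv_set)
  show False
  proof (cases "s = t")
    case True
    then have "k = 2" using r by (simp add: redex_def)
    then have "cl (a @ b) = cl u" using v(1) cl_del[OF ab st(1)] True by (simp add: numeral_2_eq_2)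
    then show False using len_le[of "a @ b"] lv k2 by simp
  next
    case False
    then have k: "m s t = enat k" "3 \<le> k" using r st tm_eq by (auto simp: redex_def)
    let ?v' = "a @ alt_word t s k @ b"
    have "cl ?v' = cl u" using cl_braid[OF ab st False k(1)] v(1) by simp
    moreover have "?v' \<in> lists S" using ab alt_word_lists[OF st(2,1)] by simp
    ultimately have "red ?v'" using lv by (simp add: red_def)
    then have "(?v, ?v') \<in> (comm_step m)\<^sup>*" using u(2) rv v(1) \<open>cl ?v' = cl u\<close> Wc_iff by blast
    then have "(?v, ?v') \<in> (T.swaps id)\<^sup>*" using comm_eq_total[OF _ v(2)] T.comm_step_eq by metis
    then have "filter (\<lambda>x. x \<in> {s, t}) ?v = filter (\<lambda>x. x \<in> {s, t}) ?v'"
      by (rule T.swap_eq_filter_dep) (use T.redex_dep[OF r] in simp)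
    moreover have "filter (\<lambda>x. x \<in> {s, t}) (alt_word s t k) = alt_word s t k"
      "filter (\<lambda>x. x \<in> {s, t}) (alt_word t s k) = alt_word t s k"
      using set_alt_word[of s t k] set_alt_word[of t s k] by (auto intro!: filter_True)
    ultimately have "alt_word s t k = alt_word t s k" by simp
    then show False using False k(2) by (cases k) auto
  qed
qed

text \<open>Lets a commutation equivalence of \<open>s # u\<close> and \<open>s # u'\<close> descend
  to \<open>u\<close> and \<open>u'\<close>.\<close>

lemma remove1_comm:
  assumes "(p, p') \<in> (comm_step m)\<^sup>*"
  shows "(remove1 s p, remove1 s p') \<in> (comm_step m)\<^sup>*"
  using assms
proof (induction rule: rtrancl_induct)
  case (step y z)
  obtain a b x x' where 1: "y = a @ [x, x'] @ b" "z = a @ [x', x] @ b" "m x x' = enat 2"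
    using step(2) unfolding comm_step_def by blast
  have c: "(c @ [x, x'] @ d, c @ [x', x] @ d) \<in> (comm_step m)\<^sup>*" for c d
    unfolding comm_step_def using 1(3) by blast
  have "(remove1 s y, remove1 s z) \<in> (comm_step m)\<^sup>*"
    using c[of "remove1 s a" b] c[of a b] c[of a "remove1 s b"]
    by (auto simp: 1 remove1_append)
  then show ?case using step(3) by simp
qed simp

lemma Wc_descent:
  assumes "z \<in> Wc" "s \<in> S" "len (lm s z) < len z"
  shows "lm s z \<in> Wc"
proof -
  have z: "z \<in> W" using assms Wc_W by blast
  have red: "red (s # u) \<and> cl (s # u) = z" if "red u" "cl u = lm s z" for u
  proof -
    have "u \<in> lists S" using that by (simp add: red_def)
    then have "cl (s # u) = z" using that assms z lm_cl[of u s] by simp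
    then show ?thesis using that assms len_lm[OF z assms(2)] \<open>u \<in> lists S\<close> by (auto simp: red_def)
  qed
  have "(u, u') \<in> (comm_step m)\<^sup>*" if "red u" "cl u = lm s z" "red u'" "cl u' = lm s z" for u u'
  proof -
    have "(s # u, s # u') \<in> (comm_step m)\<^sup>*" using red that assms(1) Wc_iff by metis
    from remove1_comm[OF this, of s] show ?thesis by simp
  qed
  then show ?thesis unfolding Wc_iff using z assms(2) by simp
qed

text \<open>Braid moves of order 2 are commutations, so by \<open>matsumoto\<close> an element whose
  reduced words contain no long braid is fully commutative.\<close>

lemma not_Wc:
  assumes "w \<in> W" "w \<notin> Wc"
  obtains a s t k b where "a \<in> lists S" "b \<in> lists S" "s \<in> S" "t \<in> S" "s \<noteq> t" "m s t = enat k" "3 \<le> k"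
    "red (a @ alt_word s t k @ b)" "cl (a @ alt_word s t k @ b) = w"
proof -
  obtain u u' where u: "red u" "cl u = w" "red u'" "cl u' = w" "(u, u') \<notin> (comm_step m)\<^sup>*"
    using assms Wc_iff by blast
  have "\<exists>a s t k b. a \<in> lists S \<and> b \<in> lists S \<and> s \<in> S \<and> t \<in> S \<and> s \<noteq> t \<and> m s t = enat k \<and> 3 \<le> k \<and>
    red (a @ alt_word s t k @ b) \<and> cl (a @ alt_word s t k @ b) = w" (is ?thesis)
  proof (rule ccontr)
    assume no: "\<not> ?thesis"
    have "(u, v) \<in> (comm_step m)\<^sup>*" if "(u, v) \<in> braid_step\<^sup>*" for v
      using that
    proof (induction rule: rtrancl_induct)
      case (step y z)
      have y: "red y" "cl y = w" using braid_red[OF step(1) u(1)] u(2) by auto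
      obtain a b s t k where 1: "y = a @ alt_word s t k @ b" "z = a @ alt_word t s k @ b" "a \<in> lists S" "b \<in> lists S"
        "s \<in> S" "t \<in> S" "s \<noteq> t" "m s t = enat k"
        using step(2) unfolding braid_step_def by blast
      have "\<not> 3 \<le> k" using no 1 y by blast
      moreover have "2 \<le> k" using m_ge[OF 1(5-7)] 1(8) by (simp add: numeral_eq_enat)
      ultimately have "k = 2" by simp
      then have "y = a @ [s, t] @ b" "z = a @ [t, s] @ b" "m s t = enat 2" using 1 by (simp_all add: numeral_2_eq_2)
      then have "(y, z) \<in> comm_step m" unfolding comm_step_def by blast
      then show ?case using step(3) by simp
    qed simp
    then show False using matsumoto u by metis
  qed
  then show thesis using that by blast
qed

end

subsection \<open>Laurent polynomials and the Hecke algebra\<close>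

lemma vpow_nth: "fls_nth (vpow i) n = (if n = i then 1 else 0)"
  by (simp add: vpow_def)

lemma vpow_mult_nth [simp]: "fls_nth (vpow i * f) n = fls_nth f (n - i)"
  by (simp add: vpow_def fls_X_intpow_times_conv_shift)

lemma vpow_add: "vpow i * vpow j = vpow (i + j)"
  unfolding vpow_def by (rule fls_X_intpow_times_fls_X_intpow)

lemma vpow_mult_assoc: "vpow i * (vpow j * f) = vpow (i + j) * f"
  by (simp add: vpow_add[symmetric] mult.assoc)

lemma vpow_0 [simp]: "vpow 0 = 1"
  by (simp add: vpow_def)

lemma vpow_cancel: "vpow i * f = vpow i * g \<Longrightarrow> f = g"
  by (simp add: vpow_def)

lemma vpow_power: "vpow 1 ^ n = vpow (int n)"
  by (induction n) (simp_all add: vpow_add add.commute)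

lemma laurent_0 [simp]: "laurent 0" and laurent_1 [simp]: "laurent 1" and laurent_vpow [simp]: "laurent (vpow i)"
  by (simp_all add: laurent_def vpow_nth)

lemma laurent_const [simp]: "laurent (fls_const c)"
  by (simp add: laurent_def)

lemma laurent_add [simp]: "laurent f \<Longrightarrow> laurent g \<Longrightarrow> laurent (f + g)"
  unfolding laurent_def
  by (rule finite_subset[of _ "{n. fls_nth f n \<noteq> 0} \<union> {n. fls_nth g n \<noteq> 0}"]) auto

lemma laurent_uminus [simp]: "laurent f \<Longrightarrow> laurent (- f)"
  by (simp add: laurent_def)

lemma laurent_diff [simp]: "laurent f \<Longrightarrow> laurent g \<Longrightarrow> laurent (f - g)"
  using laurent_add[of f "- g"] by simp

lemma laurent_sum: "(\<And>i. i \<in> A \<Longrightarrow> laurent (f i)) \<Longrightarrow> laurent (\<Sum>i\<in>A. f i)"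
  by (induction A rule: infinite_finite_induct) auto

lemma laurent_vpow_mult [simp]: "laurent f \<Longrightarrow> laurent (vpow i * f)"
proof -
  assume "laurent f"
  moreover have "{n. fls_nth (vpow i * f) n \<noteq> 0} = (\<lambda>n. n + i) ` {n. fls_nth f n \<noteq> 0}"
    by (auto simp: image_iff) (metis diff_add_cancel)
  ultimately show ?thesis unfolding laurent_def by simp
qed

lemma laurent_const_mult [simp]: "laurent f \<Longrightarrow> laurent (fls_const c * f)"
  unfolding laurent_def by (rule finite_subset[of _ "{n. fls_nth f n \<noteq> 0}"]) auto

lemma laurent_expand: "laurent f \<Longrightarrow> f = (\<Sum>n\<in>{n. fls_nth f n \<noteq> 0}. fls_const (fls_nth f n) * vpow n)"
proof (rule fls_eqI)
  fix k assume "laurent f"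
  then have fin: "finite {n. fls_nth f n \<noteq> 0}" by (simp add: laurent_def)
  have "fls_nth (\<Sum>n\<in>{n. fls_nth f n \<noteq> 0}. fls_const (fls_nth f n) * vpow n) k =
     (\<Sum>n\<in>{n. fls_nth f n \<noteq> 0}. if n = k then fls_nth f n else 0)"
    unfolding fls_nth_sum by (rule sum.cong) (auto simp: vpow_nth)
  also have "\<dots> = fls_nth f k" using fin by (simp add: sum.delta)
  finally show "fls_nth f k = fls_nth (\<Sum>n\<in>{n. fls_nth f n \<noteq> 0}. fls_const (fls_nth f n) * vpow n) k" by simp
qed

lemma laurent_mult [simp]: "laurent f \<Longrightarrow> laurent g \<Longrightarrow> laurent (f * g)"
  by (subst laurent_expand[of f], assumption)
    (auto simp: sum_distrib_right mult.assoc intro!: laurent_sum)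

lemma lbar_nth:
  assumes "laurent f"
  shows "fls_nth (lbar f) n = fls_nth f (- n)"
proof -
  have fin: "finite {n. fls_nth f n \<noteq> 0}" using assms by (simp add: laurent_def)
  have "fls_nth (lbar f) n = (\<Sum>k\<in>{n. fls_nth f n \<noteq> 0}. if k = - n then fls_nth f k else 0)"
    unfolding lbar_def fls_nth_sum by (rule sum.cong) (auto simp: vpow_nth)
  also have "\<dots> = fls_nth f (- n)" using fin by (simp add: sum.delta)
  finally show ?thesis .
qed

lemma lbar_0 [simp]: "lbar 0 = 0"
  by (simp add: lbar_def)

lemma lbar_1 [simp]: "lbar 1 = 1"
  by (rule fls_eqI) (simp add: lbar_nth)

lemma lbar_add: "laurent f \<Longrightarrow> laurent g \<Longrightarrow> lbar (f + g) = lbar f + lbar g"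
  by (rule fls_eqI) (simp add: lbar_nth)

lemma lbar_diff: "laurent f \<Longrightarrow> laurent g \<Longrightarrow> lbar (f - g) = lbar f - lbar g"
  by (rule fls_eqI) (simp add: lbar_nth)

lemma lbar_vpow_mult: "laurent f \<Longrightarrow> lbar (vpow i * f) = vpow (- i) * lbar f"
  by (rule fls_eqI) (simp add: lbar_nth)

lemma lbar_const_mult: "laurent f \<Longrightarrow> lbar (fls_const c * f) = fls_const c * lbar f"
  by (rule fls_eqI) (simp add: lbar_nth)

lemma laurent_qq [simp]: "laurent qq"
  by (simp add: qq_def)

context coxeter
begin

definition fsupp :: "('a list set \<Rightarrow> int fls) \<Rightarrow> bool" where
  "fsupp h \<longleftrightarrow> finite {w. h w \<noteq> 0} \<and> (\<forall>w. h w \<noteq> 0 \<longrightarrow> w \<in> W)"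

lemma is_hecke_iff: "is_hecke S m h \<longleftrightarrow> fsupp h \<and> (\<forall>w. laurent (h w))"
  unfolding is_hecke_def fsupp_def by blast

lemma fsupp_subset:
  assumes "finite A" "A \<subseteq> W" "\<And>w. h w \<noteq> 0 \<Longrightarrow> w \<in> A"
  shows "fsupp h"
  unfolding fsupp_def using assms finite_subset[of "{w. h w \<noteq> 0}" A] by blast

lemma fsupp_hT [simp]: "w \<in> W \<Longrightarrow> fsupp (hT w)"
  by (rule fsupp_subset[of "{w}"]) (simp_all add: hT_def split: if_splits)

lemma fsupp_add: "fsupp h \<Longrightarrow> fsupp g \<Longrightarrow> fsupp (\<lambda>y. h y + g y)"
  by (rule fsupp_subset[of "{w. h w \<noteq> 0} \<union> {w. g w \<noteq> 0}"]) (auto simp: fsupp_def)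

lemma fsupp_scale: "fsupp h \<Longrightarrow> fsupp (\<lambda>y. c * h y)"
  by (rule fsupp_subset[of "{w. h w \<noteq> 0}"]) (auto simp: fsupp_def)

lemma fsupp_sum:
  assumes "finite I" "\<And>i. i \<in> I \<Longrightarrow> fsupp (h i)"
  shows "fsupp (\<lambda>y. \<Sum>i\<in>I. h i y)"
proof (rule fsupp_subset[of "\<Union>i\<in>I. {w. h i w \<noteq> 0}"])
  show "finite (\<Union>i\<in>I. {w. h i w \<noteq> 0})" "(\<Union>i\<in>I. {w. h i w \<noteq> 0}) \<subseteq> W"
    using assms by (auto simp: fsupp_def)
  show "w \<in> (\<Union>i\<in>I. {w. h i w \<noteq> 0})" if "(\<Sum>i\<in>I. h i w) \<noteq> 0" for w
    using that by (meson UN_I mem_Collect_eq sum.not_neutral_contains_not_neutral)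
qed

lemma hT_expand:
  assumes "finite A" "\<And>w. h w \<noteq> 0 \<Longrightarrow> w \<in> A"
  shows "h = (\<lambda>z. \<Sum>w\<in>A. h w * hT w z)"
proof
  fix z
  have "(\<Sum>w\<in>A. h w * hT w z) = (\<Sum>w\<in>A. if w = z then h w else 0)"
    by (rule sum.cong) (auto simp: hT_def)
  also have "\<dots> = h z" using assms by (auto simp: sum.delta)
  finally show "h z = (\<Sum>w\<in>A. h w * hT w z)" by simp
qed

text \<open>Left multiplication by \<open>T_s\<close>, which the right-handed product does not
  supply directly. Its commutation with right multiplication takes the place of
  associativity.\<close>

definition Lg :: "'a \<Rightarrow> ('a list set \<Rightarrow> int fls) \<Rightarrow> 'a list set \<Rightarrow> int fls" where
  "Lg s h = (\<lambda>y. if y \<in> W then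
      (if len (lm s y) < len y then h (lm s y) + (qq - 1) * h y else qq * h (lm s y)) else 0)"

abbreviation Rg where "Rg s h \<equiv> rmul_gen S m h s"

lemma Rg_def: "Rg s h = (\<lambda>y. if y \<in> W then
      (if len (rm y s) < len y then h (rm y s) + (qq - 1) * h y else qq * h (rm y s)) else 0)"
  by (simp add: rmul_gen_def)

lemma Lg_sum: "Lg s (\<lambda>y. \<Sum>i\<in>I. c i * h i y) = (\<lambda>y. \<Sum>i\<in>I. c i * Lg s (h i) y)"
  unfolding Lg_def by (auto simp: fun_eq_iff sum_distrib_left sum.distrib[symmetric] algebra_simps intro!: sum.cong)

lemma Rg_sum: "Rg s (\<lambda>y. \<Sum>i\<in>I. c i * h i y) = (\<lambda>y. \<Sum>i\<in>I. c i * Rg s (h i) y)"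
  unfolding Rg_def by (auto simp: fun_eq_iff sum_distrib_left sum.distrib[symmetric] algebra_simps intro!: sum.cong)

lemma Lg_lin: "Lg s (\<lambda>y. a * h y + b * g y) = (\<lambda>y. a * Lg s h y + b * Lg s g y)"
  unfolding Lg_def by (auto simp: fun_eq_iff algebra_simps)

lemma Rg_lin: "Rg s (\<lambda>y. a * h y + b * g y) = (\<lambda>y. a * Rg s h y + b * Rg s g y)"
  unfolding Rg_def by (auto simp: fun_eq_iff algebra_simps)

text \<open>The case \<open>s y = y t\<close> is treated apart, because only there can
  multiplication on one side change the descents on the other.\<close>

lemma Lg_Rg:
  assumes "s \<in> S" "t \<in> S"
  shows "Lg s (Rg t h) = Rg t (Lg s h)"
proof
  fix y
  show "Lg s (Rg t h) y = Rg t (Lg s h) y"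
  proof (cases "y \<in> W")
    case True
    note W = True assms
    show ?thesis
    proof (cases "lm s y = rm y t")
      case eq: True
      have e2: "rm (lm s y) t = y" "lm s (rm y t) = y" using W by (simp_all add: eq) (simp add: eq[symmetric])
      show ?thesis
        unfolding Lg_def Rg_def using W e2 by (simp add: eq)
    next
      case False
      have d1: "len (lm s (rm y t)) < len (rm y t) \<longleftrightarrow> len (lm s y) < len y" by (rule descent_iff[OF W False])
      have ne: "lm s y \<noteq> rm y t" by fact
      have ne': "lm s (lm s y) \<noteq> rm (lm s y) t"
      proof
        assume "lm s (lm s y) = rm (lm s y) t"
        then have "rm (rm (lm s y) t) t = rm y t" using W by simp
        then show False using ne W by simp
      qed
      have d2: "len (rm (lm s y) t) < len (lm s y) \<longleftrightarrow> len (rm y t) < len y"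
      proof -
        have c1: "len (rm (lm s y) t) = Suc (len (lm s y)) \<or> len (lm s y) = Suc (len (rm (lm s y) t))" using len_rm W by simp
        have c2: "len (rm y t) = Suc (len y) \<or> len y = Suc (len (rm y t))" using len_rm W by simp
        have c3: "len (lm s y) = Suc (len y) \<or> len y = Suc (len (lm s y))" using len_lm W by simp
        have c4: "len (lm s (rm y t)) = Suc (len (rm y t)) \<or> len (rm y t) = Suc (len (lm s (rm y t)))" using len_lm W by simp
        show ?thesis using c1 c2 c3 c4 d1 lm_rm[OF W] by auto
      qed
      show ?thesis
        unfolding Lg_def Rg_def using W d1 d2 lm_rm[OF W] by (simp add: algebra_simps)
    qed
  qed (simp add: Lg_def Rg_def)
qed

lemma Lg_quadratic:
  assumes "s \<in> S" "\<And>w. h w \<noteq> 0 \<Longrightarrow> w \<in> W"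
  shows "Lg s (Lg s h) = (\<lambda>y. (qq - 1) * Lg s h y + qq * h y)"
proof
  fix y
  show "Lg s (Lg s h) y = (qq - 1) * Lg s h y + qq * h y"
  proof (cases "y \<in> W")
    case True
    have e: "lm s (lm s y) = y" "lm s y \<in> W" using True assms(1) by simp_all
    consider "len (lm s y) = Suc (len y)" | "len y = Suc (len (lm s y))" using len_lm[OF True assms(1)] by blast
    then show ?thesis
      by cases (simp_all add: Lg_def True e algebra_simps)
  next
    case False
    then show ?thesis using assms(2)[of y] by (auto simp: Lg_def)
  qed
qed

lemma Lg_hT:
  assumes "w \<in> W" "s \<in> S"
  shows "Lg s (hT w) = (if len w < len (lm s w) then hT (lm s w) else (\<lambda>y. qq * hT (lm s w) y + (qq - 1) * hT w y))"
proof
  fix y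
  show "Lg s (hT w) y = (if len w < len (lm s w) then hT (lm s w) else (\<lambda>y. qq * hT (lm s w) y + (qq - 1) * hT w y)) y"
  proof (cases "y \<in> W")
    case True
    have "lm s y = w \<longleftrightarrow> y = lm s w" using True assms by auto
    moreover have "lm s w \<noteq> w" using len_lm[OF assms] by auto
    ultimately show ?thesis
    proof (cases "y = w \<or> y = lm s w")
      case True
      have e: "lm s (lm s w) = w" "lm s w \<in> W" using assms by simp_all
      consider "len (lm s w) = Suc (len w)" | "len w = Suc (len (lm s w))" using len_lm[OF assms] by blast
      then show ?thesis using True \<open>lm s w \<noteq> w\<close>
        by cases (auto simp: Lg_def hT_def assms e)
    next
      case False
      then have "lm s y \<noteq> w" using \<open>lm s y = w \<longleftrightarrow> y = lm s w\<close> by blast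
      then show ?thesis using False by (simp add: Lg_def hT_def)
    qed
  next
    case False
    then have "y \<noteq> w" "y \<noteq> lm s w" using assms by auto
    then show ?thesis using False by (simp add: Lg_def hT_def)
  qed
qed

lemma Rg_hT:
  assumes "w \<in> W" "s \<in> S"
  shows "Rg s (hT w) = (if len w < len (rm w s) then hT (rm w s) else (\<lambda>y. qq * hT (rm w s) y + (qq - 1) * hT w y))"
proof
  fix y
  show "Rg s (hT w) y = (if len w < len (rm w s) then hT (rm w s) else (\<lambda>y. qq * hT (rm w s) y + (qq - 1) * hT w y)) y"
  proof (cases "y \<in> W")
    case True
    have "rm y s = w \<longleftrightarrow> y = rm w s" using True assms by auto
    moreover have "rm w s \<noteq> w" using len_rm[OF assms] by auto
    ultimately show ?thesis
    proof (cases "y = w \<or> y = rm w s")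
      case True
      have e: "rm (rm w s) s = w" "rm w s \<in> W" using assms by simp_all
      consider "len (rm w s) = Suc (len w)" | "len w = Suc (len (rm w s))" using len_rm[OF assms] by blast
      then show ?thesis using True \<open>rm w s \<noteq> w\<close>
        by cases (auto simp: Rg_def hT_def assms e)
    next
      case False
      then have "rm y s \<noteq> w" using \<open>rm y s = w \<longleftrightarrow> y = rm w s\<close> by blast
      then show ?thesis using False by (simp add: Rg_def hT_def)
    qed
  next
    case False
    then have "y \<noteq> w" "y \<noteq> rm w s" using assms by auto
    then show ?thesis using False by (simp add: Rg_def hT_def)
  qed
qed

lemma Lg_support:
  assumes "s \<in> S" "Lg s h y \<noteq> 0"
  shows "y \<in> W \<and> (h y \<noteq> 0 \<or> h (lm s y) \<noteq> 0)"
  using assms unfolding Lg_def by (auto split: if_splits)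

lemma Rg_support:
  assumes "s \<in> S" "Rg s h y \<noteq> 0"
  shows "y \<in> W \<and> (h y \<noteq> 0 \<or> h (rm y s) \<noteq> 0)"
  using assms unfolding Rg_def by (auto split: if_splits)

lemma fsupp_Lg: "fsupp h \<Longrightarrow> s \<in> S \<Longrightarrow> fsupp (Lg s h)"
proof (rule fsupp_subset[of "{w. h w \<noteq> 0} \<union> lm s ` {w. h w \<noteq> 0}"])
  fix w assume "s \<in> S" "Lg s h w \<noteq> 0"
  then show "w \<in> {w. h w \<noteq> 0} \<union> lm s ` {w. h w \<noteq> 0}"
    using Lg_support[of s h w] by (auto simp: image_iff)
qed (auto simp: fsupp_def)

lemma fsupp_Rg: "fsupp h \<Longrightarrow> s \<in> S \<Longrightarrow> fsupp (Rg s h)"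
proof (rule fsupp_subset[of "{w. h w \<noteq> 0} \<union> (\<lambda>w. rm w s) ` {w. h w \<noteq> 0}"])
  fix w assume "s \<in> S" "Rg s h w \<noteq> 0"
  then show "w \<in> {w. h w \<noteq> 0} \<union> (\<lambda>w. rm w s) ` {w. h w \<noteq> 0}"
    using Rg_support[of s h w] by (auto simp: image_iff)
qed (auto simp: fsupp_def)

lemma hecke_hT [simp]: "w \<in> W \<Longrightarrow> is_hecke S m (hT w)"
  by (simp add: is_hecke_iff) (simp add: hT_def)

lemma hecke_Lg: "is_hecke S m h \<Longrightarrow> s \<in> S \<Longrightarrow> is_hecke S m (Lg s h)"
  by (auto simp: is_hecke_iff fsupp_Lg) (auto simp: Lg_def)

lemma hecke_Rg: "is_hecke S m h \<Longrightarrow> s \<in> S \<Longrightarrow> is_hecke S m (Rg s h)"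
  by (auto simp: is_hecke_iff fsupp_Rg) (auto simp: Rg_def)

lemma hecke_scale: "is_hecke S m h \<Longrightarrow> laurent c \<Longrightarrow> is_hecke S m (\<lambda>y. c * h y)"
  by (simp add: is_hecke_iff fsupp_scale)

lemma hecke_add: "is_hecke S m h \<Longrightarrow> is_hecke S m g \<Longrightarrow> is_hecke S m (\<lambda>y. h y + g y)"
  by (simp add: is_hecke_iff fsupp_add)

abbreviation Rw where "Rw u h \<equiv> foldl (rmul_gen S m) h u"
definition Lw where "Lw u h = foldr Lg u h"

lemma Lw_simps [simp]: "Lw [] h = h" "Lw (s # u) h = Lg s (Lw u h)"
  by (simp_all add: Lw_def)

lemma Rw_sum: "Rw u (\<lambda>y. \<Sum>i\<in>I. c i * h i y) = (\<lambda>y. \<Sum>i\<in>I. c i * Rw u (h i) y)"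
  by (induction u arbitrary: h) (simp_all add: Rg_sum)

lemma Lw_sum: "Lw u (\<lambda>y. \<Sum>i\<in>I. c i * h i y) = (\<lambda>y. \<Sum>i\<in>I. c i * Lw u (h i) y)"
  by (induction u) (simp_all add: Lg_sum)

lemma Rw_Lg: "s \<in> S \<Longrightarrow> u \<in> lists S \<Longrightarrow> Rw u (Lg s h) = Lg s (Rw u h)"
  by (induction u arbitrary: h) (simp_all add: Lg_Rg[symmetric])

lemma Rw_Lw: "a \<in> lists S \<Longrightarrow> u \<in> lists S \<Longrightarrow> Rw u (Lw a h) = Lw a (Rw u h)"
  by (induction a) (simp_all add: Rw_Lg)

lemma fsupp_Rw: "fsupp h \<Longrightarrow> u \<in> lists S \<Longrightarrow> fsupp (Rw u h)"
  by (induction u arbitrary: h) (simp_all add: fsupp_Rg)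

lemma hecke_Rw: "is_hecke S m h \<Longrightarrow> u \<in> lists S \<Longrightarrow> is_hecke S m (Rw u h)"
  by (induction u arbitrary: h) (simp_all add: hecke_Rg)

lemma fsupp_Lw: "fsupp h \<Longrightarrow> u \<in> lists S \<Longrightarrow> fsupp (Lw u h)"
  by (induction u) (simp_all add: fsupp_Lg)

lemma red_snoc: "red (u @ [s]) \<Longrightarrow> red u \<and> s \<in> S \<and> len (cl u) < len (rm (cl u) s)"
  using red_append[of u "[s]"] rm_cl[of u s] by (auto simp: red_def)

lemma red_Cons: "red (s # u) \<Longrightarrow> red u \<and> s \<in> S \<and> len (cl u) < len (lm s (cl u))"
  using red_append[of "[s]" u] lm_cl[of u s] by (auto simp: red_def)

lemma Rw_hT: "red (a @ u) \<Longrightarrow> Rw u (hT (cl a)) = hT (cl (a @ u))"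
proof (induction u rule: rev_induct)
  case (snoc s u)
  have r: "red (a @ u)" "s \<in> S" "len (cl (a @ u)) < len (rm (cl (a @ u)) s)"
    using red_snoc[of "a @ u" s] snoc.prems by simp_all
  then have "a @ u \<in> lists S" by (simp add: red_def)
  then show ?case using snoc.IH[OF r(1)] r Rg_hT[OF cl_in_W r(2)] rm_cl[of "a @ u" s] by simp
qed simp

lemma Lw_hT: "red u \<Longrightarrow> Lw u (hT (cl [])) = hT (cl u)"
proof (induction u)
  case (Cons s u)
  have r: "red u" "s \<in> S" "len (cl u) < len (lm s (cl u))" using red_Cons[OF Cons.prems] by simp_all
  then have "u \<in> lists S" by (simp add: red_def)
  then show ?case using Cons.IH[OF r(1)] r Lg_hT[OF cl_in_W r(2)] lm_cl[of u s] by simp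
qed simp

text \<open>Write \<open>T_y\<close> as left operators applied to \<open>T_e\<close>. They commute
  with the right operators, and on \<open>T_e\<close> both words give the same basis
  element.\<close>

lemma Rw_hT_cong:
  assumes "y \<in> W" "red u" "red u'" "cl u = cl u'"
  shows "Rw u (hT y) = Rw u' (hT y)"
proof -
  obtain a where a: "red a" "cl a = y" by (rule red_exists[OF assms(1)])
  have l: "a \<in> lists S" "u \<in> lists S" "u' \<in> lists S" using a assms by (auto simp: red_def)
  have "Rw u (hT y) = Lw a (Rw u (hT (cl [])))" unfolding a(2)[symmetric] Lw_hT[OF a(1), symmetric] by (rule Rw_Lw[OF l(1,2)])
  also have "Rw u (hT (cl [])) = Rw u' (hT (cl []))" using Rw_hT[of "[]" u] Rw_hT[of "[]" u'] assms by simp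
  also have "Lw a (Rw u' (hT (cl []))) = Rw u' (hT y)"
    unfolding a(2)[symmetric] Lw_hT[OF a(1), symmetric] by (rule Rw_Lw[OF l(1,3), symmetric])
  finally show ?thesis .
qed

lemma red_word_lists [simp]: "w \<in> W \<Longrightarrow> red_word w \<in> lists S"
  using red_word_red by (simp add: red_def)

lemma hmul_eq:
  assumes "finite A" "\<And>w. g w \<noteq> 0 \<Longrightarrow> w \<in> A"
  shows "hmul S m h g = (\<lambda>y. \<Sum>w\<in>A. g w * Rw (red_word w) h y)"
proof
  fix y
  show "hmul S m h g y = (\<Sum>w\<in>A. g w * Rw (red_word w) h y)"
    unfolding hmul_def rmul_T_def by (rule sum.mono_neutral_left) (use assms in auto)
qed

lemma hmul_hT: "w \<in> W \<Longrightarrow> hmul S m h (hT w) = Rw (red_word w) h"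
  by (subst hmul_eq[of "{w}"]) (auto simp: hT_def split: if_splits)

lemma hmul_sum_left:
  assumes "fsupp g"
  shows "hmul S m (\<lambda>y. \<Sum>i\<in>I. c i * h i y) g = (\<lambda>y. \<Sum>i\<in>I. c i * hmul S m (h i) g y)"
proof -
  have f: "finite {w. g w \<noteq> 0}" using assms by (simp add: fsupp_def)
  show ?thesis
    unfolding hmul_eq[OF f, of g, simplified] Rw_sum sum_distrib_left
    by (subst sum.swap) (simp add: mult.left_commute)
qed

lemma hmul_scale: "fsupp g \<Longrightarrow> hmul S m (\<lambda>y. c * h y) g = (\<lambda>y. c * hmul S m h g y)"
  using hmul_sum_left[of g "\<lambda>_. c" "\<lambda>_. h" "{()}"] by simp

lemma hmul_Lg:
  assumes "fsupp g" "s \<in> S"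
  shows "hmul S m (Lg s h) g = Lg s (hmul S m h g)"
proof -
  have f: "finite {w. g w \<noteq> 0}" using assms by (simp add: fsupp_def)
  show ?thesis
    unfolding hmul_eq[OF f, of g, simplified] Lg_sum
  proof
    fix y
    show "(\<Sum>w | g w \<noteq> 0. g w * Rw (red_word w) (Lg s h) y) = (\<Sum>w | g w \<noteq> 0. g w * Lg s (Rw (red_word w) h) y)"
      by (rule sum.cong) (use assms Rw_Lg in \<open>auto simp: fsupp_def\<close>)
  qed
qed

lemma fsupp_hmul:
  assumes "fsupp h" "fsupp g"
  shows "fsupp (hmul S m h g)"
proof -
  have f: "finite {w. g w \<noteq> 0}" using assms by (simp add: fsupp_def)
  show ?thesis
    unfolding hmul_eq[OF f, of g, simplified]
  proof (rule fsupp_sum[OF f])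
    fix w assume "w \<in> {w. g w \<noteq> 0}"
    then have "w \<in> W" using assms(2) by (simp add: fsupp_def)
    then show "fsupp (\<lambda>y. g w * Rw (red_word w) h y)" by (intro fsupp_scale fsupp_Rw[OF assms(1)] red_word_lists)
  qed
qed


subsection \<open>Dihedral parabolic subgroups\<close>

abbreviation dih where "dih s t \<equiv> cl ` lists {s, t}"

text \<open>Multiplication by a generator preserves the set of alternating words of length at most
  \<open>k\<close>: at length \<open>k\<close> the braid relation turns a growing word into a
  shrinking one.\<close>

lemma dih_elements:
  assumes st: "s \<in> S" "t \<in> S" "s \<noteq> t" "m s t = enat k"
  shows "dih s t = {cl (alt_word s t j) | j. j \<le> k} \<union> {cl (alt_word t s j) | j. j \<le> k}" (is "_ = ?E s t")
proof
  have cons: "cl (x # u) \<in> ?E x y" if xy: "x \<in> S" "y \<in> S" "x \<noteq> y" "m x y = enat k" "u \<in> lists S" "cl u \<in> ?E x y" for x y u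
  proof -
    consider j where "j \<le> k" "cl u = cl (alt_word x y j)" | j where "j \<le> k" "cl u = cl (alt_word y x j)"
      using xy by blast
    then show ?thesis
    proof cases
      case 1
      have e: "cl (x # u) = cl (x # alt_word x y j)" by (rule cl_cons_cong[OF 1(2)]) (use xy in auto)
      show ?thesis
      proof (cases j)
        case 0
        have "m y x = enat k" using xy m_sym by simp
        moreover have "2 \<le> k" using m_ge[OF xy(1-3)] xy(4) by (simp add: numeral_eq_enat)
        ultimately show ?thesis unfolding e 0 by (auto intro!: exI[of _ 1])
      next
        case (Suc i)
        then have "cl (x # alt_word x y j) = cl (alt_word y x i)"
          using cl_del[of "[]" "alt_word y x i" x] xy alt_word_lists by simp
        then show ?thesis unfolding e using 1 Suc by auto
      qed
    next
      case 2
      have e: "cl (x # u) = cl (alt_word x y (Suc j))"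
        using cl_cons_cong[OF 2(2)] xy by simp
      show ?thesis
      proof (cases "j = k")
        case True
        have "cl (x # u) = cl (x # alt_word x y k)"
          by (rule cl_cons_cong) (use 2 True cl_braid[of "[]" "[]" x y k] xy in auto)
        moreover obtain i where i: "k = Suc i" using m_ge[OF xy(1-3)] xy(4) by (cases k) (auto simp: numeral_eq_enat)
        moreover have "cl (x # alt_word x y (Suc i)) = cl (alt_word y x i)"
          using cl_del[of "[]" "alt_word y x i" x] xy alt_word_lists by simp
        ultimately have "cl (x # u) = cl (alt_word y x i)" "i \<le> k" by simp_all
        then show ?thesis by blast
      next
        case False
        then have "Suc j \<le> k" using 2 by simp
        then show ?thesis unfolding e by blast
      qed
    qed
  qed
  have "cl u \<in> ?E s t" if "u \<in> lists {s, t}" for u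
    using that
  proof (induction u rule: list.induct)
    case Nil
    have "cl [] = cl (alt_word s t 0)" by simp
    then show ?case by blast
  next
    case (Cons x u)
    have l: "u \<in> lists S" using Cons.prems st by (auto simp: in_lists_conv_set)
    have ts: "m t s = enat k" using st m_sym by simp
    have IH: "cl u \<in> ?E s t" using Cons by simp
    have "x = s \<or> x = t" using Cons.prems by simp
    then show ?case
    proof
      assume "x = s" then show ?thesis using cons[OF st l IH] by simp
    next
      assume "x = t"
      have "cl u \<in> ?E t s" using IH by blast
      from cons[OF st(2,1) st(3)[symmetric] ts l this] show ?thesis using \<open>x = t\<close> by blast
    qed
  qed
  then show "dih s t \<subseteq> ?E s t" by blast
  have "alt_word s t j \<in> lists {s, t}" "alt_word t s j \<in> lists {s, t}" for j
    using set_alt_word[of s t j] set_alt_word[of t s j] by (auto simp: in_lists_conv_set)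
  then show "?E s t \<subseteq> dih s t" by blast
qed

text \<open>A list without repetition: lengths separate the words, \<open>alt_word_distinct\<close>
  separates the two of each intermediate length, and the two of full length agree.\<close>

lemma sum_dih:
  fixes f :: "'a list set \<Rightarrow> 'r::comm_monoid_add"
  assumes st: "s \<in> S" "t \<in> S" "s \<noteq> t" "m s t = enat (Suc n)"
  shows "(\<Sum>x\<in>dih s t. f x) = f (cl (alt_word s t (Suc n))) + f (cl [])
     + (\<Sum>j=1..<Suc n. f (cl (alt_word s t j)) + f (cl (alt_word t s j)))"
    and "finite (dih s t)"
proof -
  let ?a = "\<lambda>j. cl (alt_word s t j)" and ?b = "\<lambda>j. cl (alt_word t s j)"
  have ts: "m t s = enat (Suc n)" using st m_sym by simp
  have la: "len (?a j) = j" "len (?b j) = j" if "j \<le> Suc n" for j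
    using len_alt_word[OF st(1-3), of j] len_alt_word[OF st(2,1) st(3)[symmetric], of j] that st ts by simp_all
  have ab: "?a j \<noteq> ?b j" if "0 < j" "j < Suc n" for j
    using alt_word_distinct(2)[OF st(1-3), of j] that st by simp
  have "dih s t = insert (?a (Suc n)) (insert (cl []) (?a ` {1..<Suc n} \<union> ?b ` {1..<Suc n}))"
  proof -
    have "?b (Suc n) = ?a (Suc n)" using cl_braid[of "[]" "[]" s t "Suc n"] st by simp
    moreover have "?a 0 = cl []" "?b 0 = cl []" by simp_all
    moreover have "{j. j \<le> Suc n} = insert (Suc n) (insert 0 {1..<Suc n})" by auto
    moreover have "dih s t = ?a ` {j. j \<le> Suc n} \<union> ?b ` {j. j \<le> Suc n}"
      unfolding dih_elements[OF st] by blast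
    ultimately show ?thesis by auto
  qed
  moreover have "cl [] \<notin> ?a ` {1..<Suc n} \<union> ?b ` {1..<Suc n}"
  proof
    assume "cl [] \<in> ?a ` {1..<Suc n} \<union> ?b ` {1..<Suc n}"
    then obtain j where "j \<in> {1..<Suc n}" "cl [] = ?a j \<or> cl [] = ?b j" by blast
    then have "j \<in> {1..<Suc n}" "len (cl []) = j" using la[of j] by (auto simp del: len_one)
    then show False by simp
  qed
  moreover have "?a (Suc n) \<notin> insert (cl []) (?a ` {1..<Suc n} \<union> ?b ` {1..<Suc n})"
  proof
    assume "?a (Suc n) \<in> insert (cl []) (?a ` {1..<Suc n} \<union> ?b ` {1..<Suc n})"
    then consider "?a (Suc n) = cl []" | j where "j \<in> {1..<Suc n}" "?a (Suc n) = ?a j \<or> ?a (Suc n) = ?b j" by blast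
    then show False
    proof cases
      case 1
      then show False using la(1)[of "Suc n"] len_one by simp
    next
      case 2
      then show False using la[of j] la(1)[of "Suc n"] by auto
    qed
  qed
  moreover have "?a ` {1..<Suc n} \<inter> ?b ` {1..<Suc n} = {}"
  proof (rule ccontr)
    assume "?a ` {1..<Suc n} \<inter> ?b ` {1..<Suc n} \<noteq> {}"
    then obtain i j where "i \<in> {1..<Suc n}" "j \<in> {1..<Suc n}" "?a i = ?b j" by blast
    then show False using la[of i] la[of j] ab[of i] by auto
  qed
  moreover have "inj_on ?a {1..<Suc n}" "inj_on ?b {1..<Suc n}"
    by (rule inj_onI, metis la(1) atLeastLessThan_iff less_imp_le, rule inj_onI, metis la(2) atLeastLessThan_iff less_imp_le)
  ultimately show "(\<Sum>x\<in>dih s t. f x) = f (?a (Suc n)) + f (cl []) + (\<Sum>j=1..<Suc n. f (?a j) + f (?b j))"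
    "finite (dih s t)"
    by (simp_all add: sum.union_disjoint sum.reindex sum.distrib add.assoc)
qed

lemma tl_gen_supp: "tl_gen S m s t x = (if x \<in> dih s t then 1 else 0)"
  by (simp add: tl_gen_def)

lemma dih_W: "s \<in> S \<Longrightarrow> t \<in> S \<Longrightarrow> x \<in> dih s t \<Longrightarrow> x \<in> W"
  by (auto intro!: cl_in_W simp: in_lists_conv_set)

lemma fin_order:
  assumes "s \<in> S" "t \<in> S" "s \<noteq> t" "m s t \<noteq> 2" "m s t \<noteq> \<infinity>"
  obtains n where "m s t = enat (Suc n)" "3 \<le> Suc n"
proof -
  obtain k where k: "m s t = enat k" using assms by auto
  then have "2 \<le> k" "k \<noteq> 2" using m_ge[OF assms(1-3)] assms(4) by (auto simp: numeral_eq_enat)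
  then show thesis using that[of "k - 1"] k by simp
qed

lemma fsupp_tl_gen:
  assumes "s \<in> S" "t \<in> S" "s \<noteq> t" "m s t \<noteq> 2" "m s t \<noteq> \<infinity>"
  shows "fsupp (tl_gen S m s t)"
proof -
  obtain n where n: "m s t = enat (Suc n)" by (rule fin_order[OF assms])
  show ?thesis
    by (rule fsupp_subset[OF sum_dih(2)[OF assms(1-3) n]])
      (use dih_W[OF assms(1,2)] in \<open>auto simp: tl_gen_supp split: if_splits\<close>)
qed

lemma hmul_tl_gen:
  assumes "s \<in> S" "t \<in> S" "s \<noteq> t" "m s t = enat (Suc n)"
  shows "hmul S m a (tl_gen S m s t) = (\<lambda>y. \<Sum>x\<in>dih s t. Rw (red_word x) a y)"
  by (subst hmul_eq[OF sum_dih(2)[OF assms]]) (auto simp: tl_gen_supp split: if_splits)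

subsection \<open>The ideal\<close>

abbreviation J where "J \<equiv> tl_ideal S m"

lemma J_fsupp: "h \<in> J \<Longrightarrow> fsupp h"
proof (induction rule: tl_ideal.induct)
  case zero
  show ?case by (simp add: fsupp_def)
next
  case (add h a b s t)
  have "fsupp a" "fsupp b" using add by (simp_all add: is_hecke_iff)
  then show ?case using add fsupp_hmul fsupp_tl_gen by (intro fsupp_add) simp_all
qed

lemma J_add: "h \<in> J \<Longrightarrow> g \<in> J \<Longrightarrow> (\<lambda>y. h y + g y) \<in> J"
proof (induction rule: tl_ideal.induct)
  case (add h a b s t)
  have "(\<lambda>y. (h y + g y) + hmul S m (hmul S m a (tl_gen S m s t)) b y) \<in> J"
    by (rule tl_ideal.add) (use add in simp_all)
  then show ?case by (simp add: algebra_simps)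
qed simp

lemma J_scale:
  assumes "laurent c"
  shows "h \<in> J \<Longrightarrow> (\<lambda>y. c * h y) \<in> J"
proof (induction rule: tl_ideal.induct)
  case zero
  then show ?case using tl_ideal.zero by simp
next
  case (add h a b s t)
  have f: "fsupp (tl_gen S m s t)" "fsupp b" using add fsupp_tl_gen by (simp_all add: is_hecke_iff)
  have "(\<lambda>y. c * h y + hmul S m (hmul S m (\<lambda>y. c * a y) (tl_gen S m s t)) b y) \<in> J"
    by (rule tl_ideal.add) (use add assms hecke_scale in simp_all)
  then show ?case by (simp add: hmul_scale f distrib_left)
qed

lemma J_diff: "h \<in> J \<Longrightarrow> g \<in> J \<Longrightarrow> (\<lambda>y. h y - g y) \<in> J"
  using J_add[of h "\<lambda>y. -1 * g y"] J_scale[of "-1" g] by simp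

lemma J_sum: "finite I \<Longrightarrow> (\<And>i. i \<in> I \<Longrightarrow> h i \<in> J) \<Longrightarrow> (\<lambda>y. \<Sum>i\<in>I. h i y) \<in> J"
  by (induction I rule: finite_induct) (auto simp: tl_ideal.zero J_add)

text \<open>Left multiplication passes through both products to the factor \<open>a\<close>.\<close>

lemma J_Lg:
  assumes "x \<in> S"
  shows "h \<in> J \<Longrightarrow> Lg x h \<in> J"
proof (induction rule: tl_ideal.induct)
  case zero
  have "Lg x (\<lambda>_. 0) = (\<lambda>_. 0)" by (auto simp: Lg_def)
  then show ?case using tl_ideal.zero by simp
next
  case (add h a b s t)
  have f: "fsupp (tl_gen S m s t)" "fsupp b" using add fsupp_tl_gen by (simp_all add: is_hecke_iff)
  have "(\<lambda>y. Lg x h y + hmul S m (hmul S m (Lg x a) (tl_gen S m s t)) b y) \<in> J"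
    by (rule tl_ideal.add) (use add assms hecke_Lg in simp_all)
  then show ?case using Lg_lin[of x 1 h 1] by (simp add: hmul_Lg f assms)
qed

subsection \<open>Functionals on the Temperley--Lieb algebra\<close>

text \<open>The value of \<open>F\<close> on \<open>h T_u\<close>, each basis element being spelled
  by its chosen reduced word. The word \<open>u\<close> accumulates right multiplications of
  \<open>h\<close>.\<close>

definition phi :: "('a list \<Rightarrow> int fls) \<Rightarrow> 'a list \<Rightarrow> ('a list set \<Rightarrow> int fls) \<Rightarrow> int fls" where
  "phi F u h = (\<Sum>w\<in>{w. h w \<noteq> 0}. h w * rho (vpow 1) (red_word w @ u) F [])"

lemma phi_eq:
  assumes "finite A" "\<And>w. h w \<noteq> 0 \<Longrightarrow> w \<in> A"
  shows "phi F u h = (\<Sum>w\<in>A. h w * rho (vpow 1) (red_word w @ u) F [])"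
  unfolding phi_def by (rule sum.mono_neutral_left) (use assms in auto)

lemma phi_sum:
  assumes "finite I" "\<And>i. i \<in> I \<Longrightarrow> fsupp (h i)"
  shows "phi F u (\<lambda>y. \<Sum>i\<in>I. c i * h i y) = (\<Sum>i\<in>I. c i * phi F u (h i))"
proof -
  define A where "A = (\<Union>i\<in>I. {w. h i w \<noteq> 0})"
  have A: "finite A" using assms by (auto simp: A_def fsupp_def)
  have "phi F u (\<lambda>y. \<Sum>i\<in>I. c i * h i y) = (\<Sum>w\<in>A. (\<Sum>i\<in>I. c i * h i w) * rho (vpow 1) (red_word w @ u) F [])"
  proof (rule phi_eq[OF A])
    fix w assume "(\<Sum>i\<in>I. c i * h i w) \<noteq> 0"
    then obtain i where "i \<in> I" "c i * h i w \<noteq> 0" by (meson sum.not_neutral_contains_not_neutral)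
    then show "w \<in> A" unfolding A_def by auto
  qed
  also have "\<dots> = (\<Sum>i\<in>I. c i * (\<Sum>w\<in>A. h i w * rho (vpow 1) (red_word w @ u) F []))"
    unfolding sum_distrib_right sum_distrib_left by (subst sum.swap) (simp add: mult.assoc)
  also have "\<dots> = (\<Sum>i\<in>I. c i * phi F u (h i))"
    by (intro sum.cong refl) (simp add: phi_eq[OF A] A_def, subst phi_eq[OF A], auto simp: A_def)
  finally show ?thesis .
qed

lemma phi_hT: "phi F u (hT w) = rho (vpow 1) (red_word w @ u) F []"
  by (subst phi_eq[of "{w}"]) (auto simp: hT_def split: if_splits)

abbreviation dlt :: "int fls" where "dlt \<equiv> vpow 1 + vpow (-1)"

lemma vpow_inv: "vpow 1 * vpow (-1) = 1"
  by (simp add: vpow_add)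

lemma rho_red_word:
  assumes F: "T.tl_fun dlt F" and "red u"
  shows "rho (vpow 1) (red_word (cl u) @ b) F = rho (vpow 1) (u @ b) F"
proof -
  have "cl u \<in> W" using assms(2) cl_in_W by (simp add: red_def)
  then have "rho (vpow 1) (red_word (cl u)) (rho (vpow 1) b F) = rho (vpow 1) u (rho (vpow 1) b F)"
    by (intro rho_red[OF T.tl_fun_rho[OF F] vpow_inv refl]) (use red_word_red assms in auto)
  then show ?thesis by (simp add: rho_append)
qed

text \<open>If \<open>s\<close> raises the length, the extended word is again reduced. Otherwise
  \<open>w\<close> is spelled by a word ending in \<open>s\<close>, and the quadratic relation
  applies.\<close>

lemma phi_Rg_hT:
  assumes F: "T.tl_fun dlt F" and w: "w \<in> W" and s: "s \<in> S"
  shows "phi F u (Rg s (hT w)) = phi F (s # u) (hT w)"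
proof -
  let ?p = "red_word w"
  have p: "red ?p" "cl ?p = w" "?p \<in> lists S" using red_word_red[OF w] by (auto simp: red_def)
  have c: "rm w s = cl (?p @ [s])" using p rm_cl[of ?p s] s by simp
  show ?thesis
  proof (cases "len w < len (rm w s)")
    case True
    then have "len (rm w s) = Suc (len w)" using len_rm[OF w s] by simp
    then have "red (?p @ [s])" using p s c by (simp add: red_def)
    from rho_red_word[OF F this, of u] show ?thesis
      using True Rg_hT[OF w s] c by (simp add: phi_hT)
  next
    case False
    then have l: "len w = Suc (len (rm w s))" using len_rm[OF w s] by auto
    let ?r = "red_word (rm w s)"
    have r: "red ?r" "cl ?r = rm w s" "?r \<in> lists S" using red_word_red[of "rm w s"] w s by (auto simp: red_def)
    have e: "cl (?r @ [s]) = w" using rm_cl[OF r(3) s] r w s by simp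
    have rs: "red (?r @ [s])" using r s e l by (simp add: red_def)
    have q: "vpow 1 * vpow 1 = qq" by (simp add: vpow_add qq_def)
    have "phi F (s # u) (hT w) = rho (vpow 1) ((?r @ [s]) @ [s] @ u) F []"
      using rho_red_word[OF F rs, of "s # u"] e by (simp add: phi_hT)
    also have "\<dots> = rho (vpow 1) ?r (rho (vpow 1) [s, s] (rho (vpow 1) u F)) []"
    proof -
      have "rho (vpow 1) [s, s] G = rho (vpow 1) [s] (rho (vpow 1) [s] G)" for G :: "'a list \<Rightarrow> int fls" by simp
      then show ?thesis by (simp only: append_assoc rho_append)
    qed
    also have "rho (vpow 1) [s, s] (rho (vpow 1) u F) = (\<lambda>p. (qq - 1) * rho (vpow 1) [s] (rho (vpow 1) u F) p + qq * rho (vpow 1) u F p)"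
      using T.rho_quadratic[OF T.tl_fun_rho[OF F] vpow_inv refl, of s] q by auto
    also have "rho (vpow 1) ?r \<dots> [] = (qq - 1) * rho (vpow 1) ?r (rho (vpow 1) [s] (rho (vpow 1) u F)) [] + qq * rho (vpow 1) ?r (rho (vpow 1) u F) []"
    proof -
      have "rho v u (\<lambda>p. a * G p + b * H p) p = a * rho v u G p + b * rho v u H p" for u v a b G H and p :: "'a list"
        by (induction u arbitrary: p) (simp_all add: algebra_simps)
      then show ?thesis by blast
    qed
    also have "\<dots> = (qq - 1) * phi F u (hT w) + qq * phi F u (hT (rm w s))"
    proof -
      have "rho (vpow 1) (red_word w @ u) F = rho (vpow 1) (?r @ [s] @ u) F"
        using rho_red_word[OF F rs, of u] e by simp
      then show ?thesis by (simp only: phi_hT rho_append)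
    qed
    also have "\<dots> = phi F u (\<lambda>y. \<Sum>i\<in>{True, False}. (if i then qq - 1 else qq) * hT (if i then w else rm w s) y)"
      by (subst phi_sum) (use w s in auto)
    also have "(\<lambda>y. \<Sum>i\<in>{True, False}. (if i then qq - 1 else qq) * hT (if i then w else rm w s) y) = Rg s (hT w)"
      using False Rg_hT[OF w s] by (auto simp: add.commute)
    finally show ?thesis by simp
  qed
qed

lemma phi_Rg:
  assumes F: "T.tl_fun dlt F" and h: "fsupp h" and s: "s \<in> S"
  shows "phi F u (Rg s h) = phi F (s # u) h"
proof -
  let ?A = "{w. h w \<noteq> 0}"
  have A: "finite ?A" "?A \<subseteq> W" using h by (auto simp: fsupp_def)
  have e: "h = (\<lambda>z. \<Sum>w\<in>?A. h w * hT w z)" by (rule hT_expand[OF A(1)]) simp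
  have "Rg s h = Rg s (\<lambda>z. \<Sum>w\<in>?A. h w * hT w z)" using e by (rule arg_cong)
  then have "phi F u (Rg s h) = phi F u (\<lambda>y. \<Sum>w\<in>?A. h w * Rg s (hT w) y)" unfolding Rg_sum by simp
  also have "\<dots> = (\<Sum>w\<in>?A. h w * phi F u (Rg s (hT w)))"
    by (rule phi_sum[OF A(1)]) (use A s in \<open>auto intro!: fsupp_Rg\<close>)
  also have "\<dots> = (\<Sum>w\<in>?A. h w * phi F (s # u) (hT w))"
    by (rule sum.cong) (use A phi_Rg_hT[OF F _ s] in auto)
  also have "\<dots> = phi F (s # u) (\<lambda>z. \<Sum>w\<in>?A. h w * hT w z)"
    by (rule phi_sum[symmetric, OF A(1)]) (use A in auto)
  finally show ?thesis using e by simp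
qed

lemma phi_Rw:
  assumes F: "T.tl_fun dlt F"
  shows "fsupp h \<Longrightarrow> p \<in> lists S \<Longrightarrow> phi F u (Rw p h) = phi F (p @ u) h"
proof (induction p arbitrary: h rule: list.induct)
  case (Cons s p)
  then show ?case using phi_Rg[OF F, of h s "p @ u"] fsupp_Rg by simp
qed simp

lemma rho_sum: "rho v u (\<lambda>p. \<Sum>i\<in>I. G i p) p = (\<Sum>i\<in>I. rho v u (G i) p)"
  by (induction u arbitrary: p) (simp_all add: sum_distrib_left sum_subtractf)

text \<open>The sum over the dihedral subgroup acts as the Chebyshev operator of full order, which
  is zero by \<open>chebop_zero\<close>.\<close>

lemma phi_dih:
  assumes F: "T.tl_fun dlt F" and st: "s \<in> S" "t \<in> S" "s \<noteq> t" "m s t \<noteq> 2" "m s t \<noteq> \<infinity>" and a: "fsupp a"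
  shows "phi F u (hmul S m a (tl_gen S m s t)) = 0"
proof -
  obtain n where n: "m s t = enat (Suc n)" "3 \<le> Suc n" by (rule fin_order[OF st])
  have fin: "finite (dih s t)" by (rule sum_dih(2)[OF st(1-3) n(1)])
  define G where "G = rho (vpow 1) u F"
  have G: "T.tl_fun dlt G" unfolding G_def by (rule T.tl_fun_rho[OF F])
  have ts: "m t s = enat (Suc n)" using st n m_sym by simp
  have rw: "rho (vpow 1) (red_word (cl (alt_word s t j))) G = rho (vpow 1) (alt_word s t j) G"
      "rho (vpow 1) (red_word (cl (alt_word t s j))) G = rho (vpow 1) (alt_word t s j) G" if "j \<le> Suc n" for j
  proof -
    have "red (alt_word s t j)" "red (alt_word t s j)"
      using len_alt_word[OF st(1-3), of j] len_alt_word[OF st(2,1) st(3)[symmetric], of j] that n ts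
        alt_word_lists[OF st(1,2), of j] alt_word_lists[OF st(2,1), of j] by (simp_all add: red_def)
    then show "rho (vpow 1) (red_word (cl (alt_word s t j))) G = rho (vpow 1) (alt_word s t j) G"
      "rho (vpow 1) (red_word (cl (alt_word t s j))) G = rho (vpow 1) (alt_word t s j) G"
      using rho_red_word[OF G, where b = "[]"] by simp_all
  qed
  have z: "(\<Sum>x\<in>dih s t. rho (vpow 1) (red_word x) G p) = 0" for p
  proof -
    have "(\<Sum>x\<in>dih s t. rho (vpow 1) (red_word x) G p) = T.chebop (vpow 1) (Suc n) s t G p"
      unfolding sum_dih(1)[OF st(1-3) n(1)]
      using rw(1)[of "Suc n"] rw(1)[of 0] T.chebop_rho[OF G vpow_inv refl, of n s t p]
      by (simp add: rw del: alt_word.simps(2) sum.op_ivl_Suc T.chebop.simps)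
    also have "\<dots> = 0" by (rule T.chebop_zero[OF G st(3)]) (use n tm_eq st in auto)
    finally show ?thesis .
  qed
  have aA: "finite {w. a w \<noteq> 0}" using a by (simp add: fsupp_def)
  have "phi F u (hmul S m a (tl_gen S m s t)) = phi F u (\<lambda>y. \<Sum>x\<in>dih s t. 1 * Rw (red_word x) a y)"
    by (simp add: hmul_tl_gen[OF st(1-3) n(1)])
  also have "\<dots> = (\<Sum>x\<in>dih s t. 1 * phi F u (Rw (red_word x) a))"
    by (rule phi_sum[OF fin], rule fsupp_Rw[OF a], rule red_word_lists) (use dih_W st in blast)
  also have "\<dots> = (\<Sum>x\<in>dih s t. phi F (red_word x @ u) a)"
    by (rule sum.cong) (use phi_Rw[OF F a] dih_W[OF st(1,2)] in auto)
  also have "\<dots> = (\<Sum>w | a w \<noteq> 0. a w * rho (vpow 1) (red_word w) (\<lambda>p. \<Sum>x\<in>dih s t. rho (vpow 1) (red_word x) G p) [])"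
    unfolding phi_def rho_sum sum_distrib_left
    by (subst sum.swap) (simp add: rho_append G_def)
  also have "\<dots> = 0"
  proof -
    have "rho v u (\<lambda>p. 0 :: int fls) p = 0" for v u and p :: "'a list" by (induction u arbitrary: p) simp_all
    then show ?thesis by (simp add: z)
  qed
  finally show ?thesis .
qed

lemma phi_J:
  assumes F: "T.tl_fun dlt F"
  shows "h \<in> J \<Longrightarrow> phi F [] h = 0"
proof (induction rule: tl_ideal.induct)
  case zero
  then show ?case by (simp add: phi_def)
next
  case (add h a b s t)
  note st = add.hyps(4-8)
  have f: "fsupp a" "fsupp b" "fsupp (tl_gen S m s t)" "fsupp h"
    using add fsupp_tl_gen J_fsupp by (simp_all add: is_hecke_iff)
  let ?X = "hmul S m a (tl_gen S m s t)"
  have X: "fsupp ?X" using f fsupp_hmul by blast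
  have bA: "finite {w. b w \<noteq> 0}" using f by (simp add: fsupp_def)
  have "phi F [] (hmul S m ?X b) = phi F [] (\<lambda>y. \<Sum>w\<in>{w. b w \<noteq> 0}. b w * Rw (red_word w) ?X y)"
    by (subst hmul_eq[OF bA]) simp_all
  also have "\<dots> = (\<Sum>w\<in>{w. b w \<noteq> 0}. b w * phi F [] (Rw (red_word w) ?X))"
  proof (rule phi_sum[OF bA])
    fix w assume "w \<in> {w. b w \<noteq> 0}"
    then have "w \<in> W" using f by (simp add: fsupp_def)
    then show "fsupp (Rw (red_word w) ?X)" by (intro fsupp_Rw[OF X] red_word_lists)
  qed
  also have "\<dots> = 0"
  proof (rule sum.neutral, rule ballI)
    fix w assume "w \<in> {w. b w \<noteq> 0}"
    then have "w \<in> W" using f by (simp add: fsupp_def)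
    then have "phi F [] (Rw (red_word w) ?X) = phi F (red_word w) ?X" using phi_Rw[OF F X, of "red_word w" "[]"] by simp
    then show "b w * phi F [] (Rw (red_word w) ?X) = 0" using phi_dih[OF F st f(1)] by simp
  qed
  finally have z: "phi F [] (hmul S m ?X b) = 0" .
  have "phi F [] (\<lambda>y. \<Sum>i\<in>{True, False}. 1 * (if i then h else hmul S m ?X b) y) =
      (\<Sum>i\<in>{True, False}. 1 * phi F [] (if i then h else hmul S m ?X b))"
    by (rule phi_sum) (use f fsupp_hmul X in auto)
  then show ?case using z add.IH by simp
qed

text \<open>A longest \<open>x\<close> in the support is detected by the functional that is 1 on the
  commutation class of its reduced word. This functional kills shorter words, and reduced words of
  other fully commutative elements are irreducible and lie in other classes.\<close>

theorem Wc_independent: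
  assumes "d \<in> J" "\<And>x. d x \<noteq> 0 \<Longrightarrow> x \<in> Wc"
  shows "d = (\<lambda>_. 0)"
proof (rule ccontr)
  assume "d \<noteq> (\<lambda>_. 0)"
  then have ne: "{w. d w \<noteq> 0} \<noteq> {}" by auto
  have fin: "finite {w. d w \<noteq> 0}" using J_fsupp[OF assms(1)] by (simp add: fsupp_def)
  obtain x where x: "d x \<noteq> 0" and mx: "\<And>y. d y \<noteq> 0 \<Longrightarrow> len y \<le> len x"
  proof -
    have "Max (len ` {w. d w \<noteq> 0}) \<in> len ` {w. d w \<noteq> 0}" by (rule Max_in) (use fin ne in auto)
    then obtain x where "d x \<noteq> 0" "len x = Max (len ` {w. d w \<noteq> 0})" by auto
    then show thesis using that[of x] fin by simp
  qed
  have xc: "x \<in> Wc" using assms(2) x by blast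
  have rx: "red (red_word x)" "cl (red_word x) = x" using red_word_red Wc_W xc by auto
  let ?N = "len x"
  let ?g = "\<lambda>p. if (red_word x, p) \<in> (comm_step tm)\<^sup>* then 1 else 0 :: int fls"
  have lx: "length (red_word x) = ?N" using rx by (simp add: red_def)
  have g: "?g u = ?g v" if "(u, v) \<in> (comm_step tm)\<^sup>*" for u v
    using that T.comm_eq_sym[OF that] by (meson rtrancl_trans)
  have g0: "?g u = 0" if "length u < ?N" for u
    using that lx T.comm_eq_length[of "red_word x" u] by auto
  obtain F where F: "\<And>n. T.good dlt n F" "\<And>u. \<not> T.has_redex u \<Longrightarrow> F u = ?g u" "\<And>u. length u < ?N \<Longrightarrow> F u = 0"
    by (rule T.nf_exists[of ?g ?N dlt, OF g g0]) auto
  have tl: "T.tl_fun dlt F" unfolding T.tl_fun_def using F(1) by blast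
  have val: "rho (vpow 1) (red_word y) F [] = (if y = x then vpow 1 ^ ?N else 0)" if y: "d y \<noteq> 0" for y
  proof -
    have yc: "y \<in> Wc" using assms(2) y by blast
    have ry: "red (red_word y)" "cl (red_word y) = y" using red_word_red Wc_W yc by auto
    have ly: "length (red_word y) \<le> ?N" using ry mx[OF y] by (simp add: red_def)
    have e: "rho (vpow 1) (red_word y) F [] = vpow 1 ^ length (red_word y) * F (red_word y)"
      using T.rho_low[where F = F and N = ?N and v = "vpow 1" and p = "[]" and u = "red_word y"] F(3) ly by simp
    have "F (red_word y) = ?g (red_word y)" using F(2) Wc_no_redex ry yc by simp
    also have "\<dots> = (if y = x then 1 else 0)"
      using comm_eq_cl[of "red_word x" "red_word y"] rx ry by (auto simp: red_def)
    finally show ?thesis using e lx by simp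
  qed
  have "0 = phi F [] d" using phi_J[OF tl assms(1)] by simp
  also have "\<dots> = (\<Sum>w | d w \<noteq> 0. d w * (if w = x then vpow 1 ^ ?N else 0))"
    unfolding phi_def by (rule sum.cong) (simp_all add: val)
  also have "\<dots> = (\<Sum>w | d w \<noteq> 0. if w = x then d w * vpow 1 ^ ?N else 0)"
    by (rule sum.cong) simp_all
  also have "\<dots> = d x * vpow 1 ^ ?N" using x fin by (simp add: sum.delta)
  finally have "vpow (int ?N) * d x = vpow (int ?N) * 0" by (simp add: vpow_power mult.commute)
  then show False using vpow_cancel x by metis
qed


subsection \<open>The polynomials \<open>D\<close>\<close>

lemma Rg_support_ble:
  assumes "s \<in> S" "len x < len (rm x s)" "x \<in> W" "\<And>y. h y \<noteq> 0 \<Longrightarrow> ble y x" "Rg s h y \<noteq> 0"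
  shows "ble y (rm x s)"
proof -
  have up: "ble x (rm x s)" by (rule bedge_rm[OF assms(3,1,2)])
  have y: "y \<in> W" "h y \<noteq> 0 \<or> h (rm y s) \<noteq> 0" using Rg_support[OF assms(1,5)] by auto
  from y(2) show ?thesis
  proof
    assume "h y \<noteq> 0"
    then show ?thesis using assms(4) up ble_trans by blast
  next
    assume "h (rm y s) \<noteq> 0"
    then have "ble (rm y s) x" using assms(4) by blast
    from ble_rm_cases[OF this assms(1)] show ?thesis using up ble_trans y assms(1) by auto
  qed
qed

text \<open>Each further letter of a reduced word moves the upper bound one step up in the Bruhat
  order.\<close>

lemma Rw_support_ble:
  assumes "red (c @ p)" "\<And>y. h y \<noteq> 0 \<Longrightarrow> ble y (cl c)" "Rw p h y \<noteq> 0"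
  shows "ble y (cl (c @ p))"
  using assms(1,3)
proof (induction p arbitrary: y rule: rev_induct)
  case (snoc s p)
  have r: "red (c @ p)" "s \<in> S" "len (cl (c @ p)) < len (rm (cl (c @ p)) s)"
    using red_snoc[of "c @ p" s] snoc.prems(1) by simp_all
  have l: "c @ p \<in> lists S" using r by (simp add: red_def)
  have "ble y (rm (cl (c @ p)) s)"
    by (rule Rg_support_ble[OF r(2,3) cl_in_W[OF l], of "Rw p h"]) (use snoc.IH[OF r(1)] snoc.prems in auto)
  then show ?case using rm_cl[OF l r(2)] by simp
qed (use assms(2) in simp)

lemma Rw_support_len:
  assumes "p \<in> lists S" "\<And>y. h y \<noteq> 0 \<Longrightarrow> len y \<le> N" "Rw p h y \<noteq> 0"
  shows "len y \<le> N + length p"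
  using assms(1,3)
proof (induction p arbitrary: y rule: rev_induct)
  case (snoc s p)
  have s: "s \<in> S" "p \<in> lists S" using snoc.prems by auto
  have "Rg s (Rw p h) y \<noteq> 0" using snoc.prems by simp
  from Rg_support[OF s(1) this] have y: "y \<in> W" "Rw p h y \<noteq> 0 \<or> Rw p h (rm y s) \<noteq> 0" by auto
  then show ?case using snoc.IH[OF s(2), of y] snoc.IH[OF s(2), of "rm y s"] len_rm[OF y(1) s(1)] by auto
qed (use assms(2) in simp)

lemma red_prefix_ble: "red (c @ p) \<Longrightarrow> ble (cl c) (cl (c @ p))"
proof (induction p rule: rev_induct)
  case Nil
  then show ?case by (simp add: red_def cl_in_W)
next
  case (snoc s p)
  have r: "red (c @ p)" "s \<in> S" "len (cl (c @ p)) < len (rm (cl (c @ p)) s)"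
    using red_snoc[of "c @ p" s] snoc.prems(1) by simp_all
  have l: "c @ p \<in> lists S" using r by (simp add: red_def)
  have "ble (cl (c @ p)) (rm (cl (c @ p)) s)" by (rule bedge_rm[OF cl_in_W[OF l] r(2,3)])
  then show ?case using snoc.IH[OF r(1)] rm_cl[OF l r(2)] ble_trans by simp
qed

text \<open>Reduction of a word containing a long braid: the generator of the ideal, multiplied by \<open>T\<^sub>a\<close> and \<open>T\<^sub>b\<close>,
  has leading term \<open>T\<^sub>w\<close> and all its other terms strictly below \<open>w\<close>.\<close>
lemma braid_reduction:
  assumes ab: "a \<in> lists S" "b \<in> lists S" and st: "s \<in> S" "t \<in> S" "s \<noteq> t" "m s t = enat k" "3 \<le> k"
    and r: "red (a @ alt_word s t k @ b)"
  obtains Y where "is_hecke S m Y" "\<And>y. Y y \<noteq> 0 \<Longrightarrow> ble y (cl (a @ alt_word s t k @ b)) \<and> len y < len (cl (a @ alt_word s t k @ b))"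
    "(\<lambda>y. hT (cl (a @ alt_word s t k @ b)) y + Y y) \<in> J"
proof -
  define w where "w = cl (a @ alt_word s t k @ b)"
  obtain n where n: "k = Suc n" using st by (cases k) auto
  \<comment> \<open>\<open>hmul\<close> spells its right factor by the chosen reduced word, so
    \<open>b\<close> is replaced by that word.\<close>
  define rb where "rb = red_word (cl b)"
  have rb: "red rb" "cl rb = cl b" "rb \<in> lists S" using red_word_red[of "cl b"] ab cl_in_W by (auto simp: rb_def red_def)
  have ra: "red a" "red b" using red_append[OF r] red_append[of "alt_word s t k" b] by auto
  have w': "cl (a @ alt_word s t k @ rb) = w" unfolding w_def
    using cl_append_cong[of "a @ alt_word s t k" "a @ alt_word s t k" rb b] rb ab alt_word_lists[OF st(1,2), of k] by simp
  have lb: "length rb = length b" using rb ra by (simp add: red_def)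
  have r': "red (a @ alt_word s t k @ rb)"
    using r w' lb rb ab alt_word_lists[OF st(1,2), of k] by (simp add: red_def w_def)
  have lw: "len w = length a + k + length rb" using r' w' by (simp add: red_def)
  have AW: "cl a \<in> W" "cl b \<in> W" using ab cl_in_W by auto
  \<comment> \<open>The product \<open>T_a T_x T_b\<close>.\<close>
  define f where "f x = Rw rb (Rw (red_word x) (hT (cl a)))" for x
  have ts: "m t s = enat k" using st m_sym by simp
  have f: "f (cl u) = Rw rb (Rw u (hT (cl a)))" if "red u" for u
  proof -
    have uW: "cl u \<in> W" using that cl_in_W by (simp add: red_def)
    show ?thesis unfolding f_def using Rw_hT_cong[OF AW(1) _ that, of "red_word (cl u)"] red_word_red[OF uW] by simp
  qed
  have ralt: "red (alt_word s t j)" "red (alt_word t s j)" if "j \<le> k" for j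
    using len_alt_word[OF st(1-3), of j] len_alt_word[OF st(2,1) st(3)[symmetric], of j] that st(4) ts
      alt_word_lists[OF st(1,2), of j] alt_word_lists[OF st(2,1), of j] by (simp_all add: red_def)
  define Y where "Y = (\<lambda>y. f (cl []) y + (\<Sum>j=1..<Suc n. f (cl (alt_word s t j)) y + f (cl (alt_word t s j)) y))"
  have hf: "is_hecke S m (f x)" if "x \<in> W" for x
    unfolding f_def using that rb AW by (intro hecke_Rw) auto
  have altW: "cl (alt_word s t j) \<in> W" "cl (alt_word t s j) \<in> W" for j
    using alt_word_lists st cl_in_W by blast+
  show thesis
  proof (rule that)
    show "is_hecke S m Y"
    proof -
      have "fsupp (\<lambda>y. f (cl (alt_word s t j)) y + f (cl (alt_word t s j)) y)" for j
        using hf altW by (intro fsupp_add) (simp_all add: is_hecke_iff)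
      then have "fsupp (\<lambda>y. \<Sum>j=1..<Suc n. f (cl (alt_word s t j)) y + f (cl (alt_word t s j)) y)"
        by (intro fsupp_sum) auto
      then have "fsupp Y" unfolding Y_def using hf[of "cl []"] by (intro fsupp_add) (simp_all add: is_hecke_iff)
      moreover have "laurent (Y y)" for y
        unfolding Y_def using hf altW one_W by (intro laurent_add laurent_sum) (simp_all add: is_hecke_iff)
      ultimately show ?thesis by (simp add: is_hecke_iff)
    qed
    have h0: "ble y (cl a)" if "hT (cl a) y \<noteq> 0" for y using that AW by (simp add: hT_def split: if_splits)
    have h1: "len y \<le> length a" if "hT (cl a) y \<noteq> 0" for y using that ra by (simp add: hT_def red_def split: if_splits)
    have supp1: "ble y w \<and> len y < len w" if y: "f (cl (alt_word s t j)) y \<noteq> 0" and j: "j < k" for y j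
    proof
      have y': "Rw rb (Rw (alt_word s t j) (hT (cl a))) y \<noteq> 0" using y f[OF ralt(1)] j by simp
      have pre: "alt_word s t k = alt_word s t j @ drop j (alt_word s t k)"
        using take_alt_word[of j k s t] j by (metis append_take_drop_id less_imp_le)
      have r1: "red (a @ alt_word s t k)" using red_append[of "a @ alt_word s t k" rb] r' by simp
      have r1': "red ((a @ alt_word s t j) @ drop j (alt_word s t k))" using r1 pre by (metis append.assoc)
      have r2: "red (a @ alt_word s t j)" using red_append[OF r1'] by simp
      have "ble z (cl (a @ alt_word s t k))" if "Rw (alt_word s t j) (hT (cl a)) z \<noteq> 0" for z
      proof -
        have "ble z (cl (a @ alt_word s t j))" by (rule Rw_support_ble[OF r2 h0 that])
        moreover have "ble (cl (a @ alt_word s t j)) (cl (a @ alt_word s t k))"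
          using red_prefix_ble[OF r1'] pre by (metis append.assoc)
        ultimately show ?thesis using ble_trans by blast
      qed
      then have "ble y (cl ((a @ alt_word s t k) @ rb))"
        by (rule Rw_support_ble[rotated]) (use r' y' in simp_all)
      then show "ble y w" using w' by simp
      have "Rw (alt_word s t j @ rb) (hT (cl a)) y \<noteq> 0" using y' by simp
      then have "len y \<le> length a + length (alt_word s t j @ rb)"
        by (rule Rw_support_len[rotated 2]) (use h1 rb alt_word_lists[OF st(1,2)] in auto)
      then show "len y < len w" using j lw by simp
    qed
    \<comment> \<open>Words beginning with \<open>t\<close> are compared with the part of the long
      word after its first \<open>s\<close>; hence the detour through \<open>a @ [s]\<close> and the
      bound \<open>Suc j \<le> k\<close>.\<close>
    have supp2: "ble y w \<and> len y < len w" if y: "f (cl (alt_word t s j)) y \<noteq> 0" and j: "Suc j \<le> k" for y j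
    proof
      have y': "Rw rb (Rw (alt_word t s j) (hT (cl a))) y \<noteq> 0" using y f[OF ralt(2)] j by simp
      have "s # alt_word t s j = take (Suc j) (alt_word s t k)" using take_alt_word[OF j, of s t] by simp
      then have pre: "alt_word s t k = [s] @ alt_word t s j @ drop (Suc j) (alt_word s t k)"
        by (metis append_take_drop_id append_Cons append_Nil)
      have r1: "red (a @ alt_word s t k)" using red_append[of "a @ alt_word s t k" rb] r' by simp
      have r1': "red (((a @ [s]) @ alt_word t s j) @ drop (Suc j) (alt_word s t k))" using r1 pre by (metis append.assoc)
      have r2: "red ((a @ [s]) @ alt_word t s j)" using red_append[OF r1'] by simp
      have r3: "red (a @ [s])" using red_append[OF r2] by simp
      have h0': "ble z (cl (a @ [s]))" if "hT (cl a) z \<noteq> 0" for z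
        using h0[OF that] red_prefix_ble[OF r3] ble_trans by blast
      have "ble z (cl (a @ alt_word s t k))" if "Rw (alt_word t s j) (hT (cl a)) z \<noteq> 0" for z
      proof -
        have "ble z (cl ((a @ [s]) @ alt_word t s j))" by (rule Rw_support_ble[OF r2 h0' that])
        moreover have "ble (cl ((a @ [s]) @ alt_word t s j)) (cl (a @ alt_word s t k))"
          using red_prefix_ble[OF r1'] pre by (metis append.assoc)
        ultimately show ?thesis using ble_trans by blast
      qed
      then have "ble y (cl ((a @ alt_word s t k) @ rb))"
        by (rule Rw_support_ble[rotated]) (use r' y' in simp_all)
      then show "ble y w" using w' by simp
      have "Rw (alt_word t s j @ rb) (hT (cl a)) y \<noteq> 0" using y' by simp
      then have "len y \<le> length a + length (alt_word t s j @ rb)"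
        by (rule Rw_support_len[rotated 2]) (use h1 rb alt_word_lists[OF st(2,1)] in auto)
      then show "len y < len w" using j lw by simp
    qed
    show "ble y (cl (a @ alt_word s t k @ b)) \<and> len y < len (cl (a @ alt_word s t k @ b))" if "Y y \<noteq> 0" for y
    proof -
      consider "f (cl []) y \<noteq> 0" | j where "j \<in> {1..<Suc n}" "f (cl (alt_word s t j)) y + f (cl (alt_word t s j)) y \<noteq> 0"
      proof (cases "f (cl []) y = 0")
        case True
        then have "(\<Sum>j=1..<Suc n. f (cl (alt_word s t j)) y + f (cl (alt_word t s j)) y) \<noteq> 0"
          using \<open>Y y \<noteq> 0\<close> by (simp add: Y_def del: sum.op_ivl_Suc)
        then obtain j where "j \<in> {1..<Suc n}" "f (cl (alt_word s t j)) y + f (cl (alt_word t s j)) y \<noteq> 0"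
          by (rule sum.not_neutral_contains_not_neutral)
        then show ?thesis using that(2) by blast
      qed (use that(1) in blast)
      then have "ble y w \<and> len y < len w"
      proof cases
        case 1
        then show ?thesis using supp1[of 0 y] n by simp
      next
        case 2
        then show ?thesis using supp1[of j y] supp2[of j y] n by (cases "f (cl (alt_word s t j)) y = 0") auto
      qed
      then show ?thesis by (simp add: w_def)
    qed
    have "(\<lambda>y. hT w y + Y y) = hmul S m (hmul S m (hT (cl a)) (tl_gen S m s t)) (hT (cl b))"
    proof
      fix y
      have "f (cl (alt_word s t k)) = hT w"
        using f[OF ralt(1)[of k]] Rw_hT[of a "alt_word s t k @ rb"] r' w' by simp
      then have "hT w y + Y y = (\<Sum>x\<in>dih s t. f x y)"
        unfolding sum_dih(1)[OF st(1-3) st(4)[unfolded n]] Y_def n by (simp add: add.assoc)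
      also have "\<dots> = Rw rb (\<lambda>y. \<Sum>x\<in>dih s t. 1 * Rw (red_word x) (hT (cl a)) y) y"
        unfolding Rw_sum f_def by simp
      also have "\<dots> = hmul S m (hmul S m (hT (cl a)) (tl_gen S m s t)) (hT (cl b)) y"
        by (simp add: hmul_hT AW rb_def hmul_tl_gen[OF st(1-3) st(4)[unfolded n]])
      finally show "hT w y + Y y = hmul S m (hmul S m (hT (cl a)) (tl_gen S m s t)) (hT (cl b)) y" .
    qed
    moreover have "(\<lambda>y. 0 + hmul S m (hmul S m (hT (cl a)) (tl_gen S m s t)) (hT (cl b)) y) \<in> J"
      by (rule tl_ideal.add[OF tl_ideal.zero]) (use AW st in \<open>auto simp: numeral_eq_enat\<close>)
    ultimately show "(\<lambda>y. hT (cl (a @ alt_word s t k @ b)) y + Y y) \<in> J" by (simp add: w_def)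
  qed
qed

text \<open>Induction on the length: modulo the ideal, \<open>braid_reduction\<close> replaces
  \<open>T_w\<close> by a combination of shorter elements below \<open>w\<close>.\<close>

lemma D_exists:
  assumes "w \<in> W"
  shows "\<exists>d. (\<forall>x. d x \<noteq> 0 \<longrightarrow> x \<in> Wc \<and> ble x w) \<and> (\<forall>x. laurent (d x)) \<and> (\<lambda>y. hT w y - d y) \<in> J"
  using assms
proof (induction "len w" arbitrary: w rule: less_induct)
  case less
  show ?case
  proof (cases "w \<in> Wc")
    case True
    then show ?thesis using less.prems tl_ideal.zero by (intro exI[of _ "hT w"]) (auto simp: hT_def)
  next
    case False
    obtain a s t k b where ab: "a \<in> lists S" "b \<in> lists S" "s \<in> S" "t \<in> S" "s \<noteq> t" "m s t = enat k" "3 \<le> k"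
      "red (a @ alt_word s t k @ b)" and w: "cl (a @ alt_word s t k @ b) = w"
      by (rule not_Wc[OF less.prems False])
    obtain Y where Y: "is_hecke S m Y" "\<And>y. Y y \<noteq> 0 \<Longrightarrow> ble y w \<and> len y < len w" "(\<lambda>y. hT w y + Y y) \<in> J"
      by (rule braid_reduction[OF ab]) (use w in auto)
    let ?A = "{y. Y y \<noteq> 0}"
    have A: "finite ?A" using Y(1) by (simp add: is_hecke_iff fsupp_def)
    have "\<exists>d. (\<forall>x. d x \<noteq> 0 \<longrightarrow> x \<in> Wc \<and> ble x y) \<and> (\<forall>x. laurent (d x)) \<and> (\<lambda>z. hT y z - d z) \<in> J"
      if "y \<in> ?A" for y
      using less.hyps[of y] Y(2)[of y] that ble_W by blast
    then obtain d where d': "\<forall>y\<in>?A. (\<forall>x. d y x \<noteq> 0 \<longrightarrow> x \<in> Wc \<and> ble x y) \<and> (\<forall>x. laurent (d y x)) \<and> (\<lambda>z. hT y z - d y z) \<in> J"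
      by (rule bchoice[OF ballI, THEN exE]) blast+
    have d: "(\<forall>x. d y x \<noteq> 0 \<longrightarrow> x \<in> Wc \<and> ble x y) \<and> (\<forall>x. laurent (d y x)) \<and> (\<lambda>z. hT y z - d y z) \<in> J" if "Y y \<noteq> 0" for y
      using d' that by simp
    define e where "e x = - (\<Sum>y\<in>?A. Y y * d y x)" for x
    have "x \<in> Wc \<and> ble x w" if "e x \<noteq> 0" for x
    proof -
      have "(\<Sum>y\<in>?A. Y y * d y x) \<noteq> 0" using that by (simp add: e_def)
      then obtain y where "Y y \<noteq> 0" "d y x \<noteq> 0" by (metis (mono_tags, lifting) mem_Collect_eq mult_zero_right sum.neutral)
      then show ?thesis using d Y(2) ble_trans by blast
    qed
    moreover have "laurent (e x)" for x
      unfolding e_def using d Y(1) by (intro laurent_uminus laurent_sum laurent_mult) (auto simp: is_hecke_iff)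
    moreover have "(\<lambda>y. hT w y - e y) \<in> J"
    proof -
      have "(\<lambda>z. \<Sum>y\<in>?A. Y y * (hT y z - d y z)) \<in> J"
        by (rule J_sum[OF A], rule J_scale) (use d Y(1) in \<open>auto simp: is_hecke_iff\<close>)
      from J_diff[OF Y(3) this]
      have in_J: "(\<lambda>z. hT w z + Y z - (\<Sum>y\<in>?A. Y y * (hT y z - d y z))) \<in> J" .
      have "Y = (\<lambda>z. \<Sum>y\<in>?A. Y y * hT y z)" by (rule hT_expand[OF A]) simp
      then have Yz: "Y z = (\<Sum>y\<in>?A. Y y * hT y z)" for z by (rule fun_cong)
      have "(\<lambda>z. hT w z + Y z - (\<Sum>y\<in>?A. Y y * (hT y z - d y z))) = (\<lambda>z. hT w z - e z)"
      proof
        fix z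
        have "(\<Sum>y\<in>?A. Y y * (hT y z - d y z)) = (\<Sum>y\<in>?A. Y y * hT y z) - (\<Sum>y\<in>?A. Y y * d y z)"
          unfolding right_diff_distrib by (rule sum_subtractf)
        also have "(\<Sum>y\<in>?A. Y y * hT y z) = Y z" by (rule Yz[symmetric])
        finally show "hT w z + Y z - (\<Sum>y\<in>?A. Y y * (hT y z - d y z)) = hT w z - e z"
          unfolding e_def by (simp only: diff_minus_eq_add add_diff_eq diff_diff_eq2 add_diff_cancel_right')
            (simp add: algebra_simps)
      qed
      with in_J show ?thesis by (simp only:)
    qed
    ultimately show ?thesis by blast
  qed
qed

lemma finite_Wc_ble: "w \<in> W \<Longrightarrow> finite {x \<in> Wc. ble x w}"
  by (rule finite_subset[OF _ finite_ble]) auto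

text \<open>Resolves the definite description in \<open>D_fam\<close>: existence is
  \<open>D_exists\<close>, uniqueness is \<open>Wc_independent\<close>.\<close>

lemma Dpol_props:
  assumes w: "w \<in> W"
  shows "Dpol S m x w \<noteq> 0 \<Longrightarrow> x \<in> Wc \<and> ble x w" "laurent (Dpol S m x w)" "(\<lambda>y. hT w y - Dpol S m y w) \<in> J"
proof -
  define P where "P d \<longleftrightarrow> (\<forall>x. d x \<noteq> 0 \<longrightarrow> x \<in> Wc \<and> ble x w) \<and> (\<forall>x. laurent (d x)) \<and>
      tl_eq S m (hT w) (\<lambda>y. \<Sum>x\<in>{x \<in> Wc. ble x w}. d x * hT x y)" for d
  have e: "tl_eq S m (hT w) (\<lambda>y. \<Sum>x\<in>{x \<in> Wc. ble x w}. d x * hT x y) \<longleftrightarrow> (\<lambda>y. hT w y - d y) \<in> J"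
    if "\<forall>x. d x \<noteq> 0 \<longrightarrow> x \<in> Wc \<and> ble x w" for d
  proof -
    have "d = (\<lambda>y. \<Sum>x\<in>{x \<in> Wc. ble x w}. d x * hT x y)"
      by (rule hT_expand[OF finite_Wc_ble[OF w]]) (use that in blast)
    then have s: "(\<Sum>x\<in>{x \<in> Wc. ble x w}. d x * hT x y) = d y" for y by (rule fun_cong[symmetric])
    show ?thesis unfolding tl_eq_def s by (rule refl)
  qed
  obtain d where d: "\<forall>x. d x \<noteq> 0 \<longrightarrow> x \<in> Wc \<and> ble x w" "\<forall>x. laurent (d x)" "(\<lambda>y. hT w y - d y) \<in> J"
    using D_exists[OF w] by blast
  have "D_fam S m w = d"
    unfolding D_fam_def
  proof (rule the_equality)
    show "(\<forall>x. d x \<noteq> 0 \<longrightarrow> x \<in> Wc \<and> ble x w) \<and> (\<forall>x. laurent (d x)) \<and>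
      tl_eq S m (hT w) (\<lambda>y. \<Sum>x\<in>{x \<in> Wc. ble x w}. d x * hT x y)" using d e[OF d(1)] by blast
    fix d' assume d': "(\<forall>x. d' x \<noteq> 0 \<longrightarrow> x \<in> Wc \<and> ble x w) \<and> (\<forall>x. laurent (d' x)) \<and>
      tl_eq S m (hT w) (\<lambda>y. \<Sum>x\<in>{x \<in> Wc. ble x w}. d' x * hT x y)"
    then have "(\<lambda>y. hT w y - d' y) \<in> J" using e[of d'] by blast
    from J_diff[OF d(3) this] have "(\<lambda>y. d' y - d y) \<in> J" by simp
    then have "(\<lambda>y. d' y - d y) = (\<lambda>_. 0)"
    proof (rule Wc_independent)
      fix x assume "d' x - d x \<noteq> 0"
      then have "d' x \<noteq> 0 \<or> d x \<noteq> 0" by auto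
      then show "x \<in> Wc" using d d' by blast
    qed
    then show "d' = d" by (simp add: fun_eq_iff)
  qed
  then show "Dpol S m x w \<noteq> 0 \<Longrightarrow> x \<in> Wc \<and> ble x w" "laurent (Dpol S m x w)" "(\<lambda>y. hT w y - Dpol S m y w) \<in> J"
    using d by (simp_all add: Dpol_def)
qed

lemma Dpol_Wc:
  assumes "w \<in> Wc"
  shows "Dpol S m x w = (if x = w then 1 else 0)"
proof -
  have w: "w \<in> W" using assms Wc_W by blast
  have "(\<lambda>y. hT w y - Dpol S m y w) = (\<lambda>_. 0)"
  proof (rule Wc_independent[OF Dpol_props(3)[OF w]])
    fix x assume "hT w x - Dpol S m x w \<noteq> 0"
    then have "x = w \<or> Dpol S m x w \<noteq> 0" by (auto simp: hT_def split: if_splits)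
    then show "x \<in> Wc" using assms Dpol_props(1)[OF w] by blast
  qed
  then have "hT w x - Dpol S m x w = 0" by meson
  then show ?thesis by (simp add: hT_def)
qed


subsection \<open>The bar involution\<close>

lemma qq_inv: "vpow (-2) * qq = 1" "vpow (-2) * (qq * f) = f" "qq * (vpow (-2) * f) = f" "qq * (f * vpow (-2)) = f"
  by (simp_all add: qq_def vpow_add vpow_mult_assoc mult.commute[of f])

text \<open>Left multiplication by the inverse of \<open>T_s\<close>, found by solving the quadratic
  relation.\<close>

definition Li :: "'a \<Rightarrow> ('a list set \<Rightarrow> int fls) \<Rightarrow> 'a list set \<Rightarrow> int fls" where
  "Li s h = (\<lambda>y. vpow (-2) * Lg s h y + (vpow (-2) - 1) * h y)"

lemma Li_sum: "Li s (\<lambda>y. \<Sum>i\<in>I. c i * h i y) = (\<lambda>y. \<Sum>i\<in>I. c i * Li s (h i) y)"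
  unfolding Li_def Lg_sum by (simp add: sum_distrib_left sum.distrib[symmetric] algebra_simps)

lemma Lg_Li:
  assumes "s \<in> S" "fsupp h"
  shows "Lg s (Li s h) = h"
proof -
  have "\<And>w. h w \<noteq> 0 \<Longrightarrow> w \<in> W" using assms by (simp add: fsupp_def)
  from Lg_quadratic[OF assms(1) this] show ?thesis
    unfolding Li_def Lg_lin by (simp add: algebra_simps qq_inv)
qed

lemma Li_Lg:
  assumes "s \<in> S" "fsupp h"
  shows "Li s (Lg s h) = h"
proof -
  have "\<And>w. h w \<noteq> 0 \<Longrightarrow> w \<in> W" using assms by (simp add: fsupp_def)
  from Lg_quadratic[OF assms(1) this] show ?thesis
    unfolding Li_def by (simp add: algebra_simps qq_inv)
qed

lemma Li_Li:
  assumes "s \<in> S" "fsupp h"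
  shows "Li s (Li s h) = (\<lambda>y. (vpow (-2) - 1) * Li s h y + vpow (-2) * h y)"
proof -
  have "Li s (Li s h) = (\<lambda>y. vpow (-2) * Lg s (Li s h) y + (vpow (-2) - 1) * Li s h y)"
    by (simp add: Li_def[of s "Li s h"])
  then show ?thesis by (simp add: Lg_Li[OF assms] add.commute)
qed

lemma fsupp_Li: "fsupp h \<Longrightarrow> s \<in> S \<Longrightarrow> fsupp (Li s h)"
  unfolding Li_def by (intro fsupp_add fsupp_scale fsupp_Lg)

lemma hecke_Li: "is_hecke S m h \<Longrightarrow> s \<in> S \<Longrightarrow> is_hecke S m (Li s h)"
  unfolding Li_def by (intro hecke_add hecke_scale hecke_Lg) simp_all

lemma Rw_lin: "Rw u (\<lambda>y. a * h y + b * g y) = (\<lambda>y. a * Rw u h y + b * Rw u g y)"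
  by (induction u arbitrary: h g) (simp_all add: Rg_lin)

lemma Rw_Li: "s \<in> S \<Longrightarrow> u \<in> lists S \<Longrightarrow> Rw u (Li s h) = Li s (Rw u h)"
proof -
  assume a: "s \<in> S" "u \<in> lists S"
  show ?thesis unfolding Li_def Rw_lin Rw_Lg[OF a] ..
qed

text \<open>The fold runs opposite to that of \<open>Lw\<close>, so that it inverts
  \<open>Lw u\<close>.\<close>

definition Liw where "Liw u h = foldl (\<lambda>h s. Li s h) h u"

lemma Liw_simps [simp]: "Liw [] h = h" "Liw (s # u) h = Liw u (Li s h)"
  by (simp_all add: Liw_def)

lemma hecke_Liw: "is_hecke S m h \<Longrightarrow> u \<in> lists S \<Longrightarrow> is_hecke S m (Liw u h)"
  by (induction u arbitrary: h) (simp_all add: hecke_Li)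

lemma Lw_Liw: "fsupp h \<Longrightarrow> u \<in> lists S \<Longrightarrow> Lw u (Liw u h) = h"
  by (induction u arbitrary: h) (simp_all add: fsupp_Li Lg_Li)

lemma Liw_Lw: "fsupp h \<Longrightarrow> u \<in> lists S \<Longrightarrow> Liw u (Lw u h) = h"
  by (induction u arbitrary: h) (simp_all add: fsupp_Lw Li_Lg)

lemma Rw_Liw: "v \<in> lists S \<Longrightarrow> u \<in> lists S \<Longrightarrow> Rw v (Liw u h) = Liw u (Rw v h)"
  by (induction u arbitrary: h) (simp_all add: Rw_Li)

text \<open>Links the right-handed product with iterated left multiplication: on basis elements both
  sides apply the same commuting operators to \<open>T_e\<close>, in different orders.\<close>

lemma hmul_hT_left:
  assumes u: "red u" and g: "fsupp g"
  shows "hmul S m (hT (cl u)) g = Lw u g"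
proof -
  have ul: "u \<in> lists S" using u by (simp add: red_def)
  have f: "finite {w. g w \<noteq> 0}" using g by (simp add: fsupp_def)
  have "hmul S m (hT (cl u)) g = (\<lambda>y. \<Sum>w\<in>{w. g w \<noteq> 0}. g w * Lw u (hT w) y)"
  proof (subst hmul_eq[OF f])
    have "Rw (red_word w) (hT (cl u)) = Lw u (hT w)" if "g w \<noteq> 0" for w
    proof -
      have w: "w \<in> W" using that g by (simp add: fsupp_def)
      have "Rw (red_word w) (hT (cl u)) = Lw u (Rw (red_word w) (hT (cl [])))"
        unfolding Lw_hT[OF u, symmetric] by (rule Rw_Lw[OF ul red_word_lists[OF w]])
      also have "Rw (red_word w) (hT (cl [])) = hT w" using Rw_hT[of "[]" "red_word w"] red_word_red[OF w] by simp
      finally show ?thesis .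
    qed
    then show "(\<lambda>y. \<Sum>w | g w \<noteq> 0. g w * Rw (red_word w) (hT (cl u)) y) = (\<lambda>y. \<Sum>w | g w \<noteq> 0. g w * Lw u (hT w) y)"
      by simp
  qed simp
  also have "\<dots> = Lw u (\<lambda>y. \<Sum>w\<in>{w. g w \<noteq> 0}. g w * hT w y)" by (rule Lw_sum[symmetric])
  also have "(\<lambda>y. \<Sum>w\<in>{w. g w \<noteq> 0}. g w * hT w y) = g" by (rule hT_expand[OF f, symmetric]) simp
  finally show ?thesis .
qed

text \<open>Uniqueness of the inverse comes from \<open>Liw u\<close> being a left inverse of the
  operator \<open>Lw u\<close>.\<close>

lemma hinv_hT:
  assumes u: "red u"
  shows "hinv S m (hT (cl u)) = Liw u (hT (cl []))"
  unfolding hinv_def one_cl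
proof (rule the_equality)
  have ul: "u \<in> lists S" using u by (simp add: red_def)
  have W: "cl u \<in> W" using ul cl_in_W by simp
  have h: "is_hecke S m (Liw u (hT (cl [])))" using hecke_Liw ul by simp
  then have f: "fsupp (Liw u (hT (cl [])))" by (simp add: is_hecke_iff)
  have "hmul S m (hT (cl u)) (Liw u (hT (cl []))) = hT (cl [])"
    unfolding hmul_hT_left[OF u f] by (rule Lw_Liw) (simp_all only: fsupp_hT one_W ul)
  moreover have "hmul S m (Liw u (hT (cl []))) (hT (cl u)) = hT (cl [])"
  proof -
    let ?r = "red_word (cl u)"
    have r: "red ?r" "cl ?r = cl u" "?r \<in> lists S" using red_word_red[OF W] by (auto simp: red_def)
    have "hmul S m (Liw u (hT (cl []))) (hT (cl u)) = Liw u (Rw ?r (hT (cl [])))"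
      unfolding hmul_hT[OF W] by (rule Rw_Liw[OF r(3) ul])
    also have "Rw ?r (hT (cl [])) = Lw u (hT (cl []))" using Rw_hT[of "[]" ?r] Lw_hT[OF u] r by simp
    finally show ?thesis using Liw_Lw[OF fsupp_hT[OF one_W] ul] by simp
  qed
  ultimately show "is_hecke S m (Liw u (hT (cl []))) \<and>
    hmul S m (hT (cl u)) (Liw u (hT (cl []))) = hT (cl []) \<and> hmul S m (Liw u (hT (cl []))) (hT (cl u)) = hT (cl [])"
    using h by blast
  fix g assume g: "is_hecke S m g \<and> hmul S m (hT (cl u)) g = hT (cl []) \<and> hmul S m g (hT (cl u)) = hT (cl [])"
  then have "fsupp g" by (simp add: is_hecke_iff)
  then have "Lw u g = hT (cl [])" using hmul_hT_left[OF u] g by simp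
  then show "g = Liw u (hT (cl []))" using Liw_Lw[OF \<open>fsupp g\<close> ul] by simp
qed

lemma red_rev: "red u \<Longrightarrow> red (rev u)"
proof -
  assume u: "red u"
  obtain v where v: "cl v = cl (rev u)" "length v = len (cl (rev u))" using len_attained by blast
  have "cl (rev v) = cl u" using cl_rev_cong[OF v(1)] by simp
  then have "length u \<le> length v" using u len_le[of "rev v"] by (simp add: red_def)
  then show ?thesis using u v len_le[of "rev u"] by (auto simp: red_def in_lists_conv_set)
qed

text \<open>The image of \<open>T_w\<close> under the bar involution.\<close>

definition iW :: "'a list set \<Rightarrow> 'a list set \<Rightarrow> int fls" where
  "iW w = hinv S m (hT (cox_inv S m w))"

lemma iW_eq: "red u \<Longrightarrow> iW (cl u) = foldr Li u (hT (cl []))"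
  unfolding iW_def inv_cl hinv_hT[OF red_rev] by (simp add: Liw_def foldr_conv_foldl)

lemma iW_lm:
  assumes "w \<in> W" "s \<in> S" "len w < len (lm s w)"
  shows "iW (lm s w) = Li s (iW w)"
proof -
  obtain u where u: "red u" "cl u = w" by (rule red_exists[OF assms(1)])
  have ul: "u \<in> lists S" using u by (simp add: red_def)
  have e: "lm s w = cl (s # u)" using lm_cl[OF ul assms(2)] u by simp
  have "red (s # u)" using u ul e assms len_lm[OF assms(1,2)] by (auto simp: red_def)
  then show ?thesis using iW_eq[of "s # u"] iW_eq[OF u(1)] e u(2) by simp
qed

lemma iW_one: "iW (cl []) = hT (cl [])"
  using iW_eq[of "[]"] by (simp add: red_def)

lemma W_lm_induct [consumes 1, case_names one lm]:
  assumes "w \<in> W" "P (cl [])" "\<And>s y. s \<in> S \<Longrightarrow> y \<in> W \<Longrightarrow> len y < len (lm s y) \<Longrightarrow> P y \<Longrightarrow> P (lm s y)"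
  shows "P w"
proof -
  have "red u \<Longrightarrow> P (cl u)" for u
  proof (induction u)
    case (Cons s u)
    then have r: "red u" "s \<in> S" "len (cl u) < len (lm s (cl u))" using red_Cons by blast+
    then have ul: "u \<in> lists S" by (simp add: red_def)
    then show ?case using assms(3)[OF r(2) cl_in_W[OF ul] r(3) Cons.IH[OF r(1)]] lm_cl[OF ul r(2)] by simp
  qed (rule assms(2))
  moreover obtain u where "red u" "cl u = w" by (rule red_exists[OF assms(1)])
  ultimately show ?thesis by blast
qed

lemma iW_hecke: "w \<in> W \<Longrightarrow> is_hecke S m (iW w)"
  by (induction rule: W_lm_induct) (simp_all add: iW_one iW_lm hecke_Li)

text \<open>Triangularity with respect to length is enough for the uniqueness of Kazhdan-Lusztig
  elements.\<close>

lemma iW_leading: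
  "w \<in> W \<Longrightarrow> (\<forall>x. iW w x \<noteq> 0 \<longrightarrow> len x < len w \<or> x = w) \<and> iW w w = vpow (- 2 * int (len w))"
proof (induction rule: W_lm_induct)
  case one
  then show ?case by (simp add: iW_one hT_def)
next
  case (lm s y)
  have l: "len (lm s y) = Suc (len y)" using len_lm[OF lm(2,1)] lm(3) by simp
  have e: "iW (lm s y) x = vpow (-2) * Lg s (iW y) x + (vpow (-2) - 1) * iW y x" for x
    using iW_lm[OF lm(2,1,3)] by (simp add: Li_def)
  have "len x < len (lm s y) \<or> x = lm s y" if "iW (lm s y) x \<noteq> 0" for x
  proof -
    have "Lg s (iW y) x \<noteq> 0 \<or> iW y x \<noteq> 0" using that e[of x] by auto
    then have "iW y x \<noteq> 0 \<or> x \<in> W \<and> iW y (lm s x) \<noteq> 0" using Lg_support[OF lm(1)] by blast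
    then show ?thesis
    proof
      assume "iW y x \<noteq> 0"
      then show ?thesis using lm(4) l by auto
    next
      assume x: "x \<in> W \<and> iW y (lm s x) \<noteq> 0"
      then have "len (lm s x) < len y \<or> lm s x = y" using lm(4) by blast
      then show ?thesis using len_lm[of x s] x lm(1) l by auto
    qed
  qed
  moreover have "iW (lm s y) (lm s y) = vpow (- 2 * int (len (lm s y)))"
  proof -
    have z: "iW y (lm s y) = 0" using lm(4) l by (metis less_irrefl not_less_iff_gr_or_eq Suc_n_not_le_n lessI less_imp_le)
    have "Lg s (iW y) (lm s y) = iW y y" using lm(1,2,3) z by (simp add: Lg_def)
    then show ?thesis unfolding e z using lm(4) l by (simp add: vpow_add)
  qed
  ultimately show ?case by blast
qed

lemma hiota_eq:
  assumes "finite A" "\<And>w. h w \<noteq> 0 \<Longrightarrow> w \<in> A"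
  shows "hiota S m h = (\<lambda>y. \<Sum>w\<in>A. lbar (h w) * iW w y)"
proof
  fix y
  show "hiota S m h y = (\<Sum>w\<in>A. lbar (h w) * iW w y)"
    unfolding hiota_def iW_def by (rule sum.mono_neutral_left) (use assms in auto)
qed

lemma hiota_add:
  assumes "is_hecke S m h" "is_hecke S m g"
  shows "hiota S m (\<lambda>y. h y + g y) = (\<lambda>y. hiota S m h y + hiota S m g y)"
proof -
  let ?A = "{w. h w \<noteq> 0} \<union> {w. g w \<noteq> 0}"
  have A: "finite ?A" using assms by (simp add: is_hecke_iff fsupp_def)
  show ?thesis
    by (simp add: hiota_eq[OF A, of h] hiota_eq[OF A, of g])
      (subst hiota_eq[OF A], use assms in \<open>auto simp: is_hecke_iff lbar_add distrib_right sum.distrib\<close>)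
qed

lemma hiota_vpow:
  assumes "is_hecke S m h"
  shows "hiota S m (\<lambda>y. vpow i * h y) = (\<lambda>y. vpow (- i) * hiota S m h y)"
proof -
  have A: "finite {w. h w \<noteq> 0}" using assms by (simp add: is_hecke_iff fsupp_def)
  show ?thesis
    by (subst (1 2) hiota_eq[OF A])
      (use assms in \<open>auto simp: is_hecke_iff lbar_vpow_mult sum_distrib_left mult.assoc\<close>)
qed

lemma hiota_const:
  assumes "is_hecke S m h"
  shows "hiota S m (\<lambda>y. fls_const c * h y) = (\<lambda>y. fls_const c * hiota S m h y)"
proof -
  have A: "finite {w. h w \<noteq> 0}" using assms by (simp add: is_hecke_iff fsupp_def)
  show ?thesis
    by (subst (1 2) hiota_eq[OF A])
      (use assms in \<open>auto simp: is_hecke_iff lbar_const_mult sum_distrib_left mult.assoc\<close>)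
qed

text \<open>Groups \<open>w\<close> with \<open>s w\<close>, because left multiplication by
  \<open>T_s\<close> acts within each such pair.\<close>

lemma sum_pairs:
  fixes g :: "'a list set \<Rightarrow> int fls"
  assumes "finite A" "A \<subseteq> W" "s \<in> S" "lm s ` A \<subseteq> A"
  shows "(\<Sum>w\<in>A. g w) = (\<Sum>w\<in>{w \<in> A. len w < len (lm s w)}. g w + g (lm s w))"
proof -
  let ?U = "{w \<in> A. len w < len (lm s w)}" and ?D = "{w \<in> A. \<not> len w < len (lm s w)}"
  have D: "?D = lm s ` ?U"
  proof
    show "?D \<subseteq> lm s ` ?U"
    proof
      fix w assume w: "w \<in> ?D"
      then have wW: "w \<in> W" using assms by auto
      then have "lm s w \<in> ?U" "w = lm s (lm s w)" using w assms len_lm[OF wW assms(3)] by auto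
      then show "w \<in> lm s ` ?U" by blast
    qed
    show "lm s ` ?U \<subseteq> ?D" using assms by auto
  qed
  have inj: "inj_on (lm s) ?U"
    by (rule inj_on_inverseI[of _ "lm s"]) (use assms in auto)
  have "(\<Sum>w\<in>A. g w) = (\<Sum>w\<in>?U \<union> ?D. g w)" by (rule sum.cong) auto
  also have "\<dots> = (\<Sum>w\<in>?U. g w) + (\<Sum>w\<in>?D. g w)" by (rule sum.union_disjoint) (use assms in auto)
  also have "(\<Sum>w\<in>?D. g w) = (\<Sum>w\<in>?U. g (lm s w))" unfolding D using sum.reindex[OF inj, of g] by simp
  finally show ?thesis by (simp add: sum.distrib)
qed

text \<open>Multiplicativity of the involution, one generator at a time; on a pair \<open>w\<close>,
  \<open>s w\<close> it reduces to the quadratic relation for the inverse of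
  \<open>T_s\<close>.\<close>

lemma hiota_Lg:
  assumes h: "is_hecke S m h" and s: "s \<in> S"
  shows "hiota S m (Lg s h) = Li s (hiota S m h)"
proof -
  define A where "A = {w. h w \<noteq> 0} \<union> lm s ` {w. h w \<noteq> 0}"
  have hW: "\<And>w. h w \<noteq> 0 \<Longrightarrow> w \<in> W" using h by (simp add: is_hecke_iff fsupp_def)
  have A: "finite A" "A \<subseteq> W" "lm s ` A \<subseteq> A"
    using h s hW by (auto simp: A_def is_hecke_iff fsupp_def)
  have la: "laurent (h w)" for w using h by (simp add: is_hecke_iff)
  have supp: "w \<in> A" if "Lg s h w \<noteq> 0" for w
  proof -
    have w: "w \<in> W" "h w \<noteq> 0 \<or> h (lm s w) \<noteq> 0" using Lg_support[OF s that] by auto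
    have "w \<in> lm s ` {w. h w \<noteq> 0}" if "h (lm s w) \<noteq> 0"
      by (rule image_eqI[of _ _ "lm s w"]) (use that w s in simp_all)
    then show ?thesis unfolding A_def using w by blast
  qed
  have "hiota S m (Lg s h) y = Li s (hiota S m h) y" for y
  proof -
    have "hiota S m (Lg s h) y = (\<Sum>w\<in>A. lbar (Lg s h w) * iW w y)"
      by (subst hiota_eq[OF A(1)]) (use supp in auto)
    also have "\<dots> = (\<Sum>w\<in>{w \<in> A. len w < len (lm s w)}. lbar (Lg s h w) * iW w y + lbar (Lg s h (lm s w)) * iW (lm s w) y)"
      by (rule sum_pairs[OF A(1,2) s A(3)])
    also have "\<dots> = (\<Sum>w\<in>{w \<in> A. len w < len (lm s w)}. lbar (h w) * Li s (iW w) y + lbar (h (lm s w)) * Li s (iW (lm s w)) y)"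
    proof (rule sum.cong)
      fix w assume "w \<in> {w \<in> A. len w < len (lm s w)}"
      then have w: "w \<in> W" "len w < len (lm s w)" using A by auto
      have i1: "iW (lm s w) = Li s (iW w)" by (rule iW_lm[OF w(1) s w(2)])
      have i2: "Li s (iW (lm s w)) y = (vpow (-2) - 1) * iW (lm s w) y + vpow (-2) * iW w y"
        unfolding i1 using Li_Li[OF s, of "iW w"] iW_hecke[OF w(1)] by (simp add: is_hecke_iff)
      have l1: "Lg s h w = qq * h (lm s w)" using w s by (simp add: Lg_def)
      have l2: "Lg s h (lm s w) = h w + (qq * h (lm s w) - h (lm s w))" using w s by (simp add: Lg_def algebra_simps)
      have b1: "lbar (Lg s h w) = vpow (-2) * lbar (h (lm s w))"
        unfolding l1 qq_def by (rule lbar_vpow_mult[OF la])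
      have b2: "lbar (Lg s h (lm s w)) = lbar (h w) + (vpow (-2) * lbar (h (lm s w)) - lbar (h (lm s w)))"
        unfolding l2 using la by (simp add: lbar_add lbar_diff qq_def lbar_vpow_mult)
      show "lbar (Lg s h w) * iW w y + lbar (Lg s h (lm s w)) * iW (lm s w) y =
          lbar (h w) * Li s (iW w) y + lbar (h (lm s w)) * Li s (iW (lm s w)) y"
        unfolding b1 b2 i2 i1[symmetric] by (simp add: algebra_simps)
    qed simp
    also have "\<dots> = (\<Sum>w\<in>A. lbar (h w) * Li s (iW w) y)"
      by (rule sum_pairs[OF A(1,2) s A(3), symmetric])
    also have "\<dots> = Li s (hiota S m h) y"
      by (subst hiota_eq[OF A(1)]) (auto simp: A_def Li_sum)
    finally show ?thesis .
  qed
  then show ?thesis by blast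
qed


subsection \<open>Kazhdan--Lusztig elements\<close>

text \<open>The coefficients are \<open>q^(-l(w)/2) P_(x,w)\<close>; the degree bound on
  \<open>P\<close> and its being a polynomial in \<open>q\<close> become bounds and a parity
  condition on exponents of \<open>q^(1/2)\<close>.\<close>

definition is_KL :: "'a list set \<Rightarrow> ('a list set \<Rightarrow> int fls) \<Rightarrow> bool" where
  "is_KL w h \<longleftrightarrow> is_hecke S m h \<and> hiota S m h = h \<and> (\<forall>x. h x \<noteq> 0 \<longrightarrow> ble x w) \<and>
     h w = vpow (- int (len w)) \<and>
     (\<forall>x n. x \<noteq> w \<longrightarrow> fls_nth (h x) n \<noteq> 0 \<longrightarrow>
        - int (len w) \<le> n \<and> n \<le> - int (len x) - 1 \<and> even (n + int (len w)))"

text \<open>At a longest \<open>x\<close> of the support only the leading term contributes, so the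
  exponents of \<open>g x\<close> are symmetric about \<open>- len x\<close>, while the bound puts
  all of them below.\<close>

lemma hiota_fixed_zero:
  assumes g: "is_hecke S m g" "hiota S m g = g"
    and neg: "\<And>x n. fls_nth (g x) n \<noteq> 0 \<Longrightarrow> n \<le> - int (len x) - 1"
  shows "g = (\<lambda>_. 0)"
proof (rule ccontr)
  assume "g \<noteq> (\<lambda>_. 0)"
  then have ne: "{w. g w \<noteq> 0} \<noteq> {}" by auto
  have fin: "finite {w. g w \<noteq> 0}" and gW: "\<And>w. g w \<noteq> 0 \<Longrightarrow> w \<in> W" and la: "\<And>w. laurent (g w)"
    using g(1) by (auto simp: is_hecke_iff fsupp_def)
  obtain x where x: "g x \<noteq> 0" and mx: "\<And>y. g y \<noteq> 0 \<Longrightarrow> len y \<le> len x"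
  proof -
    have "Max (len ` {w. g w \<noteq> 0}) \<in> len ` {w. g w \<noteq> 0}" by (rule Max_in) (use fin ne in auto)
    then obtain x where "g x \<noteq> 0" "len x = Max (len ` {w. g w \<noteq> 0})" by auto
    then show thesis using that[of x] fin by simp
  qed
  have "g x = hiota S m g x" using g(2) by simp
  also have "\<dots> = (\<Sum>w\<in>{w. g w \<noteq> 0}. lbar (g w) * iW w x)"
    by (subst hiota_eq[OF fin]) simp_all
  also have "\<dots> = (\<Sum>w\<in>{w. g w \<noteq> 0}. if w = x then lbar (g x) * vpow (- 2 * int (len x)) else 0)"
  proof (rule sum.cong)
    fix w assume w: "w \<in> {w. g w \<noteq> 0}"
    show "lbar (g w) * iW w x = (if w = x then lbar (g x) * vpow (- 2 * int (len x)) else 0)"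
      using iW_leading[OF gW[of w]] w mx[of w] by (auto simp: not_less[symmetric])
  qed simp
  also have "\<dots> = vpow (- 2 * int (len x)) * lbar (g x)" using fin x by (simp add: mult.commute)
  finally have e: "g x = vpow (- 2 * int (len x)) * lbar (g x)" .
  obtain n where n: "fls_nth (g x) n \<noteq> 0" using x by (metis fls_eqI fls_zero_nth)
  have "fls_nth (g x) n = fls_nth (g x) (- (n + 2 * int (len x)))"
    by (subst e) (simp add: lbar_nth[OF la])
  then have "- (n + 2 * int (len x)) \<le> - int (len x) - 1" using n neg by metis
  then show False using neg[OF n] by simp
qed

lemma is_KL_unique:
  assumes h: "is_KL w h" and g: "is_KL w g"
  shows "h = g"
proof -
  have hk: "is_hecke S m h" "is_hecke S m g" using assms by (simp_all add: is_KL_def)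
  have gm: "is_hecke S m (\<lambda>y. fls_const (-1) * g y)" by (rule hecke_scale[OF hk(2)]) simp
  have "(\<lambda>y. h y + fls_const (-1) * g y) = (\<lambda>_. 0)"
  proof (rule hiota_fixed_zero)
    show "is_hecke S m (\<lambda>y. h y + fls_const (-1) * g y)" by (rule hecke_add[OF hk(1) gm])
    show "hiota S m (\<lambda>y. h y + fls_const (-1) * g y) = (\<lambda>y. h y + fls_const (-1) * g y)"
      unfolding hiota_add[OF hk(1) gm] hiota_const[OF hk(2)] using assms by (simp add: is_KL_def)
    fix x n assume n: "fls_nth (h x + fls_const (-1) * g x) n \<noteq> 0"
    have hg: "h w = g w" using assms by (simp add: is_KL_def)
    have "x \<noteq> w"
    proof
      assume "x = w"
      then show False using n unfolding \<open>x = w\<close> hg by simp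
    qed
    moreover have "fls_nth (h x) n \<noteq> 0 \<or> fls_nth (g x) n \<noteq> 0"
    proof (rule ccontr)
      assume "\<not> ?thesis"
      then show False using n by simp
    qed
    moreover have "n \<le> - int (len x) - 1" if "is_KL w f" "x \<noteq> w" "fls_nth (f x) n \<noteq> 0" for f
      using that unfolding is_KL_def by blast
    ultimately show "n \<le> - int (len x) - 1" using h g by metis
  qed
  then show ?thesis by (simp add: fun_eq_iff)
qed

lemma is_KL_one: "is_KL (cl []) (hT (cl []))"
proof -
  have "hiota S m (hT (cl [])) = hT (cl [])"
    by (subst hiota_eq[of "{cl []}"]) (auto simp: hT_def iW_one split: if_splits)
  then show ?thesis unfolding is_KL_def by (simp add: hT_def[of "cl []"]) (use hecke_hT[OF one_W] in \<open>simp add: hT_def\<close>)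
qed

lemma hiota_sum:
  assumes "finite I" "\<And>i. i \<in> I \<Longrightarrow> is_hecke S m (h i)"
  shows "is_hecke S m (\<lambda>y. \<Sum>i\<in>I. h i y) \<and> hiota S m (\<lambda>y. \<Sum>i\<in>I. h i y) = (\<lambda>y. \<Sum>i\<in>I. hiota S m (h i) y)"
  using assms
proof (induction I rule: finite_induct)
  case empty
  then show ?case by (simp add: hiota_def is_hecke_def)
next
  case (insert i I)
  then have 1: "is_hecke S m (h i)" "is_hecke S m (\<lambda>y. \<Sum>i\<in>I. h i y)"
    "hiota S m (\<lambda>y. \<Sum>i\<in>I. h i y) = (\<lambda>y. \<Sum>i\<in>I. hiota S m (h i) y)" by simp_all
  show ?case using hecke_add[OF 1(1,2)] hiota_add[OF 1(1,2)] 1(3) insert.hyps by simp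
qed

text \<open>The classical recursion: multiply the element for \<open>y\<close> by the one for
  \<open>s\<close> and subtract multiples of shorter elements with left descent \<open>s\<close>.
  All these terms are eigenvectors of \<open>T_s\<close> with eigenvalue \<open>q\<close>, hence so
  is the result.\<close>

lemma KL_step:
  assumes y: "y \<in> W" and s: "s \<in> S" and up: "len y < len (lm s y)"
    and K: "\<And>z. z \<in> W \<Longrightarrow> len z \<le> len y \<Longrightarrow> is_KL z (K z)"
    and KT: "\<And>z. z \<in> W \<Longrightarrow> len z \<le> len y \<Longrightarrow> len (lm s z) < len z \<Longrightarrow> Lg s (K z) = (\<lambda>x. qq * K z x)"
  obtains h where "is_KL (lm s y) h" "Lg s h = (\<lambda>x. qq * h x)"
proof
  define w where "w = lm s y"
  have w: "w \<in> W" "len w = Suc (len y)" "lm s w = y" using y s up len_lm[OF y s] by (auto simp: w_def)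
  define k where "k = K y"
  have k: "is_KL y k" using K y by (simp add: k_def)
  then have kh: "is_hecke S m k" and ki: "hiota S m k = k" and ks: "\<And>x. k x \<noteq> 0 \<Longrightarrow> ble x y"
    and ky: "k y = vpow (- int (len y))"
    and kd: "\<And>x n. x \<noteq> y \<Longrightarrow> fls_nth (k x) n \<noteq> 0 \<Longrightarrow> - int (len y) \<le> n \<and> n \<le> - int (len x) - 1 \<and> even (n + int (len y))"
    unfolding is_KL_def by blast+
  have kW: "k x = 0" if "x \<notin> W" for x using ks ble_W that by blast
  \<comment> \<open>\<open>vpow (-1)\<close> times \<open>T_s + 1\<close> is the Kazhdan-Lusztig
    element of \<open>s\<close>.\<close>
  define X where "X = (\<lambda>x. vpow (-1) * (Lg s k x + k x))"
  define Z where "Z = {z. k z \<noteq> 0 \<and> z \<noteq> y \<and> len (lm s z) < len z}"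
  \<comment> \<open>The coefficient at the largest exponent that the degree bound permits.\<close>
  define \<mu> where "\<mu> z = fls_nth (k z) (- int (len z) - 1)" for z
  define h where "h = (\<lambda>x. X x + (\<Sum>z\<in>Z. fls_const (- \<mu> z) * K z x))"
  have Zf: "finite Z" by (rule finite_subset[of _ "{z. k z \<noteq> 0}"]) (use kh in \<open>auto simp: Z_def is_hecke_def\<close>)
  have Zp: "z \<in> W \<and> len z < len y \<and> ble z y \<and> is_KL z (K z) \<and> len (lm s z) < len z" if "z \<in> Z" for z
  proof -
    have b: "ble z y" "z \<noteq> y" "len (lm s z) < len z" using that ks by (auto simp: Z_def)
    then have "len z < len y" "z \<in> W" using ble_len ble_W by blast+
    then show ?thesis using b K[of z] by simp
  qed
  have Kh: "is_hecke S m (K z)" "hiota S m (K z) = K z" "\<And>x. K z x \<noteq> 0 \<Longrightarrow> ble x z"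
    "K z z = vpow (- int (len z))"
    "\<And>x n. x \<noteq> z \<Longrightarrow> fls_nth (K z x) n \<noteq> 0 \<Longrightarrow> - int (len z) \<le> n \<and> n \<le> - int (len x) - 1 \<and> even (n + int (len z))"
    if "z \<in> Z" for z using Zp[OF that] unfolding is_KL_def by blast+
  have Lk: "is_hecke S m (Lg s k)" "is_hecke S m (\<lambda>x. Lg s k x + k x)" using hecke_Lg[OF kh s] hecke_add kh by blast+
  have Xh: "is_hecke S m X" unfolding X_def by (rule hecke_scale[OF Lk(2)]) simp
  have Xi: "hiota S m X = X"
  proof -
    have e: "vpow 1 * (vpow (-2) * a + (vpow (-2) - 1) * b + b) = vpow (-1) * (a + b)" for a b
    proof -
      have "vpow (-2) * a + (vpow (-2) - 1) * b + b = vpow (-2) * (a + b)" by (simp add: algebra_simps)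
      then show ?thesis by (simp add: vpow_mult_assoc)
    qed
    show ?thesis
      unfolding X_def hiota_vpow[OF Lk(2)] hiota_add[OF Lk(1) kh] hiota_Lg[OF kh s] ki Li_def by (simp add: e)
  qed
  have th: "is_hecke S m (\<lambda>x. fls_const (- \<mu> z) * K z x)" if "z \<in> Z" for z
    by (rule hecke_scale[OF Kh(1)[OF that]]) simp
  define Q where "Q = (\<lambda>x. \<Sum>z\<in>Z. fls_const (- \<mu> z) * K z x)"
  have Qh: "is_hecke S m Q" and Qi: "hiota S m Q = Q"
  proof -
    have 1: "is_hecke S m Q \<and> hiota S m Q = (\<lambda>y. \<Sum>z\<in>Z. hiota S m (\<lambda>x. fls_const (- \<mu> z) * K z x) y)"
      unfolding Q_def by (rule hiota_sum[OF Zf th])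
    then show "is_hecke S m Q" by blast
    have "(\<Sum>z\<in>Z. hiota S m (\<lambda>x. fls_const (- \<mu> z) * K z x) y) = Q y" for y
      unfolding Q_def by (rule sum.cong[OF refl]) (simp only: hiota_const[OF Kh(1)] Kh(2))
    then show "hiota S m Q = Q" using 1 by simp
  qed
  have yw: "ble y w" unfolding w_def by (rule bedge_lm[OF y s up])
  have Xs: "ble x w" if "X x \<noteq> 0" for x
  proof -
    have "Lg s k x \<noteq> 0 \<or> k x \<noteq> 0" using that by (auto simp: X_def)
    then have "k x \<noteq> 0 \<or> x \<in> W \<and> k (lm s x) \<noteq> 0" using Lg_support[OF s] by blast
    then show ?thesis
    proof
      assume "k x \<noteq> 0"
      then show ?thesis using ks yw ble_trans by blast
    next
      assume x: "x \<in> W \<and> k (lm s x) \<noteq> 0"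
      then have "ble (lm s (lm s x)) y \<or> ble (lm s (lm s x)) (lm s y)" using ble_lm_cases[OF ks s] by blast
      then show ?thesis using x s yw ble_trans by (auto simp: w_def)
    qed
  qed
  have Kw: "K z w = 0" if "z \<in> Z" for z
  proof (rule ccontr)
    assume "K z w \<noteq> 0"
    then have "ble w z" using Kh(3)[OF that] by blast
    then have "len w \<le> len z" using ble_len by fastforce
    then show False using Zp[OF that] w by simp
  qed
  have kw: "k w = 0"
  proof (rule ccontr)
    assume "k w \<noteq> 0"
    then show False using ks ble_len w by fastforce
  qed
  have Xdown: "X x = vpow (-1) * k (lm s x) + vpow 1 * k x" if "x \<in> W" "len (lm s x) < len x" for x
    using that by (simp add: X_def Lg_def algebra_simps qq_def vpow_mult_assoc vpow_add)
  have Xup: "X x = vpow 1 * k (lm s x) + vpow (-1) * k x" if "x \<in> W" "\<not> len (lm s x) < len x" for x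
    using that by (simp add: X_def Lg_def algebra_simps qq_def vpow_mult_assoc vpow_add)
  have hw: "h w = vpow (- int (len w))"
    unfolding h_def using Xdown[OF w(1)] w kw ky Kw by (simp add: vpow_add)
  have hx: "fls_nth (h x) n = fls_nth (X x) n - (\<Sum>z\<in>Z. \<mu> z * fls_nth (K z x) n)" for x n
    unfolding h_def by (simp add: fls_nth_sum sum_negf)
  have deg: "- int (len w) \<le> n \<and> n \<le> - int (len x) - 1 \<and> even (n + int (len w))"
    if x: "x \<in> W" "x \<noteq> w" and n: "fls_nth (h x) n \<noteq> 0" for x n
  proof -
    have Zdeg: "- int (len w) \<le> n \<and> n \<le> - int (len x) - 1 \<and> even (n + int (len w))"
      if z: "z \<in> Z" "z \<noteq> x" "\<mu> z * fls_nth (K z x) n \<noteq> 0" for z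
    proof -
      have "fls_nth (k z) (- int (len z) - 1) \<noteq> 0" using z(3) by (auto simp: \<mu>_def)
      moreover have "z \<noteq> y" using z(1) by (simp add: Z_def)
      ultimately have "even (- int (len z) - 1 + int (len y))" using kd by blast
      moreover have "- int (len z) \<le> n \<and> n \<le> - int (len x) - 1 \<and> even (n + int (len z))"
        using Kh(5)[OF z(1), of x n] z by auto
      moreover have "len z < len y" using Zp z(1) by blast
      ultimately show ?thesis using w(2) by (auto simp: even_add even_diff)
    qed
    show ?thesis
    proof (cases "\<exists>z\<in>Z. z \<noteq> x \<and> \<mu> z * fls_nth (K z x) n \<noteq> 0")
      case True
      then show ?thesis using Zdeg by blast
    next
      case noZ: False
      have sumx: "(\<Sum>z\<in>Z. \<mu> z * fls_nth (K z x) n) = (if x \<in> Z then \<mu> x * fls_nth (K x x) n else 0)"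
      proof -
        have "(\<Sum>z\<in>Z. \<mu> z * fls_nth (K z x) n) = (\<Sum>z\<in>Z. if z = x then \<mu> x * fls_nth (K x x) n else 0)"
          by (rule sum.cong) (use noZ in auto)
        then show ?thesis using Zf by simp
      qed
      show ?thesis
      proof (cases "len (lm s x) < len x")
        case True
        then have lx: "len x = Suc (len (lm s x))" using len_lm[OF x(1) s] by simp
        have xy: "x \<noteq> y" using True up by auto
        have sxy: "lm s x \<noteq> y" using x s by (auto simp: w_def)
        have Xn: "fls_nth (X x) n = fls_nth (k (lm s x)) (n + 1) + fls_nth (k x) (n - 1)"
          using Xdown[OF x(1) True] by simp
        have Kxx: "x \<in> Z \<Longrightarrow> fls_nth (K x x) n = (if n = - int (len x) then 1 else 0)"
          using Kh(4) by (simp add: vpow_nth)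
        \<comment> \<open>The only exponent at which \<open>X x\<close> can violate the bound. Its
          coefficient there is \<open>\<mu> x\<close>, and subtracting \<open>\<mu> x\<close> times
          \<open>K x\<close> removes it.\<close>
        have nx: "n \<noteq> - int (len x)"
        proof
          assume n0: "n = - int (len x)"
          have "fls_nth (k (lm s x)) (n + 1) = 0"
            using kd[OF sxy, of "n + 1"] lx n0 by auto
          then have X0: "fls_nth (X x) n = \<mu> x" unfolding Xn by (simp add: \<mu>_def n0)
          show False
          proof (cases "x \<in> Z")
            case True
            then have "fls_nth (K x x) n = 1" using Kxx n0 by simp
            then show False using n X0 True unfolding hx sumx by simp
          next
            case False
            then have "k x = 0" using xy \<open>len (lm s x) < len x\<close> by (auto simp: Z_def)
            then show False using n X0 False unfolding hx sumx by (simp add: \<mu>_def)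
          qed
        qed
        then have "fls_nth (X x) n \<noteq> 0" using n unfolding hx sumx by (auto simp: Kxx split: if_splits)
        then have "fls_nth (k (lm s x)) (n + 1) \<noteq> 0 \<or> fls_nth (k x) (n - 1) \<noteq> 0"
          unfolding Xn by (metis add_0)
        then consider "fls_nth (k (lm s x)) (n + 1) \<noteq> 0" | "fls_nth (k x) (n - 1) \<noteq> 0" by blast
        then show ?thesis
        proof cases
          case 1
          then show ?thesis using kd[OF sxy 1] lx w(2) by auto
        next
          case 2
          then show ?thesis using kd[OF xy 2] nx w(2) by auto
        qed
      next
        case False
        then have lx: "len (lm s x) = Suc (len x)" using len_lm[OF x(1) s] by auto
        have "x \<notin> Z" using False by (auto simp: Z_def)
        then have "fls_nth (X x) n \<noteq> 0" using n unfolding hx sumx by simp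
        moreover have "fls_nth (X x) n = fls_nth (k (lm s x)) (n - 1) + fls_nth (k x) (n + 1)"
          using Xup[OF x(1) False] by simp
        ultimately have "fls_nth (k (lm s x)) (n - 1) \<noteq> 0 \<or> fls_nth (k x) (n + 1) \<noteq> 0"
          by (metis add_0)
        then consider "fls_nth (k (lm s x)) (n - 1) \<noteq> 0" | "fls_nth (k x) (n + 1) \<noteq> 0" by blast
        then show ?thesis
        proof cases
          case 1
          have "lm s x \<noteq> y" using x s by (auto simp: w_def)
          from kd[OF this 1] show ?thesis using lx w(2) by auto
        next
          case 2
          show ?thesis
          proof (cases "x = y")
            case True
            then have "n + 1 = - int (len y)" using 2 ky by (auto simp: vpow_nth split: if_splits)
            then have "n = - int (len y) - 1" by simp
            then show ?thesis using True w(2) by auto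
          next
            case False
            from kd[OF False 2] show ?thesis using w(2) by auto
          qed
        qed
      qed
    qed
  qed
  have hs0: "ble x w" if "h x \<noteq> 0" for x
  proof (cases "X x = 0")
    case True
    then have "(\<Sum>z\<in>Z. fls_const (- \<mu> z) * K z x) \<noteq> 0" using that by (simp add: h_def)
    then obtain z where "z \<in> Z" "fls_const (- \<mu> z) * K z x \<noteq> 0" by (rule sum.not_neutral_contains_not_neutral)
    then have "ble x z" "ble z y" using Kh(3) Zp by auto
    then show ?thesis using yw ble_trans by blast
  qed (use Xs in blast)
  have "is_KL w h"
    unfolding is_KL_def
  proof (intro conjI allI impI)
    show "is_hecke S m h" using hecke_add[OF Xh Qh] by (simp add: h_def Q_def)
    have "h = (\<lambda>x. X x + Q x)" by (simp add: h_def Q_def)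
    then show "hiota S m h = h" using hiota_add[OF Xh Qh] Xi Qi by simp
    show "ble x w" if "h x \<noteq> 0" for x by (rule hs0[OF that])
    show "h w = vpow (- int (len w))" by (rule hw)
    fix x n assume x: "x \<noteq> w" "fls_nth (h x) n \<noteq> 0"
    then have "h x \<noteq> 0" by auto
    then have "x \<in> W" using hs0 ble_W by blast
    from deg[OF this x] show "- int (len w) \<le> n" "n \<le> - int (len x) - 1" "even (n + int (len w))" by auto
  qed
  then show "is_KL (lm s y) h" by (simp add: w_def)
  show "Lg s h = (\<lambda>x. qq * h x)"
  proof -
    have kW': "\<And>w. k w \<noteq> 0 \<Longrightarrow> w \<in> W" using kW by blast
    have LX: "Lg s X = (\<lambda>x. qq * X x)"
    proof -
      have e: "X = (\<lambda>x. vpow (-1) * Lg s k x + vpow (-1) * k x)" unfolding X_def by (simp add: distrib_left)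
      have q: "Lg s (Lg s k) = (\<lambda>x. (qq - 1) * Lg s k x + qq * k x)" by (rule Lg_quadratic[OF s kW'])
      have "Lg s X = (\<lambda>x. vpow (-1) * Lg s (Lg s k) x + vpow (-1) * Lg s k x)" unfolding e by (rule Lg_lin)
      then show ?thesis unfolding q by (simp add: e algebra_simps)
    qed
    have LK: "Lg s (K z) = (\<lambda>x. qq * K z x)" if "z \<in> Z" for z
      by (rule KT) (use Zp[OF that] in simp_all)
    have "Lg s h = (\<lambda>x. Lg s X x + (\<Sum>z\<in>Z. fls_const (- \<mu> z) * Lg s (K z) x))"
    proof -
      have "Lg s h = (\<lambda>x. 1 * Lg s X x + 1 * Lg s (\<lambda>x. \<Sum>z\<in>Z. fls_const (- \<mu> z) * K z x) x)"
        unfolding Lg_lin[symmetric] h_def by simp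
      then show ?thesis unfolding Lg_sum by simp
    qed
    also have "\<dots> = (\<lambda>x. qq * h x)"
      unfolding LX h_def by (rule ext) (simp add: distrib_left sum_distrib_left LK mult.left_commute)
    finally show ?thesis .
  qed
qed

text \<open>The construction uses one left descent, but by uniqueness every left descent leads to
  the same element, which is therefore an eigenvector for all of them.\<close>

theorem KL_exists:
  assumes "w \<in> W"
  shows "\<exists>h. is_KL w h \<and> (\<forall>s\<in>S. len (lm s w) < len w \<longrightarrow> Lg s h = (\<lambda>x. qq * h x))"
  using assms
proof (induction "len w" arbitrary: w rule: less_induct)
  case less
  define K where "K z = (SOME h. is_KL z h \<and> (\<forall>s\<in>S. len (lm s z) < len z \<longrightarrow> Lg s h = (\<lambda>x. qq * h x)))" for z
  have K: "is_KL z (K z) \<and> (\<forall>s\<in>S. len (lm s z) < len z \<longrightarrow> Lg s (K z) = (\<lambda>x. qq * K z x))"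
    if "z \<in> W" "len z < len w" for z
    unfolding K_def by (rule someI_ex[OF less.hyps[OF that(2,1)]])
  have step: "\<exists>h. is_KL w h \<and> Lg s h = (\<lambda>x. qq * h x)" if s: "s \<in> S" "len (lm s w) < len w" for s
  proof -
    have y: "lm s w \<in> W" "lm s (lm s w) = w" using less.prems s by simp_all
    obtain h where "is_KL (lm s (lm s w)) h" "Lg s h = (\<lambda>x. qq * h x)"
      by (rule KL_step[OF y(1) s(1), of K]) (use K s y in auto)
    then show ?thesis using y by auto
  qed
  show ?case
  proof (cases "w = cl []")
    case True
    then show ?thesis using is_KL_one by (intro exI[of _ "hT (cl [])"]) simp
  next
    case False
    obtain u where u: "red u" "cl u = w" by (rule red_exists[OF less.prems])
    then obtain s p where sp: "u = s # p" using False by (cases u) auto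
    have "s \<in> S" "red p" "len (cl p) < len (lm s (cl p))" using red_Cons u sp by blast+
    moreover have "p \<in> lists S" using \<open>red p\<close> by (simp add: red_def)
    ultimately have "lm s (cl p) = w" "cl p \<in> W" using lm_cl u sp cl_in_W by simp_all
    then have "lm s w = cl p" using lm_lm[of "cl p" s] \<open>s \<in> S\<close> by metis
    then have "len (lm s w) < len w" using \<open>len (cl p) < _\<close> \<open>lm s (cl p) = w\<close> by simp
    then obtain h where h: "is_KL w h" using step \<open>s \<in> S\<close> by blast
    have "Lg t h = (\<lambda>x. qq * h x)" if t: "t \<in> S" "len (lm t w) < len w" for t
    proof -
      obtain g where "is_KL w g" "Lg t g = (\<lambda>x. qq * g x)" using step[OF t] by blast
      then show ?thesis using is_KL_unique[OF h] by metis
    qed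
    then show ?thesis using h by blast
  qed
qed

text \<open>Resolves the definite description in \<open>P_fam\<close>: any competitor, rescaled, is
  again a Kazhdan-Lusztig element, and these are unique.\<close>

lemma Cprime_is_KL:
  assumes w: "w \<in> W"
  shows "is_KL w (Cprime S m w)"
proof -
  obtain h where h: "is_KL w h" using KL_exists[OF w] by blast
  define p where "p = (\<lambda>x. vpow (int (len w)) * h x)"
  have hp: "vpow (- int (len w)) * p x = h x" for x by (simp add: p_def vpow_mult_assoc)
  have "P_fam S m w = p"
    unfolding P_fam_def
  proof (rule the_equality)
    show "(\<forall>x. p x \<noteq> 0 \<longrightarrow> ble x w) \<and> p w = 1 \<and>
      (\<forall>x. bruhat_less S m x w \<longrightarrow> (\<forall>n. fls_nth (p x) n \<noteq> 0 \<longrightarrow> even n \<and> 0 \<le> n \<and> n \<le> int (len w) - int (len x) - 1)) \<and>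
      hiota S m (\<lambda>x. vpow (- int (len w)) * p x) = (\<lambda>x. vpow (- int (len w)) * p x)"
    proof (intro conjI allI impI)
      fix x n
      show "ble x w" if "p x \<noteq> 0" using that h by (auto simp: p_def is_KL_def)
      show "p w = 1" using h by (simp add: p_def is_KL_def vpow_add)
      show "hiota S m (\<lambda>x. vpow (- int (len w)) * p x) = (\<lambda>x. vpow (- int (len w)) * p x)"
        unfolding hp using h by (simp add: is_KL_def)
      assume "bruhat_less S m x w" "fls_nth (p x) n \<noteq> 0"
      then have "x \<noteq> w" "fls_nth (h x) (n - int (len w)) \<noteq> 0" by (auto simp: bruhat_less_def p_def)
      then have d: "- int (len w) \<le> n - int (len w) \<and> n - int (len w) \<le> - int (len x) - 1 \<and> even (n - int (len w) + int (len w))"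
        using h unfolding is_KL_def by blast
      then show "even n" "0 \<le> n" "n \<le> int (len w) - int (len x) - 1" by simp_all
    qed
  next
    fix p' assume p': "(\<forall>x. p' x \<noteq> 0 \<longrightarrow> ble x w) \<and> p' w = 1 \<and>
      (\<forall>x. bruhat_less S m x w \<longrightarrow> (\<forall>n. fls_nth (p' x) n \<noteq> 0 \<longrightarrow> even n \<and> 0 \<le> n \<and> n \<le> int (len w) - int (len x) - 1)) \<and>
      hiota S m (\<lambda>x. vpow (- int (len w)) * p' x) = (\<lambda>x. vpow (- int (len w)) * p' x)"
    define h' where "h' = (\<lambda>x. vpow (- int (len w)) * p' x)"
    have deg: "0 \<le> n \<and> n \<le> int (len w) - int (len x) - 1 \<and> even n" if "x \<noteq> w" "fls_nth (p' x) n \<noteq> 0" for x n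
    proof -
      have "p' x \<noteq> 0" using that by auto
      then have "bruhat_less S m x w" using p' that(1) by (auto simp: bruhat_less_def)
      then show ?thesis using p' that(2) by blast
    qed
    \<comment> \<open>Finite support of the coefficients follows from the degree bounds.\<close>
    have la: "laurent (p' x)" for x
    proof (cases "x = w")
      case False
      have "{n. fls_nth (p' x) n \<noteq> 0} \<subseteq> {0..int (len w)}" using deg[OF False] by force
      then show ?thesis unfolding laurent_def by (rule finite_subset) simp
    qed (use p' in simp)
    have "fsupp h'" by (rule fsupp_subset[OF finite_ble[OF w]]) (use p' ble_W in \<open>auto simp: h'_def\<close>)
    then have hk: "is_hecke S m h'" using la by (simp add: is_hecke_iff h'_def)
    have "is_KL w h'"
      unfolding is_KL_def
    proof (intro conjI allI impI)
      fix x n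
      show "is_hecke S m h'" by (rule hk)
      show "hiota S m h' = h'" using p' by (simp add: h'_def)
      show "ble x w" if "h' x \<noteq> 0" using that p' by (auto simp: h'_def)
      show "h' w = vpow (- int (len w))" using p' by (simp add: h'_def)
      assume x: "x \<noteq> w" "fls_nth (h' x) n \<noteq> 0"
      then have "fls_nth (p' x) (n + int (len w)) \<noteq> 0" by (simp add: h'_def)
      from deg[OF x(1) this] show "- int (len w) \<le> n" "n \<le> - int (len x) - 1" "even (n + int (len w))" by auto
    qed
    then have "h' = h" using is_KL_unique h by blast
    then have "vpow (- int (len w)) * p' x = vpow (- int (len w)) * p x" for x unfolding hp by (simp add: h'_def fun_eq_iff)
    then show "p' = p" using vpow_cancel by blast
  qed
  then have "Cprime S m w = h" unfolding Cprime_def using hp by simp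
  then show ?thesis using h by simp
qed

lemma Cprime_descent:
  assumes "w \<in> W" "s \<in> S" "len (lm s w) < len w"
  shows "Lg s (Cprime S m w) = (\<lambda>x. qq * Cprime S m w x)"
  using KL_exists[OF assms(1)] is_KL_unique[OF Cprime_is_KL[OF assms(1)]] assms(2,3) by metis


section \<open>The eigenvector identity in the quotient and the recursion\<close>

lemma hecke_hmul:
  assumes h: "is_hecke S m h" and g: "is_hecke S m g"
  shows "is_hecke S m (hmul S m h g)"
proof -
  have f: "finite {w. g w \<noteq> 0}" and gW: "\<And>w. g w \<noteq> 0 \<Longrightarrow> w \<in> W" using g by (auto simp: is_hecke_def)
  have "laurent (\<Sum>w | g w \<noteq> 0. g w * Rw (red_word w) h y)" for y
  proof (rule laurent_sum)
    fix w assume "w \<in> {w. g w \<noteq> 0}"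
    then have "is_hecke S m (Rw (red_word w) h)" using gW by (intro hecke_Rw[OF h] red_word_lists) simp
    then show "laurent (g w * Rw (red_word w) h y)" using g by (simp add: is_hecke_iff)
  qed
  moreover have "hmul S m h g = (\<lambda>y. \<Sum>w | g w \<noteq> 0. g w * Rw (red_word w) h y)" by (rule hmul_eq[OF f]) simp
  ultimately show ?thesis using fsupp_hmul[of h g] h g by (simp add: is_hecke_iff)
qed

text \<open>Serves to show that the coefficients of \<open>c_elem\<close> are Laurent
  polynomials.\<close>

lemma J_hecke: "h \<in> J \<Longrightarrow> is_hecke S m h"
proof (induction rule: tl_ideal.induct)
  case zero
  show ?case by (simp add: is_hecke_def)
next
  case (add h a b s t)
  have "is_hecke S m (tl_gen S m s t)" using fsupp_tl_gen[of s t] add by (simp add: is_hecke_iff) (simp add: tl_gen_def)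
  then show ?case using add hecke_hmul hecke_add by simp
qed

lemma c_elem_eq:
  assumes w: "w \<in> W"
  shows "c_elem S m w x = (if x \<in> Wc \<and> ble x w then vpow (- int (len x)) * Lpol S m x w else 0)"
proof -
  have "c_elem S m w x = (\<Sum>z\<in>{z \<in> Wc. ble z w}. if z = x then vpow (- int (len z)) * Lpol S m z w else 0)"
    unfolding c_elem_def by (rule sum.cong) (auto simp: hT_def)
  then show ?thesis using finite_Wc_ble[OF w] by simp
qed

text \<open>The coefficient of \<open>t\<^sub>y\<close> in \<open>t\<^sub>s t\<^sub>z\<close>.\<close>
definition lcoef :: "'a \<Rightarrow> 'a list set \<Rightarrow> 'a list set \<Rightarrow> int fls" where
  "lcoef s y z = (if len (lm s z) < len z then qq * hT (lm s z) y + (qq - 1) * hT z y else Dpol S m y (lm s z))"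

lemma lcoef_J:
  assumes z: "z \<in> Wc" "s \<in> S"
  shows "(\<lambda>y. Lg s (hT z) y - lcoef s y z) \<in> J"
proof -
  have W: "z \<in> W" using z Wc_W by blast
  show ?thesis
  proof (cases "len (lm s z) < len z")
    case True
    then show ?thesis using Lg_hT[OF W z(2)] tl_ideal.zero by (simp add: lcoef_def)
  next
    case False
    then have "len z < len (lm s z)" using len_lm[OF W z(2)] by auto
    then show ?thesis using Lg_hT[OF W z(2)] Dpol_props(3)[OF lm_W[OF W z(2)]] by (simp add: lcoef_def)
  qed
qed

lemma lcoef_Wc:
  assumes "z \<in> Wc" "s \<in> S" "lcoef s y z \<noteq> 0"
  shows "y \<in> Wc"
proof (cases "len (lm s z) < len z")
  case True
  then have "y = lm s z \<or> y = z" using assms(3) by (auto simp: lcoef_def hT_def split: if_splits)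
  then show ?thesis using Wc_descent[OF assms(1,2) True] assms(1) by blast
next
  case False
  then show ?thesis using assms Dpol_props(1)[OF lm_W[OF Wc_W]] by (auto simp: lcoef_def)
qed

text \<open>The coefficient of \<open>t_y\<close> in \<open>q c_w = t_s c_w\<close>. Both sides are
  supported on \<open>Wc\<close>, so by \<open>Wc_independent\<close> a congruence modulo the ideal
  is an equality.\<close>

lemma c_elem_coefficients:
  assumes P: "condP S m" and w: "w \<in> Wc" and s: "s \<in> S" and down: "len (lm s w) < len w"
  shows "qq * c_elem S m w y = (\<Sum>z\<in>{z \<in> Wc. ble z w}. c_elem S m w z * lcoef s y z)"
proof -
  let ?A = "{z \<in> Wc. ble z w}" and ?c = "c_elem S m w"
  have W: "w \<in> W" using w Wc_W by blast
  have A: "finite ?A" by (rule finite_Wc_ble[OF W])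
  have inJ: "(\<lambda>y. Cprime S m w y - ?c y) \<in> J" using P w unfolding condP_def tl_eq_def by blast
  \<comment> \<open>By condition (P), \<open>c_w\<close> is \<open>C'_w\<close> minus a member of
    the ideal, and both have Laurent coefficients.\<close>
  have la: "laurent (?c z)" for z
  proof -
    have "laurent (Cprime S m w z)" using Cprime_is_KL[OF W] by (simp add: is_KL_def is_hecke_iff)
    moreover have "laurent (Cprime S m w z - ?c z)" using J_hecke[OF inJ] by (simp add: is_hecke_iff)
    ultimately have "laurent (Cprime S m w z - (Cprime S m w z - ?c z))" by (rule laurent_diff)
    then show ?thesis by simp
  qed
  have cA: "?c z \<noteq> 0 \<Longrightarrow> z \<in> ?A" for z using c_elem_eq[OF W] by (auto split: if_splits)
  have ce: "?c = (\<lambda>y. \<Sum>z\<in>?A. ?c z * hT z y)" by (rule hT_expand[OF A cA])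
  have "Lg s (\<lambda>y. 1 * Cprime S m w y + (-1) * ?c y) \<in> J"
    using J_Lg[OF s inJ] by simp
  then have "(\<lambda>y. qq * Cprime S m w y - Lg s ?c y) \<in> J"
    unfolding Lg_lin Cprime_descent[OF W s down] by simp
  from J_diff[OF this J_scale[OF laurent_qq inJ]]
  have "(\<lambda>y. qq * ?c y - Lg s ?c y) \<in> J" by (simp add: algebra_simps)
  moreover have "(\<lambda>y. \<Sum>z\<in>?A. ?c z * (Lg s (hT z) y - lcoef s y z)) \<in> J"
    by (rule J_sum[OF A], rule J_scale[OF la], rule lcoef_J) (use s in auto)
  ultimately have "(\<lambda>y. (qq * ?c y - Lg s ?c y) + (\<Sum>z\<in>?A. ?c z * (Lg s (hT z) y - lcoef s y z))) \<in> J"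
    by (rule J_add)
  moreover have "Lg s ?c y = (\<Sum>z\<in>?A. ?c z * Lg s (hT z) y)" for y
    by (subst ce) (simp add: Lg_sum)
  then have "(qq * ?c y - Lg s ?c y) + (\<Sum>z\<in>?A. ?c z * (Lg s (hT z) y - lcoef s y z)) =
      qq * ?c y - (\<Sum>z\<in>?A. ?c z * lcoef s y z)" for y
    unfolding right_diff_distrib sum_subtractf by simp
  ultimately have "(\<lambda>y. qq * ?c y - (\<Sum>z\<in>?A. ?c z * lcoef s y z)) \<in> J" by simp
  then have "(\<lambda>y. qq * ?c y - (\<Sum>z\<in>?A. ?c z * lcoef s y z)) = (\<lambda>_. 0)"
  proof (rule Wc_independent)
    fix x assume nz: "qq * ?c x - (\<Sum>z\<in>?A. ?c z * lcoef s x z) \<noteq> 0"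
    show "x \<in> Wc"
    proof (cases "?c x = 0")
      case True
      then have "(\<Sum>z\<in>?A. ?c z * lcoef s x z) \<noteq> 0" using nz by simp
      then obtain z where "z \<in> ?A" "?c z * lcoef s x z \<noteq> 0" by (rule sum.not_neutral_contains_not_neutral)
      then show ?thesis using lcoef_Wc[OF _ s] by auto
    qed (use cA in blast)
  qed
  then show ?thesis by (simp add: fun_eq_iff)
qed

text \<open>Comparison at \<open>y = s x\<close>. The basis element \<open>t_(sx)\<close> arises in
  \<open>t_s t_z\<close> from \<open>z = x\<close>, from \<open>z = s x\<close> with coefficient
  \<open>q - 1\<close>, and from those \<open>z\<close> for which \<open>s z\<close> leaves
  \<open>Wc\<close>.\<close>

theorem L_recursion:
  assumes P: "condP S m" and x: "x \<in> Wc" and w: "w \<in> Wc" and xw: "ble x w"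
    and s: "s \<in> S" and down: "len (lm s w) < len w" and up: "len x < len (lm s x)" and sx: "lm s x \<in> Wc"
  shows "Lpol S m x w = vpow (-1) * Lpol S m (lm s x) w
    - (\<Sum>z\<in>{z \<in> Wc. bruhat_less S m x z \<and> bruhat_less S m z w \<and> lm s z \<notin> Wc}.
        vpow (int (len x) - int (len z)) * Dpol S m (lm s x) (lm s z) * Lpol S m z w)"
proof -
  have W: "x \<in> W" "w \<in> W" using x w Wc_W by blast+
  let ?A = "{z \<in> Wc. ble z w}" and ?c = "c_elem S m w"
  let ?B = "{z \<in> Wc. bruhat_less S m x z \<and> bruhat_less S m z w \<and> lm s z \<notin> Wc}"
  have A: "finite ?A" by (rule finite_Wc_ble[OF W(2)])
  have sxw: "ble (lm s x) w" by (rule ble_lift_up[OF xw s down])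
  have lsx: "len (lm s x) = Suc (len x)" using len_lm[OF W(1) s] up by simp
  have nx: "lm s x \<noteq> x" using lsx by auto
  have swc: "lm s w \<in> Wc" by (rule Wc_descent[OF w s down])
  have summand: "?c z * lcoef s (lm s x) z =
      (if z = x then ?c x else 0) + (if z = lm s x then (qq - 1) * ?c z else 0)
      + (if z \<in> ?B then ?c z * Dpol S m (lm s x) (lm s z) else 0)" if z: "z \<in> ?A" for z
  proof -
    have zW: "z \<in> W" using z Wc_W by blast
    show ?thesis
    proof (cases "len (lm s z) < len z")
      case True
      have "lm s z \<in> Wc" using Wc_descent[of z s] z s True by blast
      moreover have "z \<noteq> x" using True up by auto
      moreover have "lm s x \<noteq> lm s z" using \<open>z \<noteq> x\<close> zW W s by (metis lm_lm)
      ultimately show ?thesis using True by (auto simp: lcoef_def hT_def)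
    next
      case False
      then have zup: "len z < len (lm s z)" using len_lm[OF zW s] by auto
      have zn: "z \<noteq> lm s x" using False lsx W s by auto
      show ?thesis
      proof (cases "lm s z \<in> Wc")
        case True
        have "lm s x = lm s z \<longleftrightarrow> z = x" using zW W s by (metis lm_lm)
        then show ?thesis using False zn True by (auto simp: lcoef_def Dpol_Wc)
      next
        case nWc: False
        have "z \<noteq> x" using nWc sx by blast
        \<comment> \<open>Lifting turns \<open>sx \<le> sz\<close> into \<open>x \<le> z\<close>.
          The ends \<open>x\<close> and \<open>w\<close> are excluded because \<open>s x\<close> and
          \<open>s w\<close> are fully commutative.\<close>
        have "z \<in> ?B" if D: "Dpol S m (lm s x) (lm s z) \<noteq> 0"
        proof -
          have "ble (lm s x) (lm s z)" using Dpol_props(1)[OF lm_W[OF zW s] D] by blast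
          then have "ble (lm s (lm s x)) (lm s (lm s z))" by (rule ble_lift_down[OF _ s]) (use W s up in simp)
          then have "ble x z" using W zW s by simp
          moreover have "z \<noteq> w" using nWc swc by blast
          ultimately show ?thesis using z nWc \<open>z \<noteq> x\<close> by (auto simp: bruhat_less_def)
        qed
        then show ?thesis using False zn \<open>z \<noteq> x\<close> by (auto simp: lcoef_def)
      qed
    qed
  qed
  have "qq * ?c (lm s x) = (\<Sum>z\<in>?A. ?c z * lcoef s (lm s x) z)"
    by (rule c_elem_coefficients[OF P w s down])
  also have "\<dots> = (\<Sum>z\<in>?A. (if z = x then ?c x else 0) + (if z = lm s x then (qq - 1) * ?c z else 0)
      + (if z \<in> ?B then ?c z * Dpol S m (lm s x) (lm s z) else 0))"
    by (rule sum.cong[OF refl summand])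
  also have "\<dots> = ?c x + (qq - 1) * ?c (lm s x) + (\<Sum>z\<in>?A. if z \<in> ?B then ?c z * Dpol S m (lm s x) (lm s z) else 0)"
    unfolding sum.distrib using A x xw sx sxw by simp
  also have "(\<Sum>z\<in>?A. if z \<in> ?B then ?c z * Dpol S m (lm s x) (lm s z) else 0) = (\<Sum>z\<in>?B. ?c z * Dpol S m (lm s x) (lm s z))"
  proof -
    have "?B \<subseteq> ?A" by (auto simp: bruhat_less_def)
    then have "?A \<inter> ?B = ?B" by blast
    then show ?thesis using sum.inter_restrict[OF A, of "\<lambda>z. ?c z * Dpol S m (lm s x) (lm s z)" ?B] by simp
  qed
  \<comment> \<open>The terms with factor \<open>q\<close> cancel, leaving a single copy of the
    coefficient at \<open>s x\<close>.\<close>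
  finally have main: "?c x = ?c (lm s x) - (\<Sum>z\<in>?B. ?c z * Dpol S m (lm s x) (lm s z))"
    by (simp add: algebra_simps)
  \<comment> \<open>The factor \<open>vpow (-1)\<close> of the recursion arises here,
    \<open>s x\<close> being one longer than \<open>x\<close>.\<close>
  have cx: "?c x = vpow (- int (len x)) * Lpol S m x w" "?c (lm s x) = vpow (- 1 - int (len x)) * Lpol S m (lm s x) w"
    using c_elem_eq[OF W(2)] x xw sx sxw lsx by simp_all
  have cz: "?c z = vpow (- int (len z)) * Lpol S m z w" if "z \<in> ?B" for z
    using c_elem_eq[OF W(2), of z] that by (auto simp: bruhat_less_def)
  have "Lpol S m x w = vpow (int (len x)) * ?c x" unfolding cx by (simp add: vpow_mult_assoc)
  also have "\<dots> = vpow (-1) * Lpol S m (lm s x) w - (\<Sum>z\<in>?B. vpow (int (len x)) * (?c z * Dpol S m (lm s x) (lm s z)))"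
    unfolding main right_diff_distrib cx(2) sum_distrib_left by (simp add: vpow_mult_assoc)
  also have "(\<Sum>z\<in>?B. vpow (int (len x)) * (?c z * Dpol S m (lm s x) (lm s z))) =
      (\<Sum>z\<in>?B. vpow (int (len x) - int (len z)) * Dpol S m (lm s x) (lm s z) * Lpol S m z w)"
  proof (rule sum.cong)
    fix z assume z: "z \<in> ?B"
    have "vpow (int (len x)) * (?c z * Dpol S m (lm s x) (lm s z)) =
        (vpow (int (len x)) * vpow (- int (len z))) * Dpol S m (lm s x) (lm s z) * Lpol S m z w"
      unfolding cz[OF z] by (simp only: mult.assoc mult.left_commute mult.commute)
    then show "vpow (int (len x)) * (?c z * Dpol S m (lm s x) (lm s z)) =
        vpow (int (len x) - int (len z)) * Dpol S m (lm s x) (lm s z) * Lpol S m z w"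
      by (simp add: vpow_add)
  qed simp
  finally show ?thesis .
qed

end

theorem mainTheorem18:
  fixes S :: "'a set" and m :: "'a \<Rightarrow> 'a \<Rightarrow> enat" and x w :: "'a list set" and s :: 'a
  assumes "coxeter_graph S m"
    and "condP S m"
    and "x \<in> cox_Wc S m" and "w \<in> cox_Wc S m"
    and "bruhat_less S m x w"
    and "s \<in> S"
    and "cox_len (cox_mult S m (cox_gen S m s) w) < cox_len w"
    and "bruhat_less S m x (cox_mult S m (cox_gen S m s) x)"
    and "cox_mult S m (cox_gen S m s) x \<in> cox_Wc S m"
  shows "Lpol S m x w =
           vpow (-1) * Lpol S m (cox_mult S m (cox_gen S m s) x) w
         - (\<Sum>z\<in>{z \<in> cox_Wc S m. bruhat_less S m x z \<and> bruhat_less S m z w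
                                 \<and> cox_mult S m (cox_gen S m s) z \<notin> cox_Wc S m}.
              vpow (int (cox_len x) - int (cox_len z))
              * Dpol S m (cox_mult S m (cox_gen S m s) x) (cox_mult S m (cox_gen S m s) z)
              * Lpol S m z w)"
proof -
  interpret coxeter S m by unfold_locales (rule assms(1))
  have "len x < len (lm s x)" using assms(8) ble_len by (auto simp: bruhat_less_def)
  then show ?thesis
    using L_recursion[OF assms(2-4) _ assms(6,7) _ assms(9)] assms(5) by (simp add: bruhat_less_def)
qed

end
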